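(* Let $\mu,\lambda,\gamma$ be real constants with $\mu>0$, $2\mu+3\lambda\ge 0$ and $\gamma>1$. Assume that the initial data $(\rho_0,\mathbf u_0)$ satisfy $0\le\rho_0\in W^{1,q}(\mathbb T^3)$ for some $q\in(3,6]$, $\mathbf u_0\in H^2(\mathbb T^3)$ and $$\frac{1}{|\mathbb T^3|}\int_{\mathbb T^3}\rho_0(\mathbf x)\,\mathrm d\mathbf x=1,$$ and that $$K:=\|\rho_0-1\|_{L^2(\mathbb T^3)}+\|\sqrt{\rho_0}(\mathbf u_0-\mathbf m_0)\|_{L^2(\mathbb T^3)}+\|\nabla\mathbf u_0\|_{L^2(\mathbb T^3)}<+\infty,\qquad \mathbf m_0:=\int_{\mathbb T^3}\rho_0\mathbf u_0(\mathbf x)\,\mathrm d\mathbf x .$$ Let $(\rho,\mathbf u)$ be a global strong solution of the compressible Navier--Stokes problem on $\mathbb T^3$ (with parameters $\mu,\lambda,\gamma$) with initial data $(\rho_0,\mathbf u_0)$, verifying $$\sup_{t\ge 0}\|\rho(\cdot,t)\|_{L^\infty(\mathbb T^3)}\le M$$ for some positive constant $M$. If additionally $\inf_{\mathbf x\in\mathbb T^3}\rho_0(\mathbf x)=0$, then $$\inf_{\mathbf x\in\mathbb T^3}\rho(\mathbf x,t)=0$$ for any $t\ge0$.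
   Context: $\mathbb T^3$ is the three-dimensional torus, normalized to have volume $|\mathbb T^3|=1$. Function spaces of vector-valued functions are denoted by the same symbol as for scalar functions. The compressible Navier--Stokes problem is $$\rho_t+\mathrm{div}(\rho\mathbf u)=0,\qquad (\rho\mathbf u)_t+\mathrm{div}(\rho\mathbf u\otimes\mathbf u)+\nabla P(\rho)=\mu\Delta\mathbf u+(\mu+\lambda)\nabla\mathrm{div}\,\mathbf u,$$ for the density $\rho=\rho(\mathbf x,t)$ and velocity $\mathbf u=\mathbf u(\mathbf x,t)\in\mathbb R^3$, $\mathbf x\in\mathbb T^3$, $t\ge0$, with $P(\rho)=\rho^\gamma$, and initial condition $(\rho,\rho\mathbf u)|_{t=0}=(\rho_0,\rho_0\mathbf u_0)$. For $T>0$, $(\rho,\mathbf u)$ is a strong solution on $\mathbb T^3\times[0,T]$ if for some $q\in(3,6]$: $0\le\rho\in C([0,T];W^{1,q}(\mathbb T^3))$, $\rho_t\in C([0,T];L^q(\mathbb T^3))$, $\mathbf u\in C([0,T];H^2(\mathbb T^3))\cap L^2(0,T;W^{2,q}(\mathbb T^3))$, $\mathbf u_t\in L^2(0,T;H^1(\mathbb T^3))$, $\sqrt\rho\,\mathbf u_t\in L^\infty(0,T;L^2(\mathbb T^3))$, the equations hold a.e. on $\mathbb T^3\times[0,T]$, and the initial condition holds. A global strong solution is a pair defined for all $t\ge0$ that is a strong solution on $\mathbb T^3\times[0,T]$ for every $T>0$. *)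

theory Defs
  imports "HOL-Analysis.Analysis" "HOL-Probability.Essential_Supremum"
begin

section \<open>The torus of volume one\<close>

text \<open>Functions on the torus are functions on \<open>\<real>\<^sup>3\<close> that have period 1 in each coordinate; they
  are integrated over a unit cell.\<close>

definition unit_cell :: "(real^3) set" where
  "unit_cell = {x. \<forall>i. 0 \<le> x $ i \<and> x $ i < 1}"

definition torus :: "(real^3) measure" where
  "torus = lebesgue_on unit_cell"

definition periodic :: "(real^3 \<Rightarrow> 'b) \<Rightarrow> bool" where
  "periodic f \<longleftrightarrow> (\<forall>x i. f (x + axis i 1) = f x)"

definition spacetime :: "real \<Rightarrow> (real \<times> (real^3)) measure" where
  "spacetime T = lebesgue_on ({0..T} \<times> unit_cell)"


section \<open>Weak derivatives\<close>

primrec iter_dderiv :: "'a::euclidean_space list \<Rightarrow> ('a \<Rightarrow> real) \<Rightarrow> 'a \<Rightarrow> real" where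
  "iter_dderiv [] f = f"
| "iter_dderiv (e # es) f = (\<lambda>x. frechet_derivative (iter_dderiv es f) (at x) e)"

text \<open>Smoothness: all iterated directional derivatives are (Frechet) differentiable, hence
  continuous.\<close>

definition smooth :: "('a::euclidean_space \<Rightarrow> real) \<Rightarrow> bool" where
  "smooth f \<longleftrightarrow> (\<forall>es. iter_dderiv es f differentiable_on UNIV)"

definition torus_tests :: "(real^3 \<Rightarrow> real) set" where
  "torus_tests = {\<phi>. smooth \<phi> \<and> periodic \<phi>}"

text \<open>Test functions on the product of the open time interval \<open>(0,T)\<close> with the torus: compact
  support in time, periodicity in space.\<close>

definition spacetime_tests :: "real \<Rightarrow> (real \<times> (real^3) \<Rightarrow> real) set" where
  "spacetime_tests T = {\<phi>. smooth \<phi> \<and> (\<forall>t. periodic (\<lambda>x. \<phi> (t, x))) \<and>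
     (\<exists>a b. 0 < a \<and> b < T \<and> (\<forall>t x. t \<notin> {a..b} \<longrightarrow> \<phi> (t, x) = 0))}"

text \<open>\<open>weak_deriv \<Phi> \<Omega> es f g\<close>: the integrable function \<open>g\<close> is the iterated derivative of \<open>f\<close> in the
  directions \<open>es\<close> in the sense of distributions, tested against \<open>\<Phi>\<close>. It determines \<open>g\<close> only almost
  everywhere.\<close>

definition weak_deriv ::
  "('a::euclidean_space \<Rightarrow> real) set \<Rightarrow> 'a measure \<Rightarrow> 'a list \<Rightarrow>
   ('a \<Rightarrow> 'b::euclidean_space) \<Rightarrow> ('a \<Rightarrow> 'b) \<Rightarrow> bool" where
  "weak_deriv \<Phi> \<Omega> es f g \<longleftrightarrow> integrable \<Omega> f \<and> integrable \<Omega> g \<and>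
     (\<forall>\<phi>\<in>\<Phi>. (\<integral>z. iter_dderiv es \<phi> z *\<^sub>R f z \<partial>\<Omega>) =
             (- 1) ^ length es *\<^sub>R (\<integral>z. \<phi> z *\<^sub>R g z \<partial>\<Omega>))"

text \<open>On the torus, \<open>weak_dx [j\<^sub>1, \<dots>, j\<^sub>m]\<close> refers to the partial derivative of order \<open>m\<close>
  in the coordinates \<open>j\<^sub>1, \<dots>, j\<^sub>m\<close>.\<close>

definition weak_dx :: "3 list \<Rightarrow> (real^3 \<Rightarrow> 'b::euclidean_space) \<Rightarrow> (real^3 \<Rightarrow> 'b) \<Rightarrow> bool" where
  "weak_dx js = weak_deriv torus_tests torus (map (\<lambda>j. axis j 1) js)"

definition dx :: "3 list \<Rightarrow> (real^3 \<Rightarrow> 'b::euclidean_space) \<Rightarrow> real^3 \<Rightarrow> 'b" where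
  "dx js f = (SOME g. weak_dx js f g)"

definition weak_grad :: "(real^3 \<Rightarrow> 'b::euclidean_space) \<Rightarrow> real^3 \<Rightarrow> 'b^3" where
  "weak_grad f x = (\<chi> j. dx [j] f x)"

definition st_weak_dt ::
  "real \<Rightarrow> (real \<Rightarrow> real^3 \<Rightarrow> 'b::euclidean_space) \<Rightarrow> (real \<Rightarrow> real^3 \<Rightarrow> 'b) \<Rightarrow> bool" where
  "st_weak_dt T f g \<longleftrightarrow>
     weak_deriv (spacetime_tests T) (spacetime T) [(1, 0)] (case_prod f) (case_prod g)"

definition st_weak_dx ::
  "real \<Rightarrow> 3 list \<Rightarrow> (real \<Rightarrow> real^3 \<Rightarrow> 'b::euclidean_space) \<Rightarrow> (real \<Rightarrow> real^3 \<Rightarrow> 'b) \<Rightarrow> bool" where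
  "st_weak_dx T js f g \<longleftrightarrow>
     weak_deriv (spacetime_tests T) (spacetime T) (map (\<lambda>j. (0, axis j 1)) js)
       (case_prod f) (case_prod g)"


section \<open>Function spaces\<close>

definition Lp_norm :: "real \<Rightarrow> (real^3 \<Rightarrow> 'b::euclidean_space) \<Rightarrow> ennreal" where
  "Lp_norm p f =
     (let I = \<integral>\<^sup>+x. ennreal (norm (f x) powr p) \<partial>torus
      in if I = \<infinity> then \<infinity> else ennreal (enn2real I powr (1 / p)))"

definition Linf_norm :: "(real^3 \<Rightarrow> 'b::euclidean_space) \<Rightarrow> ennreal" where
  "Linf_norm f = esssup torus (\<lambda>x. ennreal (norm (f x)))"

definition Lp_space :: "real \<Rightarrow> (real^3 \<Rightarrow> 'b::euclidean_space) set" where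
  "Lp_space p = {f. periodic f \<and> f \<in> borel_measurable torus \<and> Lp_norm p f < \<infinity>}"

text \<open>\<open>sobolev k p\<close> is \<open>W\<^sup>k\<^sup>,\<^sup>p\<close>; in particular \<open>sobolev k 2\<close> is \<open>H\<^sup>k\<close>, and \<open>sobolev 0 p\<close> is
  \<open>L\<^sup>p\<close> (for \<open>p \<ge> 1\<close>). In the norm, a mixed partial derivative is counted once for each ordering
  of its coordinates, which gives an equivalent norm.\<close>

definition sobolev :: "nat \<Rightarrow> real \<Rightarrow> (real^3 \<Rightarrow> 'b::euclidean_space) set" where
  "sobolev k p = {f \<in> Lp_space p. \<forall>js. length js \<le> k \<longrightarrow> (\<exists>g\<in>Lp_space p. weak_dx js f g)}"

definition sobolev_norm :: "nat \<Rightarrow> real \<Rightarrow> (real^3 \<Rightarrow> 'b::euclidean_space) \<Rightarrow> ennreal" where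
  "sobolev_norm k p f = (\<Sum>js | length js \<le> k. Lp_norm p (dx js f))"

text \<open>\<open>C([0,T]; W\<^sup>k\<^sup>,\<^sup>p)\<close>\<close>

definition C_sobolev :: "real \<Rightarrow> nat \<Rightarrow> real \<Rightarrow> (real \<Rightarrow> real^3 \<Rightarrow> 'b::euclidean_space) set" where
  "C_sobolev T k p = {f. \<forall>t\<in>{0..T}. f t \<in> sobolev k p \<and>
     ((\<lambda>s. sobolev_norm k p (\<lambda>x. f s x - f t x)) \<longlongrightarrow> 0) (at t within {0..T})}"

text \<open>\<open>L\<^sup>2(0,T; W\<^sup>k\<^sup>,\<^sup>p)\<close>. Since \<open>W\<^sup>k\<^sup>,\<^sup>p\<close> is separable for finite \<open>p\<close>, strong measurability in time
  amounts to joint measurability of a representative.\<close>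

definition L2_sobolev :: "real \<Rightarrow> nat \<Rightarrow> real \<Rightarrow> (real \<Rightarrow> real^3 \<Rightarrow> 'b::euclidean_space) set" where
  "L2_sobolev T k p = {f. case_prod f \<in> borel_measurable (spacetime T) \<and>
     (AE t in lebesgue_on {0..T}. f t \<in> sobolev k p) \<and>
     (\<integral>\<^sup>+t. (sobolev_norm k p (f t))\<^sup>2 \<partial>lebesgue_on {0..T}) < \<infinity>}"

text \<open>\<open>L\<^sup>\<infinity>(0,T; L\<^sup>p)\<close>\<close>

definition Linf_Lp :: "real \<Rightarrow> real \<Rightarrow> (real \<Rightarrow> real^3 \<Rightarrow> 'b::euclidean_space) set" where
  "Linf_Lp T p = {f. case_prod f \<in> borel_measurable (spacetime T) \<and>
     (AE t in lebesgue_on {0..T}. f t \<in> Lp_space p) \<and>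
     esssup (lebesgue_on {0..T}) (\<lambda>t. Lp_norm p (f t)) < \<infinity>}"

text \<open>Elements of \<open>W\<^sup>1\<^sup>,\<^sup>q\<close> with \<open>q > 3\<close> have a unique continuous representative (Morrey); pointwise
  infima of such functions refer to it.\<close>

definition cont_rep :: "(real^3 \<Rightarrow> real) \<Rightarrow> real^3 \<Rightarrow> real" where
  "cont_rep f = (SOME g. continuous_on UNIV g \<and> periodic g \<and> (AE x in torus. g x = f x))"


section \<open>The compressible Navier--Stokes problem\<close>

definition continuity_eq ::
  "real \<Rightarrow> (real \<Rightarrow> real^3 \<Rightarrow> real) \<Rightarrow> (real \<Rightarrow> real^3 \<Rightarrow> real^3) \<Rightarrow> bool" where
  "continuity_eq T \<rho> u \<longleftrightarrow>
     (\<exists>\<rho>\<^sub>t flux.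
        st_weak_dt T \<rho> \<rho>\<^sub>t \<and>
        (\<forall>j. st_weak_dx T [j] (\<lambda>t x. \<rho> t x * u t x $ j) (flux j)) \<and>
        (AE (t, x) in spacetime T. \<rho>\<^sub>t t x + (\<Sum>j\<in>UNIV. flux j t x) = 0))"

text \<open>The \<open>i\<close>-th component of the momentum equation; the existentially quantified functions are
  \<open>(\<rho>u\<^sub>i)\<^sub>t\<close>, \<open>\<partial>\<^sub>j(\<rho>u\<^sub>iu\<^sub>j)\<close>, \<open>\<partial>\<^sub>iP(\<rho>)\<close>, \<open>\<partial>\<^sub>j\<partial>\<^sub>ju\<^sub>i\<close> and \<open>\<partial>\<^sub>i\<partial>\<^sub>ju\<^sub>j\<close>.\<close>

definition momentum_eq ::
  "real \<Rightarrow> real \<Rightarrow> real \<Rightarrow> real \<Rightarrow> (real \<Rightarrow> real^3 \<Rightarrow> real) \<Rightarrow> (real \<Rightarrow> real^3 \<Rightarrow> real^3) \<Rightarrow>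
   3 \<Rightarrow> bool" where
  "momentum_eq \<mu> lam \<gamma> T \<rho> u i \<longleftrightarrow>
     (\<exists>mom\<^sub>t conv gradP lap graddiv.
        st_weak_dt T (\<lambda>t x. \<rho> t x * u t x $ i) mom\<^sub>t \<and>
        (\<forall>j. st_weak_dx T [j] (\<lambda>t x. \<rho> t x * u t x $ i * u t x $ j) (conv j)) \<and>
        st_weak_dx T [i] (\<lambda>t x. \<rho> t x powr \<gamma>) gradP \<and>
        (\<forall>j. st_weak_dx T [j, j] (\<lambda>t x. u t x $ i) (lap j)) \<and>
        (\<forall>j. st_weak_dx T [i, j] (\<lambda>t x. u t x $ j) (graddiv j)) \<and>
        (AE (t, x) in spacetime T.
           mom\<^sub>t t x + (\<Sum>j\<in>UNIV. conv j t x) + gradP t x =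
           \<mu> * (\<Sum>j\<in>UNIV. lap j t x) + (\<mu> + lam) * (\<Sum>j\<in>UNIV. graddiv j t x)))"

definition strong_solution ::
  "real \<Rightarrow> real \<Rightarrow> real \<Rightarrow> (real^3 \<Rightarrow> real) \<Rightarrow> (real^3 \<Rightarrow> real^3) \<Rightarrow> real \<Rightarrow>
   (real \<Rightarrow> real^3 \<Rightarrow> real) \<Rightarrow> (real \<Rightarrow> real^3 \<Rightarrow> real^3) \<Rightarrow> bool" where
  "strong_solution \<mu> lam \<gamma> \<rho>\<^sub>0 u\<^sub>0 T \<rho> u \<longleftrightarrow>
     (\<exists>q. 3 < q \<and> q \<le> 6 \<and>
        case_prod \<rho> \<in> borel_measurable (spacetime T) \<and>
        case_prod u \<in> borel_measurable (spacetime T) \<and>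
        (\<forall>t\<in>{0..T}. AE x in torus. 0 \<le> \<rho> t x) \<and>
        \<rho> \<in> C_sobolev T 1 q \<and>
        (\<exists>\<rho>\<^sub>t. st_weak_dt T \<rho> \<rho>\<^sub>t \<and> \<rho>\<^sub>t \<in> C_sobolev T 0 q) \<and>
        u \<in> C_sobolev T 2 2 \<and>
        u \<in> L2_sobolev T 2 q \<and>
        (\<exists>u\<^sub>t. st_weak_dt T u u\<^sub>t \<and> u\<^sub>t \<in> L2_sobolev T 1 2 \<and>
              (\<lambda>t x. sqrt (\<rho> t x) *\<^sub>R u\<^sub>t t x) \<in> Linf_Lp T 2)) \<and>
     continuity_eq T \<rho> u \<and>
     (\<forall>i. momentum_eq \<mu> lam \<gamma> T \<rho> u i) \<and>
     (AE x in torus. \<rho> 0 x = \<rho>\<^sub>0 x \<and> \<rho> 0 x *\<^sub>R u 0 x = \<rho>\<^sub>0 x *\<^sub>R u\<^sub>0 x)"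

definition global_strong_solution ::
  "real \<Rightarrow> real \<Rightarrow> real \<Rightarrow> (real^3 \<Rightarrow> real) \<Rightarrow> (real^3 \<Rightarrow> real^3) \<Rightarrow>
   (real \<Rightarrow> real^3 \<Rightarrow> real) \<Rightarrow> (real \<Rightarrow> real^3 \<Rightarrow> real^3) \<Rightarrow> bool" where
  "global_strong_solution \<mu> lam \<gamma> \<rho>\<^sub>0 u\<^sub>0 \<rho> u \<longleftrightarrow>
     (\<forall>T>0. strong_solution \<mu> lam \<gamma> \<rho>\<^sub>0 u\<^sub>0 T \<rho> u)"

end

theory Submission
  imports Defs "HOL-Computational_Algebra.Polynomial"
begin

text \<open>
  Along a particle path the continuity equation reads \<open>(log \<rho>)\<^sub>t = - div u\<close>. A positive lower bound
  of \<open>\<rho>\<close> at a time \<open>T\<close> therefore persists backwards in time, up to the factor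
  \<open>exp (- \<integral>\<^bsub>0\<^esub>\<^bsup>T\<^esup> sup \<bar>div u\<bar>)\<close>. The integral is finite because \<open>u\<close> lies in \<open>L\<^sup>2(0,T; W\<^sup>2\<^sup>,\<^sup>q)\<close>
  with \<open>q > 3\<close>, which makes \<open>u(t)\<close> Lipschitz in space with a constant that is square integrable in
  time. If the initial density has infimum zero, no later density can have a positive infimum.

  No flow map is constructed. Let \<open>k\<close> be a smooth kernel of mass one, supported in a cube of
  half-width \<open>\<epsilon>\<close>, and let \<open>r(t,x) = \<integral> \<rho>(t,y) k(y - x) dy\<close>. The weak continuity equation makes \<open>r\<close>
  continuously differentiable in time with \<open>r\<^sub>t = \<integral> \<rho> u \<cdot> \<nabla>k\<close> (\<open>continuity_weak\<close>,
  \<open>du_bois_reymond\<close>, \<open>r_integral\<close>). At a point where \<open>r(t,\<cdot>)\<close> is minimal, \<open>\<integral> \<rho> \<nabla>k = 0\<close>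
  (\<open>mol_critical\<close>), so a constant vector \<open>v\<close> may be subtracted from \<open>u\<close>, and
  \<open>r\<^sub>t \<le> (sup \<rho>) \<integral> \<bar>u - v\<bar> \<bar>\<nabla>k\<bar>\<close>, the supremum being over the cube (\<open>flux_bound\<close>). With \<open>v\<close> the local
  average of \<open>u\<close>, the integral is at most a multiple of the Lipschitz constant of \<open>u(t)\<close>,
  independently of \<open>\<epsilon>\<close> (\<open>defect_lip\<close>), and \<open>sup \<rho>\<close> exceeds the minimum of \<open>r\<close> by at most
  a multiple of a power of \<open>\<epsilon>\<close>. This is a
  Gronwall inequality for the minimum, which a comparison function turns into a lower bound at time
  zero (\<open>barrier\<close>, \<open>lower_bound\<close>). Letting \<open>\<epsilon>\<close> tend to zero gives \<open>initial_lower_bound\<close>.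

  The continuous representatives come from Morrey's embedding, proved by the same kernels: two
  one-dimensional kernels of mass one differ by the derivative of a function that is bounded by one
  and supported in the same interval, so the weak gradient controls the difference of two averages
  (\<open>exchange_factor\<close>, \<open>oscillation\<close>). Averages over shrinking cubes then converge uniformly
  (\<open>morrey\<close>). Hoelder exponent \<open>1 - 3/q\<close> belongs to a gradient in \<open>L\<^sup>q\<close>, and exponent one, that is
  the Lipschitz bound for \<open>u\<close>, to a bounded gradient.
\<close>


section \<open>Smooth functions\<close>

text \<open>Smoothness asks for all iterated derivatives at once. A class of differentiable functions that is
  closed under directional derivatives contains with a function all of these, which replaces
  formulas for the iterated derivatives of products and compositions.\<close>

lemma smooth_coinduct:
  assumes "f \<in> C" "\<And>h. h \<in> C \<Longrightarrow> h differentiable_on UNIV"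
    "\<And>h e. h \<in> C \<Longrightarrow> (\<lambda>x. frechet_derivative h (at x) e) \<in> C"
  shows "smooth f"
proof -
  have "iter_dderiv es f \<in> C" for es
    by (induction es) (use assms in auto)
  then show ?thesis using assms(2) by (auto simp: smooth_def)
qed

lemma iter_dderiv_append: "iter_dderiv (es @ fs) f = iter_dderiv es (iter_dderiv fs f)"
  by (induction es) auto

lemma smooth_dderiv:
  assumes "smooth f"
  shows "smooth (\<lambda>x. frechet_derivative f (at x) e)"
proof -
  have "iter_dderiv es (\<lambda>x. frechet_derivative f (at x) e) = iter_dderiv (es @ [e]) f" for es
    by (simp add: iter_dderiv_append)
  then show ?thesis using assms unfolding smooth_def by presburger
qed

lemma smooth_differentiable: "smooth f \<Longrightarrow> f differentiable (at x)"
  unfolding smooth_def differentiable_on_def using iter_dderiv.simps(1)[of f] by (metis UNIV_I)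

lemma smooth_has_derivative: "smooth f \<Longrightarrow> (f has_derivative frechet_derivative f (at x)) (at x)"
  using frechet_derivative_works smooth_differentiable by blast

lemma smooth_continuous_on: "smooth f \<Longrightarrow> continuous_on S f"
  by (meson continuous_at_imp_continuous_on differentiable_imp_continuous_within smooth_differentiable)

lemma frechet_derivative_real:
  fixes b :: "real \<Rightarrow> real"
  assumes "b differentiable (at x)"
  shows "frechet_derivative b (at x) e = deriv b x * e"
proof -
  have "(b has_real_derivative deriv b x) (at x)"
    using assms DERIV_imp_deriv real_differentiable_def by blast
  then have "(b has_derivative (\<lambda>e. deriv b x * e)) (at x)"
    by (simp add: has_field_derivative_def)
  from frechet_derivative_at[OF this] show ?thesis by metis
qed

lemma smooth_has_real_derivative:
  fixes b :: "real \<Rightarrow> real"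
  assumes "smooth b"
  shows "(b has_real_derivative deriv b x) (at x)"
  using smooth_differentiable[OF assms, of x] DERIV_imp_deriv real_differentiable_def by blast

lemma smooth_deriv:
  fixes b :: "real \<Rightarrow> real"
  assumes "smooth b"
  shows "smooth (deriv b)"
proof -
  have "(\<lambda>x. frechet_derivative b (at x) 1) = deriv b"
    using frechet_derivative_real[OF smooth_differentiable[OF assms]] by auto
  then show ?thesis using smooth_dderiv[OF assms, of 1] by simp
qed

lemma smooth_real_coinduct:
  fixes f :: "real \<Rightarrow> real"
  assumes "f \<in> C" "\<And>h c. h \<in> C \<Longrightarrow> (\<lambda>x. h x * c) \<in> C"
    "\<And>h. h \<in> C \<Longrightarrow> \<exists>h'\<in>C. \<forall>x. (h has_real_derivative h' x) (at x)"
  shows "smooth f"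
proof (rule smooth_coinduct[OF assms(1)])
  fix h e assume h: "h \<in> C"
  then obtain h' where h': "h' \<in> C" "\<And>x. (h has_real_derivative h' x) (at x)"
    using assms(3) by blast
  then show D: "h differentiable_on UNIV"
    by (meson differentiable_at_imp_differentiable_on real_differentiable_def)
  have "(\<lambda>x. frechet_derivative h (at x) e) = (\<lambda>x. h' x * e)"
    by (metis DERIV_imp_deriv frechet_derivative_real h'(2) real_differentiable_def)
  then show "(\<lambda>x. frechet_derivative h (at x) e) \<in> C" using assms(2) h' by simp
qed

lemma smooth_const [simp]: "smooth (\<lambda>_. k)"
proof (rule smooth_coinduct[where C = "range (\<lambda>k _. k)"])
  fix h :: "'a \<Rightarrow> real" and e assume "h \<in> range (\<lambda>k _. k)"
  then obtain k where "h = (\<lambda>_. k)" by auto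
  then show "h differentiable_on UNIV" "(\<lambda>x. frechet_derivative h (at x) e) \<in> range (\<lambda>k _. k)"
    by (auto simp: frechet_derivative_const)
qed auto

text \<open>The closure of the smooth functions under sums, products and composition of a smooth function of
  one variable with an affine one. The chain and product rules stay inside this class, so it
  consists of smooth functions.\<close>

inductive smooth_alg :: "('a::euclidean_space \<Rightarrow> real) \<Rightarrow> bool" where
  smooth: "smooth f \<Longrightarrow> smooth_alg f"
| ridge: "smooth b \<Longrightarrow> smooth_alg (\<lambda>z. b (z \<bullet> c + d))"
| add: "smooth_alg f \<Longrightarrow> smooth_alg g \<Longrightarrow> smooth_alg (\<lambda>z. f z + g z)"
| mult: "smooth_alg f \<Longrightarrow> smooth_alg g \<Longrightarrow> smooth_alg (\<lambda>z. f z * g z)"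

lemma ridge_has_derivative:
  fixes b :: "real \<Rightarrow> real"
  assumes "smooth b"
  shows "((\<lambda>z. b (z \<bullet> c + d)) has_derivative (\<lambda>e. deriv b (z \<bullet> c + d) * (e \<bullet> c))) (at z)"
proof -
  have "((\<lambda>z. z \<bullet> c + d) has_derivative (\<lambda>e. e \<bullet> c)) (at z)"
    by (auto intro!: derivative_eq_intros)
  from has_derivative_compose[OF this, of b "\<lambda>e. deriv b (z \<bullet> c + d) * e"]
  show ?thesis using smooth_has_real_derivative[OF assms] by (simp add: has_field_derivative_def)
qed

lemma smooth_alg_dderiv:
  "smooth_alg f \<Longrightarrow> (\<forall>z. f differentiable (at z)) \<and> (\<forall>e. smooth_alg (\<lambda>z. frechet_derivative f (at z) e))"
proof (induction rule: smooth_alg.induct)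
  case (smooth f)
  then show ?case by (simp add: smooth_alg.smooth smooth_dderiv smooth_differentiable)
next
  case (ridge b c d)
  have "frechet_derivative (\<lambda>z. b (z \<bullet> c + d)) (at z) = (\<lambda>e. deriv b (z \<bullet> c + d) * (e \<bullet> c))" for z
    using frechet_derivative_at[OF ridge_has_derivative[OF ridge]] by metis
  moreover have "smooth_alg (\<lambda>z. deriv b (z \<bullet> c + d) * (e \<bullet> c))" for e
    by (intro smooth_alg.mult smooth_alg.ridge smooth_deriv ridge smooth_alg.smooth[OF smooth_const])
  moreover have "(\<lambda>z. b (z \<bullet> c + d)) differentiable (at z)" for z
    by (rule differentiableI[OF ridge_has_derivative[OF ridge]])
  ultimately show ?case by simp
next
  case (add f g)
  have "frechet_derivative (\<lambda>z. f z + g z) (at z) = (\<lambda>e. frechet_derivative f (at z) e + frechet_derivative g (at z) e)" for z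
    using add.IH
    by (intro frechet_derivative_at[symmetric] has_derivative_add) (auto simp: frechet_derivative_works[symmetric])
  then show ?case using add.IH by (auto intro: smooth_alg.add)
next
  case (mult f g)
  have "frechet_derivative (\<lambda>z. f z * g z) (at z) = (\<lambda>e. f z * frechet_derivative g (at z) e + frechet_derivative f (at z) e * g z)" for z
    using mult.IH
    by (intro frechet_derivative_at[symmetric] has_derivative_mult) (auto simp: frechet_derivative_works[symmetric])
  then show ?case using mult by (auto intro!: smooth_alg.add smooth_alg.mult)
qed

lemma smooth_alg_smooth: "smooth_alg f \<Longrightarrow> smooth f"
  by (rule smooth_coinduct[where C = "Collect smooth_alg"])
    (auto dest: smooth_alg_dderiv simp: differentiable_at_imp_differentiable_on)

lemma smooth_add: "smooth f \<Longrightarrow> smooth g \<Longrightarrow> smooth (\<lambda>z. f z + g z)"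
  and smooth_mult: "smooth f \<Longrightarrow> smooth g \<Longrightarrow> smooth (\<lambda>z. f z * g z)"
  and smooth_ridge: "smooth b \<Longrightarrow> smooth (\<lambda>z. b (z \<bullet> c + d))"
  by (auto intro!: smooth_alg_smooth smooth_alg.add smooth_alg.mult smooth_alg.ridge intro: smooth_alg.smooth)

lemma smooth_affine: "smooth (b::real\<Rightarrow>real) \<Longrightarrow> smooth (\<lambda>x. b (c * x + d))"
  using smooth_ridge[of b c d] by (simp add: mult.commute)

lemma smooth_diff: "smooth f \<Longrightarrow> smooth g \<Longrightarrow> smooth (\<lambda>z. f z - g z)"
  using smooth_add[of f "\<lambda>z. (-1) * g z"] smooth_mult[of "\<lambda>_. -1" g] by simp

lemma smooth_prod: "finite I \<Longrightarrow> (\<And>i. i \<in> I \<Longrightarrow> smooth (f i)) \<Longrightarrow> smooth (\<lambda>z. \<Prod>i\<in>I. f i z)"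
  by (induction rule: finite_induct) (auto intro!: smooth_mult)

lemma smooth_antiderivative:
  fixes G b :: "real \<Rightarrow> real"
  assumes "\<And>x. (G has_real_derivative b x) (at x)" "smooth b"
  shows "smooth G"
proof -
  define C where "C = range (\<lambda>c x. G x * c) \<union> Collect smooth"
  show ?thesis
  proof (rule smooth_real_coinduct[where C = C])
    have "G = (\<lambda>x. G x * 1)" by simp
    then show "G \<in> C" unfolding C_def by blast
  next
    fix h c assume "h \<in> C"
    then consider d where "h = (\<lambda>x. G x * d)" | "smooth h" unfolding C_def by auto
    then show "(\<lambda>x. h x * c) \<in> C"
    proof cases
      case 1
      then have "(\<lambda>x. h x * c) = (\<lambda>x. G x * (d * c))" by (simp add: mult.assoc)
      then show ?thesis unfolding C_def by blast
    next
      case 2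
      then have "smooth (\<lambda>x. h x * c)" by (rule smooth_mult) simp
      then show ?thesis unfolding C_def by blast
    qed
  next
    fix h assume "h \<in> C"
    then consider d where "h = (\<lambda>x. G x * d)" | "smooth h" unfolding C_def by auto
    then show "\<exists>h'\<in>C. \<forall>x. (h has_real_derivative h' x) (at x)"
    proof cases
      case 1
      have "smooth (\<lambda>x. b x * d)" using assms(2) by (rule smooth_mult) simp
      moreover have "\<forall>x. (h has_real_derivative b x * d) (at x)"
        unfolding 1 using assms(1) by (auto intro: DERIV_cmult_right)
      ultimately show ?thesis unfolding C_def by (intro bexI[of _ "\<lambda>x. b x * d"]) simp_all
    next
      case 2
      then show ?thesis unfolding C_def
        by (intro bexI[of _ "deriv h"]) (simp_all add: smooth_deriv smooth_has_real_derivative)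
    qed
  qed
qed

text \<open>The functions \<open>p(1/x) exp(-1/x)\<close> on the positive axis, extended by zero. Differentiation only
  changes the polynomial, and at the origin the exponential beats every power of \<open>1/x\<close>.\<close>

definition flat :: "real poly \<Rightarrow> real \<Rightarrow> real" where
  "flat p x = (if x \<le> 0 then 0 else poly p (1 / x) * exp (- (1 / x)))"

lemma poly_exp_tendsto_0: "((\<lambda>y::real. y ^ k * poly p y * exp (- y)) \<longlongrightarrow> 0) at_top"
proof (induction p arbitrary: k)
  case 0
  then show ?case by simp
next
  case (pCons a p)
  have "((\<lambda>y::real. y ^ k / exp y) \<longlongrightarrow> 0) at_top" by (rule tendsto_power_div_exp_0)
  then have "((\<lambda>y::real. a * (y ^ k / exp y) + y ^ Suc k * poly p y * exp (- y)) \<longlongrightarrow> a * 0 + 0) at_top"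
    by (intro tendsto_intros pCons.IH)
  then show ?case by (simp add: algebra_simps exp_minus divide_inverse)
qed

lemma flat_has_derivative:
  "(flat p has_real_derivative flat ((p - pderiv p) * [:0, 0, 1:]) x) (at x)"
proof -
  consider "x < 0" | "x = 0" | "x > 0" by linarith
  then show ?thesis
  proof cases
    case 1
    then have "((\<lambda>_. 0) has_real_derivative flat ((p - pderiv p) * [:0, 0, 1:]) x) (at x)"
      by (simp add: flat_def)
    then show ?thesis
      by (rule has_field_derivative_transform_within_open[of _ _ _ "{..<0}"]) (use 1 in \<open>auto simp: flat_def\<close>)
  next
    case 3
    have "((\<lambda>x. poly p (1 / x) * exp (- (1 / x))) has_real_derivative flat ((p - pderiv p) * [:0, 0, 1:]) x) (at x)"
      using 3 by (auto intro!: derivative_eq_intros poly_DERIV[THEN DERIV_chain2] simp: flat_def field_simps power2_eq_square)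
    then show ?thesis
      by (rule has_field_derivative_transform_within_open[of _ _ _ "{0<..}"]) (use 3 in \<open>auto simp: flat_def\<close>)
  next
    case 2
    have "((\<lambda>x. flat p x / x) \<longlongrightarrow> 0) (at_right 0)"
    proof -
      have "filterlim (\<lambda>x::real. inverse x) at_top (at_right 0)" by (rule filterlim_inverse_at_top_right)
      from filterlim_compose[OF poly_exp_tendsto_0[of 1 p] this]
      have "((\<lambda>x. inverse x ^ 1 * poly p (inverse x) * exp (- inverse x)) \<longlongrightarrow> 0) (at_right 0)" .
      then show ?thesis
        by (rule Lim_transform_eventually)
          (auto simp: eventually_at_filter flat_def divide_inverse)
    qed
    moreover have "((\<lambda>x. flat p x / x) \<longlongrightarrow> 0) (at_left 0)"
      by (rule tendsto_eventually) (auto simp: eventually_at_filter flat_def)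
    ultimately have "((\<lambda>x. flat p x / x) \<longlongrightarrow> 0) (at 0)"
      by (simp add: filterlim_split_at)
    then show ?thesis using 2 by (simp add: DERIV_def flat_def[of _ 0])
  qed
qed

lemma smooth_flat: "smooth (flat p)"
proof (rule smooth_real_coinduct[where C = "range flat"])
  fix h c assume "h \<in> range flat"
  then obtain p where "h = flat p" by auto
  then have "(\<lambda>x. h x * c) = flat (smult c p)" by (auto simp: flat_def)
  then show "(\<lambda>x. h x * c) \<in> range flat" by auto
next
  fix h assume "h \<in> range flat"
  then show "\<exists>h'\<in>range flat. \<forall>x. (h has_real_derivative h' x) (at x)"
    using flat_has_derivative by blast
qed auto


text \<open>The 1-periodic function that agrees with \<open>b\<close> on the fundamental interval starting at \<open>a\<close>. If \<open>b\<close> is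
  smooth and vanishes outside the interior of this interval, no singularity arises where the copies
  meet.\<close>

definition wrap :: "real \<Rightarrow> (real \<Rightarrow> real) \<Rightarrow> real \<Rightarrow> real" where
  "wrap a b x = b (a + frac (x - a))"

text \<open>The endpoints need an argument: the function vanishes on one side of them, and the one-sided
  difference quotient determines the derivative.\<close>

lemma deriv_eq_0_outside:
  fixes b :: "real \<Rightarrow> real"
  assumes b: "smooth b" "\<And>x. x \<notin> {l<..<r} \<Longrightarrow> b x = 0" and x: "x \<notin> {l<..<r}"
  shows "deriv b x = 0"
proof -
  have D: "((\<lambda>h. (b (x + h) - b x) / h) \<longlongrightarrow> deriv b x) (at 0)"
    using smooth_has_real_derivative[OF b(1)] by (simp add: DERIV_def)
  consider "x \<le> l" | "x \<ge> r" using x by force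
  then show ?thesis
  proof cases
    case 1
    have "((\<lambda>h. (b (x + h) - b x) / h) \<longlongrightarrow> deriv b x) (at_left 0)"
      using D by (simp add: filterlim_at_split)
    moreover have "((\<lambda>h. (b (x + h) - b x) / h) \<longlongrightarrow> 0) (at_left 0)"
      by (rule tendsto_eventually) (use 1 b(2) in \<open>auto simp: eventually_at_filter\<close>)
    ultimately show ?thesis by (rule tendsto_unique[rotated]) simp
  next
    case 2
    have "((\<lambda>h. (b (x + h) - b x) / h) \<longlongrightarrow> deriv b x) (at_right 0)"
      using D by (simp add: filterlim_at_split)
    moreover have "((\<lambda>h. (b (x + h) - b x) / h) \<longlongrightarrow> 0) (at_right 0)"
      by (rule tendsto_eventually) (use 2 b(2) in \<open>auto simp: eventually_at_filter\<close>)
    ultimately show ?thesis by (rule tendsto_unique[rotated]) simp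
  qed
qed

lemma wrap_periodic: "wrap a b (x + 1) = wrap a b x"
proof -
  have "x + 1 - a = (x - a) + 1" by simp
  then show ?thesis unfolding wrap_def by (metis frac_1_eq)
qed

lemma wrap_eq: "a \<le> x \<Longrightarrow> x < a + 1 \<Longrightarrow> wrap a b x = b x"
  by (simp add: wrap_def frac_eq)

text \<open>Near any point the periodized function is the sum of two adjacent translates of \<open>b\<close>, one of which
  vanishes.\<close>

lemma wrap_has_derivative:
  fixes b :: "real \<Rightarrow> real"
  assumes b: "smooth b" "\<And>x. x \<notin> {a<..<a+1} \<Longrightarrow> b x = 0"
  shows "(wrap a b has_real_derivative wrap a (deriv b) x) (at x)"
proof -
  define n where "n = real_of_int \<lfloor>x - a\<rfloor>"
  have n: "n \<le> x - a" "x - a < n + 1" unfolding n_def by linarith+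
  have E: "wrap a c y = c (y - n) + c (y - n + 1)"
    if c: "\<And>x. x \<notin> {a<..<a+1} \<Longrightarrow> c x = 0" and y: "y \<in> {a+n-1<..<a+n+1}" for c :: "real \<Rightarrow> real" and y
  proof (cases "y \<ge> a + n")
    case True
    then have "\<lfloor>y - a\<rfloor> = \<lfloor>x - a\<rfloor>" using y unfolding n_def by (simp add: floor_eq_iff)
    then have "a + frac (y - a) = y - n" by (simp add: frac_def n_def)
    moreover have "c (y - n + 1) = 0" using True by (intro c) auto
    ultimately show ?thesis by (simp add: wrap_def)
  next
    case False
    then have "\<lfloor>y - a\<rfloor> = \<lfloor>x - a\<rfloor> - 1" using y unfolding n_def
      by (simp add: floor_eq_iff)
    then have "a + frac (y - a) = y - n + 1" by (simp add: frac_def n_def)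
    moreover have "c (y - n) = 0" using False by (intro c) auto
    ultimately show ?thesis by (simp add: wrap_def)
  qed
  have "((\<lambda>y. b (y - n) + b (y - n + 1)) has_real_derivative deriv b (x - n) + deriv b (x - n + 1)) (at x)"
    using DERIV_shift[of b "deriv b (x - n)" x "- n"] DERIV_shift[of b "deriv b (x - n + 1)" x "- n + 1"]
    by (intro DERIV_add) (simp_all add: smooth_has_real_derivative b algebra_simps)
  then have "(wrap a b has_real_derivative deriv b (x - n) + deriv b (x - n + 1)) (at x)"
    by (rule has_field_derivative_transform_within_open[of _ _ _ "{a+n-1<..<a+n+1}"])
      (use n E[of b] b(2) in auto)
  moreover have "wrap a (deriv b) x = deriv b (x - n) + deriv b (x - n + 1)"
    by (rule E) (use n deriv_eq_0_outside[OF b] in auto)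
  ultimately show ?thesis by simp
qed

lemma smooth_wrap:
  fixes b :: "real \<Rightarrow> real"
  assumes b: "smooth b" "\<And>x. x \<notin> {a<..<a+1} \<Longrightarrow> b x = 0"
  shows "smooth (wrap a b)"
proof -
  define C where "C = wrap a ` {b. smooth b \<and> (\<forall>x. x \<notin> {a<..<a+1} \<longrightarrow> b x = 0)}"
  show ?thesis
  proof (rule smooth_real_coinduct[where C = C])
    show "wrap a b \<in> C" unfolding C_def using b by auto
  next
    fix h c assume "h \<in> C"
    then obtain b where b: "h = wrap a b" "smooth b" "\<forall>x. x \<notin> {a<..<a+1} \<longrightarrow> b x = 0"
      unfolding C_def by auto
    have "(\<lambda>x. h x * c) = wrap a (\<lambda>x. b x * c)" by (auto simp: wrap_def b)
    moreover have "smooth (\<lambda>x. b x * c)" using b by (intro smooth_mult) auto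
    ultimately show "(\<lambda>x. h x * c) \<in> C" unfolding C_def using b(3) by auto
  next
    fix h assume "h \<in> C"
    then obtain b where b: "h = wrap a b" "smooth b" "\<And>x. x \<notin> {a<..<a+1} \<Longrightarrow> b x = 0"
      unfolding C_def by auto
    have "wrap a (deriv b) \<in> C"
      unfolding C_def using smooth_deriv[OF b(2)] deriv_eq_0_outside[OF b(2,3)] by blast
    then show "\<exists>h'\<in>C. \<forall>x. (h has_real_derivative h' x) (at x)"
      using wrap_has_derivative[OF b(2,3)] b(1) by blast
  qed
qed

section \<open>Tensor products as test functions\<close>

text \<open>All test functions are products of functions of one coordinate. A partial derivative then replaces
  a single factor by its derivative, and kernels can be compared one coordinate at a time.\<close>

definition tens :: "(3 \<Rightarrow> real \<Rightarrow> real) \<Rightarrow> real^3 \<Rightarrow> real" where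
  "tens b y = (\<Prod>i\<in>UNIV. b i (y $ i))"

lemma tens_upd: "tens (b(j := c)) y = c (y $ j) * (\<Prod>i\<in>UNIV - {j}. b i (y $ i))"
  unfolding tens_def by (subst prod.remove[of _ j]) (auto intro!: prod.cong)

lemma tens_split: "tens b y = b j (y $ j) * (\<Prod>i\<in>UNIV - {j}. b i (y $ i))"
  unfolding tens_def by (subst prod.remove[of _ j]) auto

lemma tens_has_derivative:
  assumes "\<And>i. smooth (b i)"
  shows "(tens b has_derivative (\<lambda>e. \<Sum>j\<in>UNIV. e $ j * tens (b(j := deriv (b j))) y)) (at y)"
proof -
  have "((\<lambda>y. b i (y $ i)) has_derivative (\<lambda>e. deriv (b i) (y $ i) * (e $ i))) (at y)" for i
    using ridge_has_derivative[OF assms, of i "axis i 1" 0 y] by (simp add: cart_eq_inner_axis)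
  from has_derivative_prod[of UNIV "\<lambda>i y. b i (y $ i)", OF this]
  moreover have "tens b = (\<lambda>y. \<Prod>i\<in>UNIV. b i (y $ i))" by (auto simp: tens_def)
  ultimately show ?thesis
    by (simp add: tens_upd mult_ac)
qed

lemma smooth_tens:
  assumes "\<And>i. smooth (b i)"
  shows "smooth (tens b)"
proof -
  have "smooth (\<lambda>y. b i (y $ i))" for i
    using smooth_ridge[OF assms, of i "axis i 1" 0] by (simp add: cart_eq_inner_axis)
  then show ?thesis unfolding tens_def[abs_def] by (intro smooth_prod) auto
qed

lemma tens_dderiv:
  assumes "\<And>i. smooth (b i)"
  shows "frechet_derivative (tens b) (at y) (axis j 1) = tens (b(j := deriv (b j))) y"
  by (subst frechet_derivative_at[OF tens_has_derivative[OF assms], symmetric])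
     (simp add: axis_def if_distrib[of "\<lambda>x. x * _"] sum.delta' cong: if_cong)

lemma sttens_has_derivative:
  assumes "\<And>i. smooth (b i)" "smooth \<psi>"
  shows "((\<lambda>z. \<psi> (fst z) * tens b (snd z)) has_derivative
     (\<lambda>e. \<psi> (fst z) * (\<Sum>j\<in>UNIV. snd e $ j * tens (b(j := deriv (b j))) (snd z)) +
          deriv \<psi> (fst z) * fst e * tens b (snd z))) (at z)"
proof (rule has_derivative_mult)
  show "((\<lambda>z. \<psi> (fst z)) has_derivative (\<lambda>e. deriv \<psi> (fst z) * fst e)) (at z)"
    using has_derivative_compose[OF has_derivative_fst[OF has_derivative_ident], of \<psi> _ z UNIV]
      smooth_has_real_derivative[OF assms(2), of "fst z"]
    by (simp add: has_field_derivative_def)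
  show "((\<lambda>z. tens b (snd z)) has_derivative (\<lambda>e. \<Sum>j\<in>UNIV. snd e $ j * tens (b(j := deriv (b j))) (snd z))) (at z)"
    by (rule has_derivative_compose[OF has_derivative_snd[OF has_derivative_ident], OF tens_has_derivative[OF assms(1)]])
qed

lemma smooth_sttens:
  assumes "\<And>i. smooth (b i)" "smooth \<psi>"
  shows "smooth (\<lambda>z::real \<times> (real^3). \<psi> (fst z) * tens b (snd z))"
proof -
  have "smooth (\<lambda>z::real \<times> (real^3). \<psi> (fst z))"
    using smooth_ridge[OF assms(2), of "(1,0)::real \<times> (real^3)" 0] by (simp add: inner_prod_def)
  moreover have "smooth (\<lambda>z::real \<times> (real^3). b i (snd z $ i))" for i
    using smooth_ridge[OF assms(1), of i "(0, axis i 1)" 0] by (simp add: inner_prod_def cart_eq_inner_axis)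
  then have "smooth (\<lambda>z::real \<times> (real^3). tens b (snd z))"
    unfolding tens_def by (intro smooth_prod) auto
  ultimately show ?thesis by (rule smooth_mult)
qed

section \<open>Integrals of periodic functions\<close>

definition cell_at :: "real^3 \<Rightarrow> (real^3) set" where
  "cell_at a = {x. \<forall>i. a $ i \<le> x $ i \<and> x $ i < a $ i + 1}"

lemma unit_cell_eq: "unit_cell = cell_at 0"
  by (simp add: unit_cell_def cell_at_def)

lemma cell_at_borel [measurable]: "cell_at a \<in> sets borel"
  unfolding cell_at_def by measurable

lemma cell_at_lebesgue [simp]: "cell_at a \<in> sets lebesgue"
  using cell_at_borel by simp

lemma unit_cell_lebesgue [simp]: "unit_cell \<in> sets lebesgue"
  by (simp add: unit_cell_eq)

lemma lebesgue_distr_plus: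
  fixes c :: "'a::euclidean_space"
  shows "distr lebesgue lebesgue ((+) c) = lebesgue"
proof -
  have E: "(\<lambda>x. c + (\<Sum>j\<in>Basis. (1 * (x \<bullet> j)) *\<^sub>R j)) = (+) c"
    by (auto simp: euclidean_representation)
  show ?thesis
    using lebesgue_affine_euclidean[of "\<lambda>_. 1" c] unfolding E by (simp add: density_1)
qed

lemma lebesgue_plus_measurable [measurable]:
  fixes c :: "'a::euclidean_space"
  shows "(+) c \<in> lebesgue \<rightarrow>\<^sub>M lebesgue"
proof -
  have E: "(\<lambda>x. c + (\<Sum>j\<in>Basis. (1 * (x \<bullet> j)) *\<^sub>R j)) = (+) c"
    by (auto simp: euclidean_representation)
  show ?thesis using lebesgue_affine_measurable[of "\<lambda>_. 1" c] unfolding E by simp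
qed

lemma lebesgue_integral_plus:
  fixes c :: "'a::euclidean_space" and f :: "'a \<Rightarrow> real"
  assumes "integrable lebesgue f"
  shows "integrable lebesgue (\<lambda>x. f (c + x))" "(\<integral>x. f (c + x) \<partial>lebesgue) = (\<integral>x. f x \<partial>lebesgue)"
proof -
  have m: "f \<in> borel_measurable lebesgue" using assms by simp
  show "integrable lebesgue (\<lambda>x. f (c + x))"
    using integrable_distr_eq[OF lebesgue_plus_measurable m, of c] assms
    by (simp add: lebesgue_distr_plus)
  show "(\<integral>x. f (c + x) \<partial>lebesgue) = (\<integral>x. f x \<partial>lebesgue)"
    using integral_distr[OF lebesgue_plus_measurable m, of c] by (simp add: lebesgue_distr_plus)
qed

lemma set_lebesgue_integral_plus:
  fixes f :: "'a::euclidean_space \<Rightarrow> real"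
  assumes f: "set_integrable lebesgue A f"
    and per: "\<And>x. f (c + x) = f x" and B: "\<And>x. c + x \<in> B \<longleftrightarrow> x \<in> A"
  shows "set_integrable lebesgue B f" "(LINT x:B|lebesgue. f x) = (LINT x:A|lebesgue. f x)"
proof -
  have *: "indicator A x *\<^sub>R f x = indicator B (c + x) *\<^sub>R f (c + x)" for x
    using per B[of x] by (auto simp: indicator_def)
  have **: "indicator B x *\<^sub>R f x = indicator A (- c + x) *\<^sub>R f (- c + x)" for x
    using per[of "- c + x"] B[of "- c + x"] by (auto simp: indicator_def)
  show 1: "set_integrable lebesgue B f"
    using lebesgue_integral_plus(1)[of "\<lambda>x. indicator A x *\<^sub>R f x" "- c"] f
    by (simp only: set_integrable_def **)
  show "(LINT x:B|lebesgue. f x) = (LINT x:A|lebesgue. f x)"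
    using lebesgue_integral_plus(2)[of "\<lambda>x. indicator B x *\<^sub>R f x" c] 1
    by (simp only: set_integrable_def set_lebesgue_integral_def *)
qed

definition cell_int :: "(real^3 \<Rightarrow> real) \<Rightarrow> real \<Rightarrow> real^3 \<Rightarrow> bool" where
  "cell_int P c a \<longleftrightarrow> set_integrable lebesgue (cell_at a) P \<and> (LINT x:cell_at a|lebesgue. P x) = c"

lemma periodic_minus: "periodic P \<Longrightarrow> P (x - axis i 1) = P x"
  unfolding periodic_def by (metis diff_add_cancel)

lemma cell_int_back:
  assumes "periodic P" "cell_int P c a"
  shows "cell_int P c (a - axis i 1)"
proof -
  have *: "P (- axis i 1 + x) = P x" for x using periodic_minus[OF assms(1), of x i] by simp
  have "- axis i 1 + x \<in> cell_at (a - axis i 1) \<longleftrightarrow> x \<in> cell_at a" for x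
    by (simp add: cell_at_def algebra_simps)
  from set_lebesgue_integral_plus[of "cell_at a" P, OF _ * this] show ?thesis
    using assms(2) by (simp add: cell_int_def)
qed

text \<open>Moving a cell by \<open>s \<le> 1\<close> in one direction cuts off a slab on one side and adds its translate by one
  period on the other.\<close>

lemma cell_int_step:
  assumes P: "periodic P" "cell_int P c a" and s: "0 \<le> s" "s \<le> 1"
  shows "cell_int P c (a + axis i s)"
proof -
  define A1 where "A1 = {x \<in> cell_at a. x $ i < a $ i + s}"
  define A2 where "A2 = {x \<in> cell_at a. a $ i + s \<le> x $ i}"
  define B where "B = {x. x - axis i 1 \<in> A1}"
  have U: "cell_at a = A1 \<union> A2" and d: "A1 \<inter> A2 = {}" by (auto simp: A1_def A2_def)
  have U2: "cell_at (a + axis i s) = B \<union> A2" and d2: "B \<inter> A2 = {}"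
  proof -
    show "B \<inter> A2 = {}"
    proof (rule ccontr)
      assume "B \<inter> A2 \<noteq> {}"
      then obtain x where x: "x - axis i 1 \<in> cell_at a" "x \<in> cell_at a" by (auto simp: A1_def A2_def B_def)
      then have "a $ i \<le> x $ i - 1" "x $ i < a $ i + 1"
        unfolding cell_at_def by (auto dest: spec[of _ i])
      then show False by simp
    qed
    have "x \<in> cell_at (a + axis i s) \<longleftrightarrow> x \<in> B \<union> A2" for x
    proof -
      have "x \<in> cell_at (a + axis i s) \<longleftrightarrow> (a $ i + s \<le> x $ i \<and> x $ i < a $ i + s + 1) \<and>
          (\<forall>k. k \<noteq> i \<longrightarrow> a $ k \<le> x $ k \<and> x $ k < a $ k + 1)"
        unfolding cell_at_def by (auto simp: axis_def; metis)
      moreover have "x \<in> A2 \<longleftrightarrow> (a $ i + s \<le> x $ i \<and> x $ i < a $ i + 1) \<and>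
          (\<forall>k. k \<noteq> i \<longrightarrow> a $ k \<le> x $ k \<and> x $ k < a $ k + 1)"
        unfolding A2_def cell_at_def using s by auto (smt (verit))
      moreover have "x \<in> B \<longleftrightarrow> (a $ i + 1 \<le> x $ i \<and> x $ i < a $ i + s + 1) \<and>
          (\<forall>k. k \<noteq> i \<longrightarrow> a $ k \<le> x $ k \<and> x $ k < a $ k + 1)"
        unfolding A1_def cell_at_def B_def using s by (auto simp: axis_def split: if_splits)
      ultimately show ?thesis using s by auto
    qed
    then show "cell_at (a + axis i s) = B \<union> A2" by blast
  qed
  have m: "A1 \<in> sets lebesgue" "A2 \<in> sets lebesgue"
    unfolding A1_def A2_def using cell_at_borel[of a] by (auto simp del: cell_at_borel intro!: borel_measurable_less)
  have "B = cell_at (a + axis i s) - A2" using U2 d2 by auto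
  then have mB: "B \<in> sets lebesgue" using m(2) by auto
  have c: "set_integrable lebesgue (cell_at a) P" "(LINT x:cell_at a|lebesgue. P x) = c"
    using P(2) by (auto simp: cell_int_def)
  have i: "set_integrable lebesgue A1 P" "set_integrable lebesgue A2 P"
    using set_integrable_subset[OF c(1)] m U by auto
  have *: "P (axis i 1 + x) = P x" for x using P(1) by (simp add: periodic_def add.commute)
  have **: "axis i 1 + x \<in> B \<longleftrightarrow> x \<in> A1" for x by (simp add: B_def)
  note B = set_lebesgue_integral_plus[OF i(1) * **]
  have "set_integrable lebesgue (cell_at (a + axis i s)) P"
    unfolding U2 by (rule set_integrable_Un[OF B(1) i(2)])
      (rule mB, rule m(2))
  moreover have "(LINT x:cell_at (a + axis i s)|lebesgue. P x) = c"
    unfolding U2 set_integral_Un[OF d2 B(1) i(2)] B(2)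
    using set_integral_Un[OF d i] c(2) U by simp
  ultimately show ?thesis by (simp add: cell_int_def)
qed

text \<open>An arbitrary shift is reached from whole periods backwards followed by forward steps of length at
  most one.\<close>

lemma cell_int_axis:
  assumes P: "periodic P" "cell_int P c a"
  shows "cell_int P c (a + axis i r)"
proof -
  have bwd: "cell_int P c (a - axis i (real n))" for n
  proof (induction n)
    case (Suc n)
    have "a - axis i (real (Suc n)) = (a - axis i (real n)) - axis i 1"
      by (simp add: vec_eq_iff axis_def)
    then show ?case using cell_int_back[OF P(1) Suc] by metis
  next
    case 0
    have "a - axis i (real 0) = a" by (simp add: vec_eq_iff axis_def)
    then show ?case using P(2) by metis
  qed
  have fwd: "cell_int P c (a' + axis i (s * real n))" if "cell_int P c a'" "0 \<le> s" "s \<le> 1" for n s a'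
  proof (induction n)
    case (Suc n)
    have "a' + axis i (s * real (Suc n)) = (a' + axis i (s * real n)) + axis i s"
      by (simp add: vec_eq_iff axis_def algebra_simps)
    then show ?case using cell_int_step[OF P(1) Suc that(2,3)] by metis
  next
    case 0
    have "a' + axis i (s * real 0) = a'" by (simp add: vec_eq_iff axis_def)
    then show ?case using that by metis
  qed
  obtain n :: nat where n: "real n \<ge> \<bar>r\<bar>" using real_arch_simple by blast
  define m where "m = Suc (2 * n)"
  define s where "s = (r + real n) / real m"
  have s: "0 \<le> s" "s \<le> 1" "s * real m = r + real n" using n by (auto simp: s_def m_def field_simps)
  have "a + axis i r = (a - axis i (real n)) + axis i (s * real m)"
    unfolding s(3) by (simp add: vec_eq_iff axis_def)
  then show ?thesis using fwd[OF bwd s(1,2)] by metis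
qed

lemma cell_int_any:
  assumes P: "periodic P" "cell_int P c 0"
  shows "cell_int P c a"
proof -
  have "a = ((0 + axis 1 (a $ 1)) + axis 2 (a $ 2)) + axis 3 (a $ 3)"
    by (simp add: vec_eq_iff axis_def forall_3)
  then show ?thesis using cell_int_axis[OF P(1)] P(2) by metis
qed

lemma integrable_torus_iff:
  fixes f :: "real^3 \<Rightarrow> 'b::euclidean_space"
  shows "integrable torus f \<longleftrightarrow> set_integrable lebesgue unit_cell f"
  by (simp add: torus_def integrable_restrict_space set_integrable_def)

lemma integral_torus_eq:
  fixes f :: "real^3 \<Rightarrow> 'b::euclidean_space"
  shows "(\<integral>x. f x \<partial>torus) = (LINT x:unit_cell|lebesgue. f x)"
  by (simp add: torus_def integral_restrict_space set_lebesgue_integral_def)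

lemma torus_integral_cell:
  fixes P :: "real^3 \<Rightarrow> real"
  assumes "periodic P" "integrable torus P"
  shows "set_integrable lebesgue (cell_at a) P" "(LINT x:cell_at a|lebesgue. P x) = (\<integral>x. P x \<partial>torus)"
proof -
  have "cell_int P (\<integral>x. P x \<partial>torus) 0"
    using assms by (simp add: cell_int_def integrable_torus_iff integral_torus_eq unit_cell_eq)
  from cell_int_any[OF assms(1) this, of a]
  show "set_integrable lebesgue (cell_at a) P" "(LINT x:cell_at a|lebesgue. P x) = (\<integral>x. P x \<partial>torus)"
    by (auto simp: cell_int_def)
qed

lemma smooth_compact_bounded:
  fixes b :: "real \<Rightarrow> real"
  assumes "smooth b" "\<And>x. x \<notin> {l<..<r} \<Longrightarrow> b x = 0"
  obtains B where "0 < B" "\<And>x. \<bar>b x\<bar> \<le> B"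
proof -
  have "bounded (b ` {l..r})"
    using smooth_continuous_on[OF assms(1)] by (intro compact_imp_bounded compact_continuous_image) auto
  then obtain B where B: "0 < B" "\<And>x. x \<in> {l..r} \<Longrightarrow> \<bar>b x\<bar> \<le> B" by (auto simp: bounded_pos)
  show thesis
  proof (rule that[of B])
    show "\<bar>b x\<bar> \<le> B" for x using B assms(2)[of x] by (cases "x \<in> {l..r}") auto
  qed (use B in auto)
qed

text \<open>Factors supported in the open unit cell with corner \<open>a\<close>: their periodizations are test functions on
  the torus, and on that cell they agree with the factors themselves.\<close>

definition supp_at :: "real^3 \<Rightarrow> (3 \<Rightarrow> real \<Rightarrow> real) \<Rightarrow> bool" where
  "supp_at a b \<longleftrightarrow> (\<forall>i. smooth (b i) \<and> (\<forall>x. x \<notin> {a $ i<..<a $ i + 1} \<longrightarrow> b i x = 0))"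

lemma supp_atD:
  assumes "supp_at a b"
  shows "smooth (b i)" "x \<notin> {a $ i<..<a $ i + 1} \<Longrightarrow> b i x = 0"
  using assms unfolding supp_at_def by blast+

lemma supp_at_deriv: "supp_at a b \<Longrightarrow> supp_at a (b(j := deriv (b j)))"
  unfolding supp_at_def
  using smooth_deriv[of "b j"] deriv_eq_0_outside[of "b j" "a $ j" "a $ j + 1"] by simp

lemma supp_at_tens_zero: "supp_at a b \<Longrightarrow> y \<notin> cell_at a \<Longrightarrow> tens b y = 0"
  unfolding tens_def cell_at_def supp_at_def by (auto intro!: prod_zero) (metis greaterThanLessThan_iff less_eq_real_def not_less)+

lemma tens_bounded:
  assumes "supp_at a b"
  obtains B where "0 < B" "\<And>y. \<bar>tens b y\<bar> \<le> B"
proof -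
  have "\<exists>B. 0 < B \<and> (\<forall>x. \<bar>b i x\<bar> \<le> B)" for i
    using smooth_compact_bounded[of "b i" "a $ i" "a $ i + 1"] supp_atD[OF assms] by metis
  then obtain B where B: "\<And>i. 0 < B i" "\<And>i x. \<bar>b i x\<bar> \<le> B i" by metis
  show thesis
  proof (rule that[of "\<Prod>i\<in>UNIV. B i"])
    show "\<bar>tens b y\<bar> \<le> (\<Prod>i\<in>UNIV. B i)" for y
      unfolding tens_def abs_prod by (intro prod_mono) (use B in auto)
  qed (use B in \<open>auto intro: prod_pos\<close>)
qed

lemma periodic_tens_wrap: "periodic (tens (\<lambda>i. wrap (a $ i) (b i)))"
  unfolding periodic_def tens_def
  by (auto intro!: prod.cong simp: axis_def wrap_periodic)

lemma tens_wrap_eq: "y \<in> cell_at a \<Longrightarrow> tens (\<lambda>i. wrap (a $ i) (b i)) y = tens b y"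
  unfolding tens_def cell_at_def by (auto intro!: prod.cong simp: wrap_eq)

lemma tens_wrap_bounded:
  assumes "supp_at a b"
  obtains B where "0 < B" "\<And>y. \<bar>tens (\<lambda>i. wrap (a $ i) (b i)) y\<bar> \<le> B"
proof -
  obtain B where B: "0 < B" "\<And>y. \<bar>tens b y\<bar> \<le> B" using tens_bounded[OF assms] by blast
  have "tens (\<lambda>i. wrap (a $ i) (b i)) y = tens b (\<chi> i. a $ i + frac (y $ i - a $ i))" for y
    by (simp add: tens_def wrap_def)
  then show thesis using that B by metis
qed

lemma supp_at_wrap_smooth: "supp_at a b \<Longrightarrow> smooth (wrap (a $ i) (b i))"
  by (intro smooth_wrap) (auto dest: supp_atD)

text \<open>Torus integrals against periodized factors are integrals over the whole space against the
  compactly supported product. From here on kernels live on the whole space and may be centred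
  anywhere.\<close>

lemma torus_integral_tens:
  fixes f :: "real^3 \<Rightarrow> real"
  assumes b: "supp_at a b" and f: "periodic f" "integrable torus f"
  shows "integrable lebesgue (\<lambda>y. f y * tens b y)"
    "integrable torus (\<lambda>y. tens (\<lambda>i. wrap (a $ i) (b i)) y * f y)"
    "(\<integral>y. tens (\<lambda>i. wrap (a $ i) (b i)) y * f y \<partial>torus) = (\<integral>y. f y * tens b y \<partial>lebesgue)"
proof -
  let ?T = "tens (\<lambda>i. wrap (a $ i) (b i))"
  obtain B where B: "0 < B" "\<And>y. \<bar>?T y\<bar> \<le> B" using tens_wrap_bounded[OF b] by blast
  have "?T \<in> borel_measurable borel"
    by (intro borel_measurable_continuous_onI smooth_continuous_on smooth_tens supp_at_wrap_smooth b)
  then have m: "?T \<in> borel_measurable torus"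
    unfolding torus_def by (simp add: measurable_completion measurable_restrict_space1)
  show i: "integrable torus (\<lambda>y. ?T y * f y)"
    by (rule Bochner_Integration.integrable_bound[where f = "\<lambda>y. B * f y"])
      (use f B m in \<open>auto simp: abs_mult intro!: mult_mono\<close>)
  have p: "periodic (\<lambda>y. ?T y * f y)"
    using periodic_tens_wrap[of a b] f(1) by (simp add: periodic_def)
  have e: "indicator (cell_at a) y *\<^sub>R (?T y * f y) = f y * tens b y" for y
    using tens_wrap_eq[of y a b] supp_at_tens_zero[OF b, of y] by (cases "y \<in> cell_at a") auto
  show "integrable lebesgue (\<lambda>y. f y * tens b y)"
    using torus_integral_cell(1)[OF p i, of a] by (simp only: set_integrable_def e)
  show "(\<integral>y. ?T y * f y \<partial>torus) = (\<integral>y. f y * tens b y \<partial>lebesgue)"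
    using torus_integral_cell(2)[OF p i, of a] by (simp only: set_lebesgue_integral_def e)
qed

lemma torus_integral_tens_bound:
  fixes f :: "real^3 \<Rightarrow> real"
  assumes b: "supp_at a b" and f: "periodic f" "integrable torus f" and B: "\<And>y. \<bar>tens b y\<bar> \<le> B"
  shows "integrable lebesgue (\<lambda>y. \<bar>f y\<bar> * \<bar>tens b y\<bar>)"
    "(\<integral>y. \<bar>f y\<bar> * \<bar>tens b y\<bar> \<partial>lebesgue) \<le> B * (\<integral>y. \<bar>f y\<bar> \<partial>torus)"
proof -
  have p: "periodic (\<lambda>y. B * \<bar>f y\<bar>)" using f(1) by (simp add: periodic_def)
  have i: "integrable torus (\<lambda>y. B * \<bar>f y\<bar>)" using f(2) by simp
  show 1: "integrable lebesgue (\<lambda>y. \<bar>f y\<bar> * \<bar>tens b y\<bar>)"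
    using integrable_abs[OF torus_integral_tens(1)[OF b f]] by (simp add: abs_mult)
  have "(\<integral>y. \<bar>f y\<bar> * \<bar>tens b y\<bar> \<partial>lebesgue) \<le> (LINT y:cell_at a|lebesgue. B * \<bar>f y\<bar>)"
    unfolding set_lebesgue_integral_def
  proof (rule integral_mono[OF 1])
    show "integrable lebesgue (\<lambda>y. indicator (cell_at a) y *\<^sub>R (B * \<bar>f y\<bar>))"
      using torus_integral_cell(1)[OF p i, of a] by (simp add: set_integrable_def)
    show "\<bar>f y\<bar> * \<bar>tens b y\<bar> \<le> indicator (cell_at a) y *\<^sub>R (B * \<bar>f y\<bar>)" for y
      using supp_at_tens_zero[OF b, of y] B[of y]
      by (cases "y \<in> cell_at a") (auto simp: mult.commute[of "\<bar>f y\<bar>"] intro: mult_right_mono)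
  qed
  then show "(\<integral>y. \<bar>f y\<bar> * \<bar>tens b y\<bar> \<partial>lebesgue) \<le> B * (\<integral>y. \<bar>f y\<bar> \<partial>torus)"
    using torus_integral_cell(2)[OF p i, of a] by (simp del: set_integral_mult_right)
qed

lemma deriv_wrap:
  assumes "supp_at a b"
  shows "deriv (wrap (a $ i) (b i)) = wrap (a $ i) (deriv (b i))"
  using DERIV_imp_deriv[OF wrap_has_derivative[OF supp_atD[OF assms]]] by auto

lemma tens_wrap_test: "supp_at a b \<Longrightarrow> tens (\<lambda>i. wrap (a $ i) (b i)) \<in> torus_tests"
  unfolding torus_tests_def by (auto intro!: smooth_tens supp_at_wrap_smooth periodic_tens_wrap)

lemma tens_wrap_dderiv:
  assumes "supp_at a b"
  shows "frechet_derivative (tens (\<lambda>i. wrap (a $ i) (b i))) (at y) (axis j 1)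
    = tens (\<lambda>i. wrap (a $ i) ((b(j := deriv (b j))) i)) y"
proof -
  have "(\<lambda>i. wrap (a $ i) (b i))(j := deriv (wrap (a $ j) (b j))) = (\<lambda>i. wrap (a $ i) ((b(j := deriv (b j))) i))"
    using deriv_wrap[OF assms, of j] by auto
  then show ?thesis using tens_dderiv[OF supp_at_wrap_smooth[OF assms], where y = y and j = j] by simp
qed

text \<open>The defining identity of weak derivatives, moved from periodic test functions to compactly
  supported products.\<close>

lemma weak_dx_tens:
  fixes f g :: "real^3 \<Rightarrow> real"
  assumes w: "weak_dx [j] f g" and p: "periodic f" "periodic g" and b: "supp_at a b"
  shows "(\<integral>y. f y * tens (b(j := deriv (b j))) y \<partial>lebesgue) = - (\<integral>y. g y * tens b y \<partial>lebesgue)"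
proof -
  have i: "integrable torus f" "integrable torus g"
    using w by (auto simp: weak_dx_def weak_deriv_def)
  have "(\<integral>y. frechet_derivative (tens (\<lambda>i. wrap (a $ i) (b i))) (at y) (axis j 1) * f y \<partial>torus)
      = - (\<integral>y. tens (\<lambda>i. wrap (a $ i) (b i)) y * g y \<partial>torus)"
    using w tens_wrap_test[OF b] by (auto simp: weak_dx_def weak_deriv_def)
  then show ?thesis
    unfolding tens_wrap_dderiv[OF b] torus_integral_tens(3)[OF b p(2) i(2)]
      torus_integral_tens(3)[OF supp_at_deriv[OF b] p(1) i(1)] .
qed

section \<open>Kernels\<close>

text \<open>Smooth kernels of one variable with mass one, centred at \<open>x\<close>, of width \<open>\<epsilon>\<close> and height at most \<open>A / \<epsilon>\<close>.
  The mass is expressed by a primitive that rises from 0 to 1, since it is the primitive that the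
  comparison of two kernels uses.\<close>

definition adm :: "real \<Rightarrow> real \<Rightarrow> real \<Rightarrow> (real \<Rightarrow> real) \<Rightarrow> bool" where
  "adm A \<epsilon> x b \<longleftrightarrow> smooth b \<and> (\<forall>s. 0 \<le> b s \<and> b s \<le> A / \<epsilon>) \<and> (\<forall>s. \<bar>s - x\<bar> \<ge> \<epsilon> \<longrightarrow> b s = 0) \<and>
     (\<exists>G. (\<forall>s. (G has_real_derivative b s) (at s)) \<and> (\<forall>s. s \<le> x - \<epsilon> \<longrightarrow> G s = 0) \<and>
          (\<forall>s. s \<ge> x + \<epsilon> \<longrightarrow> G s = 1))"

lemma admD:
  assumes "adm A \<epsilon> x b"
  shows "smooth b" "0 \<le> b s" "b s \<le> A / \<epsilon>" "\<bar>s - x\<bar> \<ge> \<epsilon> \<Longrightarrow> b s = 0"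
  using assms unfolding adm_def by auto

lemma adm_primitive:
  assumes "adm A \<epsilon> x b" "0 < \<epsilon>"
  obtains G where "\<And>s. (G has_real_derivative b s) (at s)" "\<And>s. s \<le> x - \<epsilon> \<Longrightarrow> G s = 0"
    "\<And>s. s \<ge> x + \<epsilon> \<Longrightarrow> G s = 1" "\<And>s. 0 \<le> G s" "\<And>s. G s \<le> 1"
proof -
  obtain G where G: "\<And>s. (G has_real_derivative b s) (at s)" "\<And>s. s \<le> x - \<epsilon> \<Longrightarrow> G s = 0"
    "\<And>s. s \<ge> x + \<epsilon> \<Longrightarrow> G s = 1" using assms unfolding adm_def by blast
  have mono: "G s \<le> G t" if "s \<le> t" for s t
    by (rule DERIV_nonneg_imp_nondecreasing[OF that]) (use G(1) admD(2)[OF assms(1)] in blast)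
  have "0 \<le> G s" for s using mono[of "min s (x - \<epsilon>)" s] G(2)[of "min s (x - \<epsilon>)"] by simp
  moreover have "G s \<le> 1" for s using mono[of s "max s (x + \<epsilon>)"] G(3)[of "max s (x + \<epsilon>)"] by simp
  ultimately show thesis using that G by blast
qed

lemma adm_mass:
  assumes "adm A \<epsilon> x b" "0 < \<epsilon>"
  shows "(\<integral>\<^sup>+s. ennreal (b s) \<partial>lborel) = 1"
proof -
  obtain G where G: "\<And>s. (G has_real_derivative b s) (at s)" "\<And>s. s \<le> x - \<epsilon> \<Longrightarrow> G s = 0"
    "\<And>s. s \<ge> x + \<epsilon> \<Longrightarrow> G s = 1" using adm_primitive[OF assms] by metis
  have "(\<integral>\<^sup>+s. ennreal (b s) * indicator {x - \<epsilon>..x + \<epsilon>} s \<partial>lborel) = ennreal (G (x + \<epsilon>) - G (x - \<epsilon>))"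
    by (rule nn_integral_FTC_Icc)
      (use assms(2) G admD[OF assms(1)] in \<open>auto intro!: borel_measurable_continuous_onI smooth_continuous_on DERIV_subset[of G]\<close>)
  also have "ennreal (G (x + \<epsilon>) - G (x - \<epsilon>)) = 1" using G by simp
  also have "(\<integral>\<^sup>+s. ennreal (b s) * indicator {x - \<epsilon>..x + \<epsilon>} s \<partial>lborel) = (\<integral>\<^sup>+s. ennreal (b s) \<partial>lborel)"
  proof (rule nn_integral_cong)
    fix s
    show "ennreal (b s) * indicator {x - \<epsilon>..x + \<epsilon>} s = ennreal (b s)"
      using admD(4)[OF assms(1), of s] by (cases "s \<in> {x - \<epsilon>..x + \<epsilon>}") (auto simp: abs_if split: if_splits)
  qed
  finally show ?thesis .
qed

text \<open>Kernels of equal mass differ by the derivative of a function supported in the same interval. This is what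
  lets a weak derivative control the difference of two averages.\<close>

lemma adm_diff_primitive:
  assumes b: "adm A \<epsilon> x b" and c: "adm A \<epsilon> x c" and \<epsilon>: "0 < \<epsilon>"
  obtains \<Gamma> where "smooth \<Gamma>" "deriv \<Gamma> = (\<lambda>s. b s - c s)" "\<And>s. \<bar>\<Gamma> s\<bar> \<le> 1" "\<And>s. \<bar>s - x\<bar> \<ge> \<epsilon> \<Longrightarrow> \<Gamma> s = 0"
proof -
  obtain G where G: "\<And>s. (G has_real_derivative b s) (at s)" "\<And>s. s \<le> x - \<epsilon> \<Longrightarrow> G s = 0"
    "\<And>s. s \<ge> x + \<epsilon> \<Longrightarrow> G s = 1" "\<And>s. 0 \<le> G s" "\<And>s. G s \<le> 1" using adm_primitive[OF b \<epsilon>] by metis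
  obtain H where H: "\<And>s. (H has_real_derivative c s) (at s)" "\<And>s. s \<le> x - \<epsilon> \<Longrightarrow> H s = 0"
    "\<And>s. s \<ge> x + \<epsilon> \<Longrightarrow> H s = 1" "\<And>s. 0 \<le> H s" "\<And>s. H s \<le> 1" using adm_primitive[OF c \<epsilon>] by metis
  show thesis
  proof (rule that[of "\<lambda>s. G s - H s"])
    have D: "((\<lambda>s. G s - H s) has_real_derivative b s - c s) (at s)" for s
      using G(1) H(1) by (rule DERIV_diff)
    show "smooth (\<lambda>s. G s - H s)"
      by (rule smooth_antiderivative[OF D]) (intro smooth_diff admD(1)[OF b] admD(1)[OF c])
    show "deriv (\<lambda>s. G s - H s) = (\<lambda>s. b s - c s)" using DERIV_imp_deriv[OF D] by auto
    show "\<bar>G s - H s\<bar> \<le> 1" for s using G(4,5)[of s] H(4,5)[of s] by linarith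
    show "G s - H s = 0" if "\<bar>s - x\<bar> \<ge> \<epsilon>" for s
      using that G(2,3)[of s] H(2,3)[of s] by (cases "s \<le> x") auto
  qed
qed

text \<open>The product of two flat functions is positive exactly on the interval from -1 to 1; dividing by
  its integral gives mass one.\<close>

lemma bump_exists: "\<exists>b A. adm A 1 0 b \<and> (\<forall>s. b (- s) = b s)"
proof -
  define b0 where "b0 s = flat [:1:] (1 + s) * flat [:1:] (1 - s)" for s :: real
  have sm: "smooth b0"
    unfolding b0_def using smooth_affine[OF smooth_flat, of _ 1 1] smooth_affine[OF smooth_flat, of _ "-1" 1]
    by (intro smooth_mult) (simp_all add: add.commute)
  have pos: "b0 s > 0" if "\<bar>s\<bar> < 1" for s using that by (auto simp: b0_def flat_def)
  have zero: "b0 s = 0" if "\<bar>s\<bar> \<ge> 1" for s using that by (auto simp: b0_def flat_def)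
  have nn: "b0 s \<ge> 0" for s using pos[of s] zero[of s] by (cases "\<bar>s\<bar> < 1") auto
  have cont: "continuous_on S b0" for S using sm by (rule smooth_continuous_on)
  define G where "G s = integral {-2..s} b0" for s
  have G0: "G s = 0" if "s \<le> -1" for s
  proof -
    have "G s = integral {-2..s} (\<lambda>_. 0)" unfolding G_def
      by (intro integral_cong) (use that zero in auto)
    then show ?thesis by simp
  qed
  have D: "(G has_real_derivative b0 s) (at s)" for s
  proof (cases "s < -1")
    case True
    have "((\<lambda>_. 0) has_real_derivative b0 s) (at s)" using True zero[of s] by simp
    then show ?thesis
      by (rule has_field_derivative_transform_within_open[of _ _ _ "{..<-1}"]) (use True G0 in auto)
  next
    case False
    have "(G has_real_derivative b0 s) (at s within {-2..s+1})"
      unfolding G_def by (rule integral_has_real_derivative[OF cont]) (use False in auto)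
    moreover have "at s within {-2..s+1} = at s"
      by (rule at_within_interior) (use False in simp)
    ultimately show ?thesis by simp
  qed
  have G1: "G s = G 1" if "s \<ge> 1" for s
  proof (cases "s = 1")
    case False
    then have "1 < s" using that by simp
    then show ?thesis
    proof (rule DERIV_isconst_end[of 1 s G])
      show "continuous_on {1..s} G" using D DERIV_isCont continuous_at_imp_continuous_on by blast
      show "(G has_real_derivative 0) (at x)" if "1 < x" "x < s" for x
        using D[of x] zero[of x] that by simp
    qed
  qed simp
  have I: "G 1 > 0"
  proof -
    have "G (-1) < G 1"
    proof (rule DERIV_pos_imp_increasing_open[of "-1" 1 G])
      show "\<exists>y. (G has_real_derivative y) (at x) \<and> 0 < y" if "-1 < x" "x < 1" for x
        using D[of x] pos[of x] that by auto
      show "continuous_on {-1..1} G" using D DERIV_isCont continuous_at_imp_continuous_on by blast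
    qed auto
    then show ?thesis using G0[of "-1"] by simp
  qed
  define b where "b s = b0 s * (1 / G 1)" for s
  have smb: "smooth b" unfolding b_def by (intro smooth_mult sm smooth_const)
  have "b s = 0" if "s \<notin> {-1<..<1}" for s using that zero[of s] by (auto simp: b_def)
  then obtain A where A: "\<And>s. \<bar>b s\<bar> \<le> A"
    using smooth_compact_bounded[OF smb, of "-1" 1] by blast
  have "adm A 1 0 b"
    unfolding adm_def
  proof (intro conjI exI[of _ "\<lambda>s. G s * (1 / G 1)"] allI impI smb)
    show "((\<lambda>s. G s * (1 / G 1)) has_real_derivative b s) (at s)" for s
      unfolding b_def by (rule DERIV_cmult_right[OF D])
    show "0 \<le> b s" for s unfolding b_def using nn[of s] I by simp
    show "b s \<le> A / 1" for s using A[of s] by simp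
    show "b s = 0" if "1 \<le> \<bar>s - 0\<bar>" for s using zero[of s] that by (simp add: b_def)
    show "G s * (1 / G 1) = 0" if "s \<le> 0 - 1" for s using G0 that by simp
    show "G s * (1 / G 1) = 1" if "0 + 1 \<le> s" for s using G1[of s] that I by simp
  qed
  moreover have "b (- s) = b s" for s by (simp add: b_def b0_def mult.commute)
  ultimately show ?thesis by blast
qed

definition bump :: "real \<Rightarrow> real" where
  "bump = (SOME b. \<exists>A. adm A 1 0 b \<and> (\<forall>s. b (- s) = b s))"

definition bumpA :: real where
  "bumpA = (SOME A. adm A 1 0 bump)"

lemma adm_bump: "adm bumpA 1 0 bump" and bump_even: "bump (- s) = bump s"
proof -
  have "\<exists>A. adm A 1 0 bump \<and> (\<forall>s. bump (- s) = bump s)"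
    unfolding bump_def by (rule someI_ex[OF bump_exists])
  then show "adm bumpA 1 0 bump" "bump (- s) = bump s" unfolding bumpA_def by (auto intro: someI_ex)
qed

definition kern :: "real \<Rightarrow> real \<Rightarrow> real \<Rightarrow> real" where
  "kern \<epsilon> x s = bump ((s - x) / \<epsilon>) / \<epsilon>"

text \<open>Symmetry in the centre and the variable, from evenness of the bump. It makes the kernel integrate
  to one also with respect to its centre.\<close>

lemma kern_commute: "kern \<epsilon> x s = kern \<epsilon> s x"
  using bump_even[of "(s - x) / \<epsilon>"] by (simp add: kern_def minus_divide_left)

lemma adm_kern:
  assumes "0 < \<epsilon>"
  shows "adm bumpA \<epsilon> x (kern \<epsilon> x)"
proof -
  obtain G where G: "\<And>s. (G has_real_derivative bump s) (at s)" "\<And>s. s \<le> 0 - 1 \<Longrightarrow> G s = 0"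
    "\<And>s. s \<ge> 0 + 1 \<Longrightarrow> G s = 1" using adm_bump unfolding adm_def by blast
  show ?thesis
    unfolding adm_def
  proof (intro conjI exI[of _ "\<lambda>s. G ((s - x) / \<epsilon>)"] allI impI)
    have "smooth (\<lambda>s. bump (1 / \<epsilon> * s + (- x / \<epsilon>)) * (1 / \<epsilon>))"
      by (rule smooth_mult[OF smooth_affine[OF admD(1)[OF adm_bump]] smooth_const])
    then show "smooth (kern \<epsilon> x)" unfolding kern_def[abs_def] by (simp add: diff_divide_distrib)
    show "0 \<le> kern \<epsilon> x s" "kern \<epsilon> x s \<le> bumpA / \<epsilon>" for s
      using admD(2,3)[OF adm_bump] assms by (auto simp: kern_def divide_right_mono)
    show "kern \<epsilon> x s = 0" if "\<epsilon> \<le> \<bar>s - x\<bar>" for s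
      using admD(4)[OF adm_bump, of "(s - x) / \<epsilon>"] that assms by (simp add: kern_def)
    show "((\<lambda>s. G ((s - x) / \<epsilon>)) has_real_derivative kern \<epsilon> x s) (at s)" for s
    proof -
      have "((\<lambda>s. (s - x) / \<epsilon>) has_real_derivative 1 / \<epsilon>) (at s)"
        using assms by (auto intro!: derivative_eq_intros)
      from DERIV_chain2[OF G(1) this] show ?thesis by (simp add: kern_def)
    qed
    show "G ((s - x) / \<epsilon>) = 0" if "s \<le> x - \<epsilon>" for s using that assms by (intro G) (simp add: field_simps)
    show "G ((s - x) / \<epsilon>) = 1" if "s \<ge> x + \<epsilon>" for s using that assms by (intro G) (simp add: field_simps)
  qed
qed

lemma bumpA_pos: "bumpA > 0"
proof (rule ccontr)
  assume "\<not> bumpA > 0"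
  then have "bump s = 0" for s using admD(2,3)[OF adm_bump, of s] by simp
  then show False using adm_mass[OF adm_bump] by simp
qed

text \<open>Kernels of smaller width or displaced centre are kernels of a common larger width around a common
  centre, with a larger height constant. One comparison result then covers both changes of scale
  and changes of centre.\<close>

lemma adm_weaken:
  assumes "adm A \<epsilon> x b" "0 < \<epsilon>" "A / \<epsilon> \<le> A' / \<epsilon>'" "\<epsilon> + \<bar>x - x'\<bar> \<le> \<epsilon>'"
  shows "adm A' \<epsilon>' x' b"
proof -
  obtain G where G: "\<And>s. (G has_real_derivative b s) (at s)" "\<And>s. s \<le> x - \<epsilon> \<Longrightarrow> G s = 0"
    "\<And>s. s \<ge> x + \<epsilon> \<Longrightarrow> G s = 1" using assms(1) unfolding adm_def by blast
  show ?thesis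
    unfolding adm_def
  proof (intro conjI exI[of _ G] allI impI G admD(1,2)[OF assms(1)])
    show "b s \<le> A' / \<epsilon>'" for s using admD(3)[OF assms(1), of s] assms(3) by linarith
    show "b s = 0" if "\<epsilon>' \<le> \<bar>s - x'\<bar>" for s using admD(4)[OF assms(1), of s] that assms(4) by linarith
  qed (use assms(4) in linarith)+
qed

definition cube :: "real^3 \<Rightarrow> real \<Rightarrow> (real^3) set" where
  "cube x \<epsilon> = {y. \<forall>i. \<bar>y $ i - x $ i\<bar> < \<epsilon>}"

definition adm3 :: "real \<Rightarrow> real \<Rightarrow> real^3 \<Rightarrow> (3 \<Rightarrow> real \<Rightarrow> real) \<Rightarrow> bool" where
  "adm3 A \<epsilon> x b \<longleftrightarrow> (\<forall>i. adm A \<epsilon> (x $ i) (b i))"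

abbreviation corner :: "real^3 \<Rightarrow> real^3" where
  "corner x \<equiv> (\<chi> i. x $ i - 1 / 2)"

lemma adm3_supp:
  assumes "adm3 A \<epsilon> x b" "\<epsilon> \<le> 1 / 2"
  shows "supp_at (corner x) b"
  unfolding supp_at_def
proof (intro allI conjI impI)
  show "smooth (b i)" for i using assms admD(1) unfolding adm3_def by blast
  show "b i s = 0" if "s \<notin> {corner x $ i<..<corner x $ i + 1}" for i s
    using that assms(1) assms(2) admD(4)[of A \<epsilon> "x $ i" "b i" s] unfolding adm3_def
    by (auto simp: abs_if split: if_splits)
qed

lemma tens_nonneg: "adm3 A \<epsilon> x b \<Longrightarrow> 0 \<le> tens b y"
  unfolding tens_def adm3_def by (intro prod_nonneg) (auto dest: admD)

lemma tens_zero_cube: "adm3 A \<epsilon> x b \<Longrightarrow> y \<notin> cube x \<epsilon> \<Longrightarrow> tens b y = 0"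
  unfolding tens_def adm3_def cube_def by (auto intro!: prod_zero simp: not_less dest: admD(4))

lemma tens_le: "adm3 A \<epsilon> x b \<Longrightarrow> \<bar>tens b y\<bar> \<le> (A / \<epsilon>) ^ 3"
proof -
  assume "adm3 A \<epsilon> x b"
  then have "\<bar>b i s\<bar> \<le> A / \<epsilon>" for i s
    using admD(2,3)[of A \<epsilon> "x $ i" "b i" s] unfolding adm3_def by auto
  then have "(\<Prod>i\<in>UNIV. \<bar>b i (y $ i)\<bar>) \<le> (\<Prod>i\<in>(UNIV::3 set). A / \<epsilon>)"
    by (intro prod_mono) auto
  then show ?thesis by (simp add: tens_def abs_prod)
qed

text \<open>Lebesgue measure on the space is a product measure over the standard basis, so the masses of the
  factors multiply.\<close>

lemma tens_mass:
  assumes "adm3 A \<epsilon> x b" "0 < \<epsilon>"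
  shows "integrable lborel (tens b)" "(\<integral>y. tens b y \<partial>lborel) = 1"
    "integrable lebesgue (tens b)" "(\<integral>y. tens b y \<partial>lebesgue) = 1"
proof -
  have m: "tens b \<in> borel_measurable borel"
    using assms unfolding adm3_def
    by (intro borel_measurable_continuous_onI smooth_continuous_on smooth_tens) (auto dest: admD)
  have mb: "b i \<in> borel_measurable borel" for i
    using assms unfolding adm3_def
    by (intro borel_measurable_continuous_onI smooth_continuous_on) (auto dest: admD)
  have inj: "inj (\<lambda>i::3. axis i (1::real))" by (auto simp: inj_on_def axis_eq_axis)
  have Bs: "(Basis :: (real^3) set) = range (\<lambda>i. axis i 1)" by (auto simp: Basis_vec_def)
  define c where "c e = b (THE i. e = axis i (1::real))" for e :: "real^3"
  have c: "c (axis i 1) = b i" for i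
    unfolding c_def by (rule arg_cong[where f = b]) (auto simp: axis_eq_axis)
  have "(\<integral>\<^sup>+y. ennreal (tens b y) \<partial>lborel) = (\<integral>\<^sup>+y. (\<Prod>e\<in>Basis. ennreal (c e (y \<bullet> e))) \<partial>lborel)"
  proof (rule nn_integral_cong)
    fix y
    have "ennreal (tens b y) = (\<Prod>i\<in>UNIV. ennreal (b i (y $ i)))"
      unfolding tens_def using assms(1) by (intro prod_ennreal[symmetric]) (auto simp: adm3_def dest: admD)
    also have "\<dots> = (\<Prod>e\<in>Basis. ennreal (c e (y \<bullet> e)))"
      unfolding Bs by (subst prod.reindex[OF inj]) (simp add: c cart_eq_inner_axis)
    finally show "ennreal (tens b y) = (\<Prod>e\<in>Basis. ennreal (c e (y \<bullet> e)))" .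
  qed
  also have "\<dots> = (\<Prod>e\<in>Basis. (\<integral>\<^sup>+s. ennreal (c e s) \<partial>lborel))"
    by (rule nn_integral_lborel_prod) (use mb in \<open>auto simp: Bs c\<close>)
  also have "\<dots> = (\<Prod>i\<in>UNIV. (\<integral>\<^sup>+s. ennreal (b i s) \<partial>lborel))"
    unfolding Bs by (subst prod.reindex[OF inj]) (simp add: c)
  also have "\<dots> = 1" using adm_mass[OF _ assms(2)] assms(1) unfolding adm3_def by (intro prod.neutral) blast
  finally have nn: "(\<integral>\<^sup>+y. ennreal (tens b y) \<partial>lborel) = 1" .
  show i: "integrable lborel (tens b)"
    by (rule integrableI_nonneg) (use m nn tens_nonneg[OF assms(1)] in auto)
  show e: "(\<integral>y. tens b y \<partial>lborel) = 1"
    using integral_eq_nn_integral[of "tens b" lborel] m nn tens_nonneg[OF assms(1)] by simp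
  show "integrable lebesgue (tens b)" using i by (simp add: integrable_completion)
  show "(\<integral>y. tens b y \<partial>lebesgue) = 1" using e m by (simp add: integral_completion)
qed

section \<open>Oscillation of averages\<close>

lemma cube_subset_cell: "\<epsilon> \<le> 1 / 2 \<Longrightarrow> cube x \<epsilon> \<subseteq> cell_at (corner x)"
proof
  fix y assume e: "\<epsilon> \<le> 1 / 2" and y: "y \<in> cube x \<epsilon>"
  have "corner x $ i \<le> y $ i \<and> y $ i < corner x $ i + 1" for i
  proof -
    have "\<bar>y $ i - x $ i\<bar> < \<epsilon>" using y by (simp add: cube_def)
    then show ?thesis using e by (auto simp: abs_if split: if_splits)
  qed
  then show "y \<in> cell_at (corner x)" unfolding cell_at_def by blast
qed

lemma cube_borel [measurable]: "cube x \<epsilon> \<in> sets borel"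
  unfolding cube_def by measurable

lemma cube_integrable:
  fixes g :: "real^3 \<Rightarrow> real"
  assumes "periodic g" "integrable torus g" "\<epsilon> \<le> 1 / 2"
  shows "set_integrable lebesgue (cube x \<epsilon>) g"
  by (rule set_integrable_subset[OF torus_integral_cell(1)[OF assms(1,2), of "corner x"]])
    (use cube_subset_cell[OF assms(3)] in auto)

lemma adm_abs_le: "adm A \<epsilon> x b \<Longrightarrow> \<bar>b s\<bar> \<le> A / \<epsilon>"
  using admD(2,3)[of A \<epsilon> x b s] by simp

text \<open>Exchanging one factor of the kernel changes the average by the integral of the weak derivative in
  that direction against a function which is at most \<open>(A / \<epsilon>)\<^sup>2\<close> and lives on the cube.\<close>

lemma exchange_factor:
  fixes f g :: "real^3 \<Rightarrow> real"
  assumes w: "weak_dx [j] f g" and p: "periodic f" "periodic g"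
    and b: "adm3 A \<epsilon> x b" and c: "adm A \<epsilon> (x $ j) c" and \<epsilon>: "0 < \<epsilon>" "\<epsilon> \<le> 1 / 2"
  shows "\<bar>(\<integral>y. f y * tens b y \<partial>lebesgue) - (\<integral>y. f y * tens (b(j := c)) y \<partial>lebesgue)\<bar>
      \<le> A\<^sup>2 / \<epsilon>\<^sup>2 * (LINT y:cube x \<epsilon>|lebesgue. \<bar>g y\<bar>)"
proof -
  have i: "integrable torus f" "integrable torus g"
    using w by (auto simp: weak_dx_def weak_deriv_def)
  have babs: "\<bar>b i s\<bar> \<le> A / \<epsilon>" for i s using b adm_abs_le unfolding adm3_def by blast
  have bj: "adm A \<epsilon> (x $ j) (b j)" using b by (simp add: adm3_def)
  obtain \<Gamma> where \<Gamma>: "smooth \<Gamma>" "deriv \<Gamma> = (\<lambda>s. b j s - c s)" "\<And>s. \<bar>\<Gamma> s\<bar> \<le> 1"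
    "\<And>s. \<bar>s - x $ j\<bar> \<ge> \<epsilon> \<Longrightarrow> \<Gamma> s = 0"
    using adm_diff_primitive[OF bj c \<epsilon>(1)] by blast
  have b': "adm3 A \<epsilon> x (b(j := c))" using b c by (simp add: adm3_def)
  have sb: "supp_at (corner x) b" "supp_at (corner x) (b(j := c))"
    using adm3_supp b b' \<epsilon> by blast+
  have s\<Gamma>: "supp_at (corner x) (b(j := \<Gamma>))"
    unfolding supp_at_def
  proof (intro allI conjI impI)
    show "smooth ((b(j := \<Gamma>)) i)" for i using \<Gamma>(1) supp_atD[OF sb(1)] by simp
    show "(b(j := \<Gamma>)) i s = 0" if "s \<notin> {corner x $ i<..<corner x $ i + 1}" for i s
    proof (cases "i = j")
      case True
      then have "\<bar>s - x $ j\<bar> \<ge> \<epsilon>" using that \<epsilon> by (auto simp: abs_if split: if_splits)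
      then show ?thesis using True \<Gamma>(4) by simp
    qed (use supp_atD[OF sb(1)] that in auto)
  qed
  have split: "tens ((b(j := \<Gamma>))(j := deriv ((b(j := \<Gamma>)) j))) y = tens b y - tens (b(j := c)) y" for y
    by (simp add: tens_upd tens_split[of b y j] \<Gamma>(2) left_diff_distrib)
  have fi: "integrable lebesgue (\<lambda>y. f y * tens b y)" "integrable lebesgue (\<lambda>y. f y * tens (b(j := c)) y)"
    using torus_integral_tens(1) sb p i by blast+
  have gi: "integrable lebesgue (\<lambda>y. g y * tens (b(j := \<Gamma>)) y)"
    using torus_integral_tens(1) s\<Gamma> p i by blast
  have "(\<integral>y. f y * tens b y \<partial>lebesgue) - (\<integral>y. f y * tens (b(j := c)) y \<partial>lebesgue)
      = (\<integral>y. f y * (tens b y - tens (b(j := c)) y) \<partial>lebesgue)"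
    using Bochner_Integration.integral_diff[OF fi] by (simp add: right_diff_distrib)
  also have "\<dots> = - (\<integral>y. g y * tens (b(j := \<Gamma>)) y \<partial>lebesgue)"
    using weak_dx_tens[OF w p s\<Gamma>] by (simp only: split)
  finally have E: "\<bar>(\<integral>y. f y * tens b y \<partial>lebesgue) - (\<integral>y. f y * tens (b(j := c)) y \<partial>lebesgue)\<bar>
      = \<bar>\<integral>y. g y * tens (b(j := \<Gamma>)) y \<partial>lebesgue\<bar>" by simp
  have T: "\<bar>tens (b(j := \<Gamma>)) y\<bar> \<le> A\<^sup>2 / \<epsilon>\<^sup>2 * indicator (cube x \<epsilon>) y" for y
  proof (cases "y \<in> cube x \<epsilon>")
    case True
    have "\<bar>tens (b(j := \<Gamma>)) y\<bar> = \<bar>\<Gamma> (y $ j)\<bar> * (\<Prod>i\<in>UNIV - {j}. \<bar>b i (y $ i)\<bar>)"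
      by (simp add: tens_upd abs_mult abs_prod)
    also have "\<dots> \<le> 1 * (\<Prod>i\<in>UNIV - {j}. A / \<epsilon>)"
      using babs by (intro mult_mono \<Gamma> prod_mono prod_nonneg) auto
    also have "\<dots> = A\<^sup>2 / \<epsilon>\<^sup>2" by (simp add: power_divide card_Diff_singleton)
    finally show ?thesis using True by simp
  next
    case False
    then obtain i where i: "\<bar>y $ i - x $ i\<bar> \<ge> \<epsilon>" unfolding cube_def by (auto simp: not_less)
    have "(b(j := \<Gamma>)) i (y $ i) = 0"
      using i \<Gamma>(4) b by (cases "i = j") (auto simp: adm3_def dest: admD(4))
    then have "tens (b(j := \<Gamma>)) y = 0" unfolding tens_def by (intro prod_zero bexI[of _ i]) auto
    then show ?thesis using False by simp
  qed
  have ci: "set_integrable lebesgue (cube x \<epsilon>) (\<lambda>y. \<bar>g y\<bar>)"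
    using cube_integrable[of "\<lambda>y. \<bar>g y\<bar>" \<epsilon> x] p i \<epsilon> by (simp add: periodic_def)
  have "\<bar>\<integral>y. g y * tens (b(j := \<Gamma>)) y \<partial>lebesgue\<bar> \<le> (\<integral>y. \<bar>g y * tens (b(j := \<Gamma>)) y\<bar> \<partial>lebesgue)"
    by (rule integral_abs_bound)
  also have "\<dots> \<le> (\<integral>y. A\<^sup>2 / \<epsilon>\<^sup>2 * (indicator (cube x \<epsilon>) y *\<^sub>R \<bar>g y\<bar>) \<partial>lebesgue)"
  proof (rule integral_mono)
    show "integrable lebesgue (\<lambda>y. \<bar>g y * tens (b(j := \<Gamma>)) y\<bar>)" using gi by simp
    show "integrable lebesgue (\<lambda>y. A\<^sup>2 / \<epsilon>\<^sup>2 * (indicator (cube x \<epsilon>) y *\<^sub>R \<bar>g y\<bar>))"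
      using ci by (simp only: set_integrable_def integrable_mult_right)
    show "\<bar>g y * tens (b(j := \<Gamma>)) y\<bar> \<le> A\<^sup>2 / \<epsilon>\<^sup>2 * (indicator (cube x \<epsilon>) y *\<^sub>R \<bar>g y\<bar>)" for y
      using mult_left_mono[OF T[of y], of "\<bar>g y\<bar>"] by (simp add: abs_mult mult_ac)
  qed
  finally show ?thesis unfolding E by (simp add: set_lebesgue_integral_def)
qed

text \<open>The Morrey-space condition: \<open>N \<epsilon>\<^sup>2\<^sup>+\<^sup>\<alpha>\<close> is the growth of the integral of the gradient over a cube of
  half-width \<open>\<epsilon>\<close> that corresponds to Hoelder exponent \<open>\<alpha>\<close>. It covers gradients in \<open>L\<^sup>q\<close> and bounded
  gradients alike.\<close>

definition grad_bound :: "real \<Rightarrow> real \<Rightarrow> (3 \<Rightarrow> real^3 \<Rightarrow> real) \<Rightarrow> bool" where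
  "grad_bound \<alpha> N g \<longleftrightarrow> (\<forall>j x \<epsilon>. 0 < \<epsilon> \<longrightarrow> \<epsilon> \<le> 1 / 2 \<longrightarrow>
     (LINT y:cube x \<epsilon>|lebesgue. \<bar>g j y\<bar>) \<le> N * \<epsilon> powr (2 + \<alpha>))"

text \<open>The three factors are exchanged one after the other.\<close>

lemma oscillation:
  fixes f :: "real^3 \<Rightarrow> real"
  assumes w: "\<And>j. weak_dx [j] f (g j)" and p: "periodic f" "\<And>j. periodic (g j)"
    and N: "grad_bound \<alpha> N g"
    and b: "adm3 A \<epsilon> x b" and c: "adm3 A \<epsilon> x c" and \<epsilon>: "0 < \<epsilon>" "\<epsilon> \<le> 1 / 2"
  shows "\<bar>(\<integral>y. f y * tens b y \<partial>lebesgue) - (\<integral>y. f y * tens c y \<partial>lebesgue)\<bar> \<le> 3 * A\<^sup>2 * N * \<epsilon> powr \<alpha>"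
proof -
  let ?I = "\<lambda>b. \<integral>y. f y * tens b y \<partial>lebesgue"
  have step: "\<bar>?I b - ?I (b(j := c j))\<bar> \<le> A\<^sup>2 * N * \<epsilon> powr \<alpha>" if "adm3 A \<epsilon> x b" for b j
  proof -
    have "\<bar>?I b - ?I (b(j := c j))\<bar> \<le> A\<^sup>2 / \<epsilon>\<^sup>2 * (LINT y:cube x \<epsilon>|lebesgue. \<bar>g j y\<bar>)"
      by (rule exchange_factor[OF w p that _ \<epsilon>]) (use c in \<open>simp add: adm3_def\<close>)
    also have "\<dots> \<le> A\<^sup>2 / \<epsilon>\<^sup>2 * (N * \<epsilon> powr (2 + \<alpha>))"
      using N \<epsilon> by (intro mult_left_mono) (auto simp: grad_bound_def)
    also have "\<dots> = A\<^sup>2 * N * \<epsilon> powr \<alpha>"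
      using \<epsilon> by (simp add: powr_add powr_numeral)
    finally show ?thesis .
  qed
  have a1: "adm3 A \<epsilon> x (b(1 := c 1))" and a2: "adm3 A \<epsilon> x (b(1 := c 1, 2 := c 2))"
    using b c by (auto simp: adm3_def)
  have "b(1 := c 1, 2 := c 2, 3 := c 3) = c" by (auto simp: fun_eq_iff) (metis exhaust_3)
  then show ?thesis
    using step[OF b, of 1] step[OF a1, of 2] step[OF a2, of 3] by simp
qed

definition mol :: "(real^3 \<Rightarrow> real) \<Rightarrow> real \<Rightarrow> real^3 \<Rightarrow> real" where
  "mol f \<epsilon> x = (\<integral>y. f y * tens (\<lambda>i. kern \<epsilon> (x $ i)) y \<partial>lebesgue)"

lemma adm3_kern: "0 < \<epsilon> \<Longrightarrow> adm3 bumpA \<epsilon> x (\<lambda>i. kern \<epsilon> (x $ i))"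
  by (simp add: adm3_def adm_kern)

lemma adm3_kern':
  assumes "0 < \<epsilon>" "\<epsilon> \<le> \<epsilon>'" "\<epsilon>' \<le> 2 * \<epsilon>" "\<And>i. \<epsilon> + \<bar>x $ i - x' $ i\<bar> \<le> \<epsilon>'"
  shows "adm3 (2 * bumpA) \<epsilon>' x' (\<lambda>i. kern \<epsilon> (x $ i))"
  unfolding adm3_def
proof
  fix i
  show "adm (2 * bumpA) \<epsilon>' (x' $ i) (kern \<epsilon> (x $ i))"
    by (rule adm_weaken[OF adm_kern])
      (use assms bumpA_pos in \<open>auto simp: field_simps\<close>)
qed


lemma continuous_integrable_torus:
  fixes F :: "real^3 \<Rightarrow> real"
  assumes "continuous_on UNIV F"
  shows "integrable torus F"
proof -
  have "set_integrable lebesgue unit_cell F"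
  proof (rule set_integrable_subset[where A = "cbox 0 (\<chi> i. 1)"])
    show "set_integrable lebesgue (cbox 0 (\<chi> i. 1)) F"
      by (rule absolutely_integrable_continuous) (use assms continuous_on_subset in blast)
    show "unit_cell \<subseteq> cbox 0 (\<chi> i. 1)"
      by (auto simp: unit_cell_def mem_box_cart) (metis less_eq_real_def)
  qed simp
  then show ?thesis by (simp add: integrable_torus_iff)
qed

lemma measure_torus: "measure torus (space torus) = 1" "finite_measure torus"
proof -
  have sub: "box 0 (\<chi> i. 1) \<subseteq> unit_cell" "unit_cell \<subseteq> cbox 0 (\<chi> i. 1)"
    by (auto simp: unit_cell_def mem_box_cart) (metis less_eq_real_def)+
  have c: "emeasure lebesgue (cbox 0 (\<chi> i. 1) :: (real^3) set) = 1" "emeasure lebesgue (box 0 (\<chi> i. 1) :: (real^3) set) = 1"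
    by (simp_all add: emeasure_lborel_cbox_eq emeasure_lborel_box_eq Basis_vec_def inner_axis prod.neutral)
  have "emeasure lebesgue unit_cell = 1"
    using emeasure_mono[OF sub(1), of lebesgue] emeasure_mono[OF sub(2), of lebesgue] c by (auto intro: antisym)
  then have e: "emeasure torus (space torus) = 1"
    by (simp add: torus_def emeasure_restrict_space)
  show "finite_measure torus" using e by (intro finite_measureI) simp
  show "measure torus (space torus) = 1" using e by (simp add: measure_def)
qed

lemma mol_continuous_close:
  assumes F: "continuous_on UNIV F" "periodic F" and \<epsilon>: "0 < \<epsilon>" "\<epsilon> \<le> 1 / 2"
    and \<delta>: "\<And>y. y \<in> cube x \<epsilon> \<Longrightarrow> \<bar>F y - F x\<bar> \<le> \<delta>"
  shows "\<bar>mol F \<epsilon> x - F x\<bar> \<le> \<delta>"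
proof -
  let ?T = "tens (\<lambda>i. kern \<epsilon> (x $ i))"
  note a = adm3_kern[OF \<epsilon>(1), of x]
  note m = tens_mass(3,4)[OF a \<epsilon>(1)]
  have i: "integrable lebesgue (\<lambda>y. F y * ?T y)"
    by (rule torus_integral_tens(1)[OF adm3_supp[OF a \<epsilon>(2)] F(2) continuous_integrable_torus[OF F(1)]])
  have "mol F \<epsilon> x - F x = (\<integral>y. F y * ?T y \<partial>lebesgue) - (\<integral>y. F x * ?T y \<partial>lebesgue)"
    using m by (simp add: mol_def)
  also have "\<dots> = (\<integral>y. F y * ?T y - F x * ?T y \<partial>lebesgue)"
    by (rule Bochner_Integration.integral_diff[symmetric, OF i]) (use m in simp)
  finally have "\<bar>mol F \<epsilon> x - F x\<bar> \<le> (\<integral>y. \<bar>F y * ?T y - F x * ?T y\<bar> \<partial>lebesgue)"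
    using integral_abs_bound by metis
  also have "\<dots> \<le> (\<integral>y. \<delta> * ?T y \<partial>lebesgue)"
  proof (rule integral_mono)
    show "integrable lebesgue (\<lambda>y. \<bar>F y * ?T y - F x * ?T y\<bar>)"
      using i m by (intro integrable_abs Bochner_Integration.integrable_diff) auto
    show "integrable lebesgue (\<lambda>y. \<delta> * ?T y)" using m by simp
    show "\<bar>F y * ?T y - F x * ?T y\<bar> \<le> \<delta> * ?T y" for y
    proof (cases "y \<in> cube x \<epsilon>")
      case True
      have "\<bar>F y * ?T y - F x * ?T y\<bar> = \<bar>F y - F x\<bar> * ?T y"
        using tens_nonneg[OF a, of y] by (simp add: left_diff_distrib[symmetric] abs_mult)
      then show ?thesis using mult_right_mono[OF \<delta>[OF True] tens_nonneg[OF a, of y]] by simp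
    qed (use tens_zero_cube[OF a, of y] in simp)
  qed
  also have "\<dots> = \<delta>" using m by simp
  finally show ?thesis .
qed

lemma mol_periodic:
  assumes "periodic f" "integrable torus f" "0 < \<epsilon>" "\<epsilon> \<le> 1 / 2"
  shows "mol f \<epsilon> (x + axis j 1) = mol f \<epsilon> x"
proof -
  let ?T = "\<lambda>x. tens (\<lambda>i. kern \<epsilon> (x $ i))"
  have i: "integrable lebesgue (\<lambda>y. f y * ?T (x + axis j 1) y)"
    by (rule torus_integral_tens(1)[OF adm3_supp[OF adm3_kern[OF assms(3)] assms(4)] assms(1,2)])
  have "mol f \<epsilon> (x + axis j 1) = (\<integral>y. f (axis j 1 + y) * ?T (x + axis j 1) (axis j 1 + y) \<partial>lebesgue)"
    unfolding mol_def using lebesgue_integral_plus(2)[OF i, of "axis j 1"] by simp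
  also have "\<dots> = mol f \<epsilon> x"
    unfolding mol_def using assms(1)
    by (intro Bochner_Integration.integral_cong) (auto simp: periodic_def tens_def kern_def add.commute[of "axis j 1"])
  finally show ?thesis .
qed

lemma mol_bound:
  assumes "periodic f" "integrable torus f" "0 < \<epsilon>" "\<epsilon> \<le> 1 / 2"
  shows "\<bar>mol f \<epsilon> x\<bar> \<le> (bumpA / \<epsilon>) ^ 3 * (\<integral>y. \<bar>f y\<bar> \<partial>torus)"
proof -
  note a = adm3_kern[OF assms(3), of x]
  have "\<bar>mol f \<epsilon> x\<bar> \<le> (\<integral>y. \<bar>f y * tens (\<lambda>i. kern \<epsilon> (x $ i)) y\<bar> \<partial>lebesgue)"
    unfolding mol_def by (rule integral_abs_bound)
  also have "\<dots> \<le> (bumpA / \<epsilon>) ^ 3 * (\<integral>y. \<bar>f y\<bar> \<partial>torus)"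
    unfolding abs_mult by (rule torus_integral_tens_bound(2)[OF adm3_supp[OF a assms(4)] assms(1,2) tens_le[OF a]])
  finally show ?thesis .
qed

lemma bump_measurable [measurable]: "bump \<in> borel_measurable borel"
  by (intro borel_measurable_continuous_onI smooth_continuous_on admD(1)[OF adm_bump])

section \<open>Identification of the limit of the averages\<close>

text \<open>Boxes generate the Borel sets and are stable under intersection, so by a Dynkin argument all
  set integrals vanish.\<close>

lemma AE_zero_of_box_integrals:
  fixes E :: "'a::euclidean_space \<Rightarrow> real"
  assumes i: "integrable lborel E" and z: "\<And>a b. (LINT y:box a b|lborel. E y) = 0"
    and t: "(\<integral>y. E y \<partial>lborel) = 0"
  shows "AE y in lborel. E y = 0"
proof (rule sigma_finite_measure.density_zero[OF lborel.sigma_finite_measure_axioms i])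
  fix A :: "'a set" assume "A \<in> sets lborel"
  then have A: "A \<in> sigma_sets UNIV (range (\<lambda>(a, b). box a b :: 'a set))"
    by (simp add: borel_eq_box)
  have st: "Int_stable (range (\<lambda>(a, b). box a b :: 'a set))"
  proof (rule Int_stableI)
    fix X Y :: "'a set"
    assume "X \<in> range (\<lambda>(a, b). box a b)" "Y \<in> range (\<lambda>(a, b). box a b)"
    then obtain a b c d where "X = box a b" "Y = box c d" by auto
    then have "X \<inter> Y = (\<lambda>(a, b). box a b) (\<Sum>i\<in>Basis. max (a \<bullet> i) (c \<bullet> i) *\<^sub>R i, \<Sum>i\<in>Basis. min (b \<bullet> i) (d \<bullet> i) *\<^sub>R i)"
      by (simp add: box_Int_box)
    then show "X \<inter> Y \<in> range (\<lambda>(a, b). box a b)" by blast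
  qed
  have cl: "range (\<lambda>(a, b). box a b :: 'a set) \<subseteq> Pow UNIV" by simp
  have si: "set_integrable lborel A E" if "A \<in> sets borel" for A
    unfolding set_integrable_def by (rule integrable_mult_indicator[OF _ i]) (use that in simp)
  from st cl A show "(LINT y:A|lborel. E y) = 0"
  proof (induction rule: sigma_sets_induct_disjoint)
    case (basic A)
    then show ?case using z by auto
  next
    case empty
    then show ?case by (simp add: set_lebesgue_integral_def)
  next
    case (compl A)
    then have A: "A \<in> sets borel" by (simp add: borel_eq_box)
    have "(LINT y:A \<union> (UNIV - A)|lborel. E y) = (LINT y:A|lborel. E y) + (LINT y:UNIV - A|lborel. E y)"
      using A by (intro set_integral_Un si) auto
    moreover have "A \<union> (UNIV - A) = UNIV" by auto
    ultimately show ?case using compl t by (simp add: set_lebesgue_integral_def)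
  next
    case (union A)
    then have A: "A i \<in> sets lborel" for i by (auto simp: borel_eq_box)
    have "(LINT y:(\<Union>i. A i)|lborel. E y) = (\<Sum>i. LINT y:A i|lborel. E y)"
      using A union(1) by (intro lebesgue_integral_countable_add si)
        (auto simp: disjoint_family_on_def)
    then show ?case using union by simp
  qed
qed


lemma tens_kern_commute: "tens (\<lambda>i. kern \<epsilon> (x $ i)) y = tens (\<lambda>i. kern \<epsilon> (y $ i)) x"
  unfolding tens_def by (intro prod.cong refl kern_commute)

lemma integral_norm_bound_le:
  fixes f :: "'a \<Rightarrow> real"
  assumes "integrable M w" "\<And>x. \<bar>f x\<bar> \<le> w x"
  shows "norm (\<integral>x. f x \<partial>M) \<le> (\<integral>x. w x \<partial>M)"
proof (cases "integrable M f")
  case True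
  have "\<bar>\<integral>x. f x \<partial>M\<bar> \<le> (\<integral>x. \<bar>f x\<bar> \<partial>M)" by (rule integral_abs_bound)
  also have "\<dots> \<le> (\<integral>x. w x \<partial>M)" by (rule integral_mono) (use assms True in auto)
  finally show ?thesis by simp
next
  case False
  have "0 \<le> w x" for x using assms(2)[of x] by linarith
  then show ?thesis using False by (simp add: not_integrable_integral_eq integral_nonneg_AE)
qed

text \<open>A substitute for Lebesgue's differentiation theorem. By Fubini, integrating the averages over the
  centres \<open>x\<close> in a box gives the integral of \<open>D\<close> against a function \<open>K\<close> that tends to the indicator of
  the box. Here \<open>E\<close> is a Borel version of \<open>D\<close> on the unit cube.\<close>

lemma mol_limit_zero_box:
  fixes D E :: "real^3 \<Rightarrow> real"
  assumes p: "periodic D" "integrable torus D"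
    and E: "integrable lborel E" "AE y in lborel. indicator (box 0 (\<chi> i. 1)) y * D y = E y"
    and \<epsilon>: "\<epsilon> \<longlonglongrightarrow> 0" "\<And>k::nat. 0 < \<epsilon> k" "\<And>k. \<epsilon> k \<le> 1 / 2" and \<delta>: "\<delta> \<longlonglongrightarrow> 0"
    and m: "\<And>k x. \<bar>mol D (\<epsilon> k) x\<bar> \<le> \<delta> k"
    and lu: "\<And>i. 0 \<le> l $ i" "\<And>i. u $ i \<le> 1"
  shows "(LINT y:box l u|lborel. E y) = 0"
proof -
  \<comment> \<open>The centres range over a box shrunk by the width of the kernel, so that the kernels stay inside
    the box, where \<open>E\<close> and \<open>D\<close> agree.\<close>
  define Q where "Q k = box (\<chi> i. l $ i + \<epsilon> k) (\<chi> i. u $ i - \<epsilon> k)" for k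
  define T where "T k x = tens (\<lambda>i. kern (\<epsilon> k) (x $ i))" for k x
  define K where "K k y = (\<integral>x. indicator (Q k) x * T k x y \<partial>lborel)" for k y
  have a: "adm3 bumpA (\<epsilon> k) x (\<lambda>i. kern (\<epsilon> k) (x $ i))" for k x by (rule adm3_kern[OF \<epsilon>(2)])
  have Tnn: "0 \<le> T k x y" for k x y unfolding T_def by (rule tens_nonneg[OF a])
  have Tle: "T k x y \<le> (bumpA / \<epsilon> k) ^ 3" for k x y using tens_le[OF a, of k x y] unfolding T_def by simp
  have Tz: "T k x y = 0" if "y \<notin> cube x (\<epsilon> k)" for k x y unfolding T_def by (rule tens_zero_cube[OF a that])
  have Tc: "T k x y = T k y x" for k x y unfolding T_def by (rule tens_kern_commute)
  have Ti: "integrable lborel (\<lambda>x. T k x y)" "(\<integral>x. T k x y \<partial>lborel) = 1" for k y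
    using tens_mass(1,2)[OF a[of k y] \<epsilon>(2)] unfolding Tc[of k _ y] by (simp_all add: T_def)
  have Tm[measurable]: "(\<lambda>z. T k (fst z) (snd z)) \<in> borel_measurable (lborel \<Otimes>\<^sub>M lborel)" for k
  proof -
    have nth: "(\<lambda>v::real^3. v $ i) \<in> borel_measurable lborel" for i
      by (simp add: borel_measurable_continuous_onI continuous_intros)
    have [measurable]: "(\<lambda>z::(real^3) \<times> (real^3). fst z $ i) \<in> borel_measurable (lborel \<Otimes>\<^sub>M (lborel :: (real^3) measure))" for i :: 3
      by (rule measurable_compose[OF measurable_fst nth])
    have [measurable]: "(\<lambda>z::(real^3) \<times> (real^3). snd z $ i) \<in> borel_measurable ((lborel :: (real^3) measure) \<Otimes>\<^sub>M lborel)" for i :: 3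
      by (rule measurable_compose[OF measurable_snd nth])
    show ?thesis unfolding T_def tens_def kern_def by (intro borel_measurable_prod) measurable
  qed
  have Tm1[measurable]: "T k x \<in> borel_measurable lborel" for k x
    using borel_measurable_integrable[OF tens_mass(1)[OF a[of k x] \<epsilon>(2)]] by (simp add: T_def)
  have Em[measurable]: "E \<in> borel_measurable lborel" using E(1) by simp
  have Qm[measurable]: "Q k \<in> sets lborel" for k by (simp add: Q_def)
  have Qsub: "Q k \<subseteq> box 0 (\<chi> i. 1)" for k
  proof
    fix x assume "x \<in> Q k"
    then have x: "l $ i + \<epsilon> k < x $ i" "x $ i < u $ i - \<epsilon> k" for i by (auto simp: Q_def mem_box_cart)
    have "0 < x $ i" "x $ i < 1" for i using x[of i] lu[of i] \<epsilon>(2)[of k] by linarith+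
    then show "x \<in> box 0 (\<chi> i. 1)" by (simp add: mem_box_cart)
  qed
  have unit1: "measure lborel (box 0 (\<chi> i. 1) :: (real^3) set) = 1" "emeasure lborel (box 0 (\<chi> i. 1) :: (real^3) set) = 1"
    by (simp_all add: measure_def emeasure_lborel_box_eq Basis_vec_def inner_axis prod.neutral)
  have Qi: "integrable lborel (\<lambda>x. indicator (Q k) x :: real)" for k
    by (intro integrable_real_indicator) (use emeasure_bounded_finite[OF bounded_box] in \<open>auto simp: Q_def\<close>)
  have Qmeas: "(\<integral>x. indicator (Q k) x \<partial>lborel) \<le> (1::real)" for k
  proof -
    have "measure lborel (Q k) \<le> measure lborel (box 0 (\<chi> i. 1) :: (real^3) set)"
      by (rule measure_mono_fmeasurable[OF Qsub]) (use Qm in auto)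
    then show ?thesis using unit1 by simp
  qed
  have inner: "(\<integral>y. E y * T k x y \<partial>lborel) = mol D (\<epsilon> k) x" if x: "x \<in> Q k" for k x
  proof -
    have sub: "cube x (\<epsilon> k) \<subseteq> box 0 (\<chi> i. 1)"
    proof
      fix y assume "y \<in> cube x (\<epsilon> k)"
      then have y: "\<bar>y $ i - x $ i\<bar> < \<epsilon> k" for i by (simp add: cube_def)
      have x': "l $ i + \<epsilon> k < x $ i" "x $ i < u $ i - \<epsilon> k" for i using x by (auto simp: Q_def mem_box_cart)
      have "0 < y $ i" "y $ i < 1" for i using y[of i] x'[of i] lu[of i] by linarith+
      then show "y \<in> box 0 (\<chi> i. 1)" by (simp add: mem_box_cart)
    qed
    have Dm: "integrable lebesgue (\<lambda>y. D y * T k x y)"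
      unfolding T_def by (rule torus_integral_tens(1)[OF adm3_supp[OF a \<epsilon>(3)] p])
    have ETm: "(\<lambda>y. E y * T k x y) \<in> borel_measurable lborel"
      using Tm1[of k x] Em by simp
    have "(\<integral>y. E y * T k x y \<partial>lborel) = (\<integral>y. E y * T k x y \<partial>lebesgue)"
      by (rule integral_completion[symmetric, OF ETm])
    also have "\<dots> = (\<integral>y. D y * T k x y \<partial>lebesgue)"
    proof (rule integral_cong_AE)
      show "(\<lambda>y. E y * T k x y) \<in> borel_measurable lebesgue" using ETm by (rule measurable_completion)
      show "(\<lambda>y. D y * T k x y) \<in> borel_measurable lebesgue" using Dm by simp
      show "AE y in lebesgue. E y * T k x y = D y * T k x y"
        using AE_completion[OF E(2)]
      proof eventually_elim
        case (elim y)
        then show ?case using sub Tz[of y x k] by (cases "y \<in> cube x (\<epsilon> k)") (auto simp: indicator_def split: if_splits)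
      qed
    qed
    finally show ?thesis by (simp add: mol_def T_def)
  qed
  have fub: "(\<integral>y. E y * K k y \<partial>lborel) = (\<integral>x. indicator (Q k) x * mol D (\<epsilon> k) x \<partial>lborel)" for k
  proof -
    define \<phi> where "\<phi> x y = indicator (Q k) x * (E y * T k x y)" for x y
    define B where "B = (bumpA / \<epsilon> k) ^ 3"
    have B: "0 \<le> B" using Tnn[of k 0 0] Tle[of k 0 0] unfolding B_def by linarith
    have \<phi>m: "(\<lambda>z. \<phi> (fst z) (snd z)) \<in> borel_measurable (lborel \<Otimes>\<^sub>M lborel)"
      unfolding \<phi>_def using Tm[of k] by measurable
    have b: "\<bar>\<phi> x y\<bar> \<le> indicator (Q k) x * (B * \<bar>E y\<bar>)" for x y
      using mult_right_mono[OF Tle[of k x y], of "\<bar>E y\<bar>"] Tnn[of k x y]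
      by (auto simp: \<phi>_def B_def abs_mult indicator_def mult.commute)
    have i2: "integrable lborel (\<lambda>y. \<phi> x y)" for x
    proof (rule Bochner_Integration.integrable_bound)
      show "integrable lborel (\<lambda>y. indicator (Q k) x * (B * \<bar>E y\<bar>))" using E(1) by simp
      show "(\<lambda>y. \<phi> x y) \<in> borel_measurable lborel" unfolding \<phi>_def using Tm1[of k x] Em by simp
      show "AE y in lborel. norm (\<phi> x y) \<le> norm (indicator (Q k) x * (B * \<bar>E y\<bar>))"
        using b[of x] B by (auto simp: abs_mult)
    qed
    have "integrable (lborel \<Otimes>\<^sub>M lborel) (\<lambda>z. \<phi> (fst z) (snd z))"
    proof (rule lborel_pair.Fubini_integrable[OF \<phi>m])
      show "AE x in lborel. integrable lborel (\<lambda>y. \<phi> (fst (x, y)) (snd (x, y)))" using i2 by simp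
      show "integrable lborel (\<lambda>x. \<integral>y. norm (\<phi> (fst (x, y)) (snd (x, y))) \<partial>lborel)"
      proof (rule Bochner_Integration.integrable_bound)
        show "integrable lborel (\<lambda>x. indicator (Q k) x * (B * (\<integral>y. \<bar>E y\<bar> \<partial>lborel)))"
          using Qi by simp
        show "(\<lambda>x. \<integral>y. norm (\<phi> (fst (x, y)) (snd (x, y))) \<partial>lborel) \<in> borel_measurable lborel"
          using \<phi>m by measurable
        show "AE x in lborel. norm (\<integral>y. norm (\<phi> (fst (x, y)) (snd (x, y))) \<partial>lborel)
            \<le> norm (indicator (Q k) x * (B * (\<integral>y. \<bar>E y\<bar> \<partial>lborel)))"
        proof (rule AE_I2)
          fix x
          have "(\<integral>y. \<bar>\<phi> x y\<bar> \<partial>lborel) \<le> (\<integral>y. indicator (Q k) x * (B * \<bar>E y\<bar>) \<partial>lborel)"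
            by (rule integral_mono) (use i2 E(1) b in auto)
          then show "norm (\<integral>y. norm (\<phi> (fst (x, y)) (snd (x, y))) \<partial>lborel)
            \<le> norm (indicator (Q k) x * (B * (\<integral>y. \<bar>E y\<bar> \<partial>lborel)))"
            using B by (simp add: abs_mult)
        qed
      qed
    qed
    then have "integrable (lborel \<Otimes>\<^sub>M lborel) (\<lambda>(x, y). \<phi> x y)" by (simp add: case_prod_unfold)
    from lborel_pair.Fubini_integral[OF this]
    have "(\<integral>y. (\<integral>x. \<phi> x y \<partial>lborel) \<partial>lborel) = (\<integral>x. (\<integral>y. \<phi> x y \<partial>lborel) \<partial>lborel)" .
    moreover have "(\<integral>x. \<phi> x y \<partial>lborel) = E y * K k y" for y
    proof -
      have "(\<integral>x. \<phi> x y \<partial>lborel) = (\<integral>x. E y * (indicator (Q k) x * T k x y) \<partial>lborel)"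
        unfolding \<phi>_def by (intro Bochner_Integration.integral_cong) auto
      then show ?thesis by (simp add: K_def)
    qed
    moreover have "(\<integral>y. \<phi> x y \<partial>lborel) = indicator (Q k) x * mol D (\<epsilon> k) x" for x
      using inner[of x k] by (cases "x \<in> Q k") (auto simp: \<phi>_def)
    ultimately show ?thesis by simp
  qed
  have QTi: "integrable lborel (\<lambda>x. indicator (Q k) x * T k x y)" for k y
    using integrable_mult_indicator[OF Qm Ti(1), of k k y] by simp
  have K01: "0 \<le> K k y" "K k y \<le> 1" for k y
  proof -
    show "0 \<le> K k y" unfolding K_def using Tnn by (intro integral_nonneg_AE) auto
    have "K k y \<le> (\<integral>x. T k x y \<partial>lborel)" unfolding K_def
      by (rule integral_mono[OF QTi Ti(1)]) (use Tnn in \<open>auto simp: indicator_def\<close>)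
    then show "K k y \<le> 1" using Ti(2) by simp
  qed
  have Klim: "(\<lambda>k. K k y) \<longlonglongrightarrow> indicator (box l u) y" for y
  proof (cases "y \<in> box l u")
    case True
    then have y: "l $ i < y $ i" "y $ i < u $ i" for i by (auto simp: mem_box_cart)
    have "\<forall>\<^sub>F k in sequentially. \<forall>i\<in>UNIV. 2 * \<epsilon> k < min (y $ i - l $ i) (u $ i - y $ i)"
    proof (rule eventually_ball_finite)
      have "(\<lambda>k. 2 * \<epsilon> k) \<longlonglongrightarrow> 2 * 0" by (intro tendsto_intros \<epsilon>)
      then have "(\<lambda>k. 2 * \<epsilon> k) \<longlonglongrightarrow> 0" by simp
      from order_tendstoD(2)[OF this]
      show "\<forall>i\<in>UNIV. \<forall>\<^sub>F k in sequentially. 2 * \<epsilon> k < min (y $ i - l $ i) (u $ i - y $ i)"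
        using y by (simp add: eventually_conj_iff)
    qed auto
    then have "\<forall>\<^sub>F k in sequentially. K k y = 1"
    proof eventually_elim
      case (elim k)
      have "indicator (Q k) x * T k x y = T k x y" for x
      proof (cases "y \<in> cube x (\<epsilon> k)")
        case True
        then have c: "\<bar>y $ i - x $ i\<bar> < \<epsilon> k" for i by (simp add: cube_def)
        have "l $ i + \<epsilon> k < x $ i \<and> x $ i < u $ i - \<epsilon> k" for i
        proof -
          have "2 * \<epsilon> k < y $ i - l $ i" "2 * \<epsilon> k < u $ i - y $ i" using elim by auto
          then show ?thesis using c[of i] by linarith
        qed
        then have "x \<in> Q k" by (simp add: Q_def mem_box_cart)
        then show ?thesis by simp
      qed (use Tz[of y x k] in simp)
      then show ?case by (simp only: K_def Ti(2))
    qed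
    then show ?thesis using True by (simp add: tendsto_eventually)
  next
    case False
    then obtain i where i: "\<not> (l $ i < y $ i \<and> y $ i < u $ i)" by (auto simp: mem_box_cart)
    have "indicator (Q k) x * T k x y = 0" for k x
    proof (cases "x \<in> Q k")
      case True
      then have "l $ i + \<epsilon> k < x $ i" "x $ i < u $ i - \<epsilon> k" by (auto simp: Q_def mem_box_cart)
      then have "\<epsilon> k \<le> \<bar>y $ i - x $ i\<bar>" using i by linarith
      then have "y \<notin> cube x (\<epsilon> k)" unfolding cube_def by (auto simp: not_less)
      then show ?thesis using Tz[of y x k] by simp
    qed simp
    then have "K k y = 0" for k by (simp only: K_def) simp
    then show ?thesis using False by simp
  qed
  have Km: "(\<lambda>y. K k y) \<in> borel_measurable lborel" for k
  proof -
    have "(\<lambda>y. K k y) = (\<lambda>y. \<integral>x. indicator (Q k) x * T k y x \<partial>lborel)"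
      unfolding K_def by (intro ext Bochner_Integration.integral_cong refl) (simp add: Tc[of k])
    then show ?thesis using Tm[of k] by simp
  qed
  have lim1: "(\<lambda>k. \<integral>y. E y * K k y \<partial>lborel) \<longlonglongrightarrow> (\<integral>y. E y * indicator (box l u) y \<partial>lborel)"
  proof (rule integral_dominated_convergence[where w = "\<lambda>y. \<bar>E y\<bar>"])
    show "AE y in lborel. (\<lambda>k. E y * K k y) \<longlonglongrightarrow> E y * indicator (box l u) y"
      by (intro AE_I2 tendsto_mult_left Klim)
    show "AE y in lborel. norm (E y * K k y) \<le> \<bar>E y\<bar>" for k
      using K01 by (auto simp: abs_mult intro!: mult_left_le)
  qed (use E(1) Km in auto)
  have lim2: "(\<lambda>k. \<integral>y. E y * K k y \<partial>lborel) \<longlonglongrightarrow> 0"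
  proof (rule Lim_null_comparison[OF _ \<delta>], rule always_eventually, rule allI)
    fix k
    have d0: "0 \<le> \<delta> k" using m[of k 0] by linarith
    have "norm (\<integral>x. indicator (Q k) x * mol D (\<epsilon> k) x \<partial>lborel) \<le> (\<integral>x. \<delta> k * indicator (Q k) x \<partial>lborel)"
      by (rule integral_norm_bound_le) (use Qi m d0 in \<open>auto simp: indicator_def abs_mult\<close>)
    also have "\<dots> \<le> \<delta> k" using mult_left_mono[OF Qmeas d0, of k] by simp
    finally show "norm (\<integral>y. E y * K k y \<partial>lborel) \<le> \<delta> k" unfolding fub .
  qed
  show ?thesis using LIMSEQ_unique[OF lim1 lim2] by (simp add: set_lebesgue_integral_def mult.commute)
qed


text \<open>What the box integrals give on the torus. It identifies the limits of averages, and it also shows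
  that weak derivatives of order zero are unique.\<close>

lemma mol_limit_zero:
  fixes D :: "real^3 \<Rightarrow> real"
  assumes p: "periodic D" "integrable torus D"
    and \<epsilon>: "\<epsilon> \<longlonglongrightarrow> 0" "\<And>k::nat. 0 < \<epsilon> k" "\<And>k. \<epsilon> k \<le> 1 / 2" and \<delta>: "\<delta> \<longlonglongrightarrow> 0"
    and m: "\<And>k x. \<bar>mol D (\<epsilon> k) x\<bar> \<le> \<delta> k"
  shows "AE x in torus. D x = 0"
proof -
  let ?U = "box 0 (\<chi> i. 1) :: (real^3) set"
  have sub: "?U \<subseteq> unit_cell" "unit_cell \<subseteq> cbox 0 (\<chi> i. 1)"
    by (auto simp: unit_cell_def mem_box_cart) (metis less_eq_real_def)+
  have iD: "set_integrable lebesgue ?U D"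
    by (rule set_integrable_subset[OF _ _ sub(1)]) (use p(2) in \<open>auto simp: integrable_torus_iff\<close>)
  then have iD': "integrable lebesgue (\<lambda>y. indicator ?U y * D y)" by (simp add: set_integrable_def)
  then have "(\<lambda>y. indicator ?U y * D y) \<in> borel_measurable (completion lborel)" by simp
  from completion_ex_borel_measurable_real[OF this]
  obtain E0 where E0: "E0 \<in> borel_measurable lborel" "AE y in lborel. indicator ?U y * D y = E0 y" by blast
  have "integrable lebesgue E0"
    using integrable_cong_AE_imp[OF iD'] E0(1) AE_completion[OF E0(2)]
    by (metis (mono_tags, lifting) AE_cong measurable_completion)
  then have iE0: "integrable lborel E0" using E0(1) by (simp add: integrable_completion)
  define E where "E y = indicator ?U y * E0 y" for y
  have iE: "integrable lborel E"
    unfolding E_def using integrable_mult_indicator[OF _ iE0, of ?U] by simp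
  have aeE: "AE y in lborel. indicator ?U y * D y = E y"
    using E0(2) by eventually_elim (auto simp: E_def indicator_def)
  have box: "(LINT y:box a b|lborel. E y) = 0" for a b
  proof -
    define l :: "real^3" where "l = (\<chi> i. max (a $ i) 0)"
    define u :: "real^3" where "u = (\<chi> i. min (b $ i) 1)"
    have "(LINT y:box l u|lborel. E y) = 0"
      by (rule mol_limit_zero_box[OF p iE aeE \<epsilon> \<delta> m]) (auto simp: l_def u_def)
    moreover have "indicator (box l u) y *\<^sub>R E y = indicator (box a b) y *\<^sub>R E y" for y
      by (auto simp: E_def indicator_def mem_box_cart l_def u_def)
    ultimately show ?thesis by (simp only: set_lebesgue_integral_def)
  qed
  have "(\<integral>y. E y \<partial>lborel) = (LINT y:?U|lborel. E y)"
    by (auto simp: set_lebesgue_integral_def E_def indicator_def intro!: Bochner_Integration.integral_cong)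
  then have "AE y in lborel. E y = 0" using AE_zero_of_box_integrals[OF iE box] box by simp
  with aeE have "AE y in lborel. y \<in> ?U \<longrightarrow> D y = 0" by eventually_elim auto
  then have "AE y in lebesgue. y \<in> ?U \<longrightarrow> D y = 0" by (rule AE_completion)
  moreover have "AE y in lebesgue. y \<notin> cbox 0 (\<chi> i. 1) - ?U"
    by (rule AE_not_in) (use negligible_frontier_interval[of 0 "\<chi> i. 1 :: real^3"] in
      \<open>simp add: negligible_iff_null_sets\<close>)
  ultimately have "AE y in lebesgue. y \<in> unit_cell \<longrightarrow> D y = 0"
    by eventually_elim (use sub in auto)
  then show ?thesis unfolding torus_def by (subst AE_restrict_space_iff) auto
qed

section \<open>The Morrey embedding\<close>

definition eps :: "nat \<Rightarrow> real" where
  "eps k = (1 / 2) ^ k / 4"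

lemma eps_pos: "0 < eps k" and eps_le: "eps k \<le> 1 / 4" and eps_Suc: "2 * eps (Suc k) = eps k"
  by (auto simp: eps_def power_le_one)

lemma eps_lim: "eps \<longlonglongrightarrow> 0"
  unfolding eps_def[abs_def] by (auto intro!: tendsto_eq_intros LIMSEQ_realpow_zero)

lemma geometric_telescope:
  fixes m :: "nat \<Rightarrow> real"
  assumes s: "\<And>k. \<bar>m (Suc k) - m k\<bar> \<le> c * e k" and e: "\<And>k. e (Suc k) = r * e k" and r: "0 \<le> r" "r < 1"
    and e0: "\<And>k. 0 \<le> e k" and c: "0 \<le> c"
  obtains L where "m \<longlonglongrightarrow> L" "\<And>k. \<bar>L - m k\<bar> \<le> c / (1 - r) * e k"
proof -
  have A: "\<bar>m (k + n) - m k\<bar> \<le> c / (1 - r) * e k * (1 - r ^ n)" for k n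
  proof (induction n)
    case (Suc n)
    have en: "e (k + n) = r ^ n * e k" by (induction n) (auto simp: e)
    have "\<bar>m (k + Suc n) - m k\<bar> \<le> \<bar>m (Suc (k + n)) - m (k + n)\<bar> + \<bar>m (k + n) - m k\<bar>" by simp
    also have "\<dots> \<le> c * (r ^ n * e k) + c / (1 - r) * e k * (1 - r ^ n)"
      using s[of "k + n"] Suc.IH unfolding en by linarith
    also have "\<dots> = c / (1 - r) * e k * (1 - r ^ Suc n)"
      using r by (simp add: field_simps)
    finally show ?case .
  qed simp
  have B: "\<bar>m (k + n) - m k\<bar> \<le> c / (1 - r) * e k" for k n
  proof -
    have "c / (1 - r) * e k * (1 - r ^ n) \<le> c / (1 - r) * e k * 1"
      using r c e0 by (intro mult_left_mono) auto
    then show ?thesis using A[of k n] by linarith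
  qed
  have ek: "e k = r ^ k * e 0" for k by (induction k) (auto simp: e)
  have elim: "(\<lambda>k. c / (1 - r) * e k) \<longlonglongrightarrow> 0"
  proof -
    have "(\<lambda>k. c / (1 - r) * (r ^ k * e 0)) \<longlonglongrightarrow> c / (1 - r) * (0 * e 0)"
      using r by (intro tendsto_intros LIMSEQ_power_zero) auto
    then show ?thesis by (simp only: ek[symmetric]) simp
  qed
  have "Cauchy m"
  proof (rule metric_CauchyI)
    fix d :: real assume "0 < d"
    then have "\<forall>\<^sub>F k in sequentially. c / (1 - r) * e k < d / 2"
      using elim by (intro order_tendstoD(2)) auto
    then obtain K where K: "c / (1 - r) * e K < d / 2" by (auto simp: eventually_sequentially)
    have "dist (m i) (m j) < d" if "i \<ge> K" "j \<ge> K" for i j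
    proof -
      have "\<bar>m i - m K\<bar> \<le> c / (1 - r) * e K" "\<bar>m j - m K\<bar> \<le> c / (1 - r) * e K"
        using B[of K "i - K"] B[of K "j - K"] that by auto
      then have "\<bar>m i - m K\<bar> < d / 2" "\<bar>m j - m K\<bar> < d / 2" using K by linarith+
      then show ?thesis unfolding dist_real_def by linarith
    qed
    then show "\<exists>M. \<forall>i\<ge>M. \<forall>j\<ge>M. dist (m i) (m j) < d" by blast
  qed
  then obtain L where L: "m \<longlonglongrightarrow> L" using Cauchy_convergent_iff convergent_def by blast
  have "\<bar>L - m k\<bar> \<le> c / (1 - r) * e k" for k
  proof (rule LIMSEQ_le_const2)
    have "(\<lambda>n. m (n + k)) \<longlonglongrightarrow> L" using LIMSEQ_ignore_initial_segment[OF L] .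
    then show "(\<lambda>n. \<bar>m (n + k) - m k\<bar>) \<longlonglongrightarrow> \<bar>L - m k\<bar>" by (intro tendsto_intros)
    show "\<exists>N. \<forall>n\<ge>N. \<bar>m (n + k) - m k\<bar> \<le> c / (1 - r) * e k" using B[of k] by (auto simp: add.commute)
  qed
  then show thesis using that L by blast
qed

text \<open>The factor 12 is \<open>3 (2 A)\<^sup>2\<close> divided by \<open>A\<^sup>2\<close>: three exchanged factors, and height constant \<open>2 A\<close>
  because kernels at scales \<open>\<epsilon>\<close> and \<open>\<epsilon>/2\<close> are compared. The denominator sums the geometric series
  over the dyadic scales.\<close>

definition morrey_const :: "real \<Rightarrow> real" where
  "morrey_const \<alpha> = 12 * bumpA\<^sup>2 / (1 - 2 powr (- \<alpha>))"

definition sup_const :: "real \<Rightarrow> real" where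
  "sup_const \<alpha> = 4 * morrey_const \<alpha> + 24 * bumpA\<^sup>2 + (4 * bumpA) ^ 3"

text \<open>Hoelder continuity tested at the dyadic scales only, which is all that the averages at these
  scales need. The bound starts at the second scale because centres at distance \<open>eps k\<close> are compared
  at width \<open>2 eps k\<close>, which is again one of the scales.\<close>

definition osc_bound :: "real \<Rightarrow> real \<Rightarrow> (real^3 \<Rightarrow> real) \<Rightarrow> bool" where
  "osc_bound \<alpha> C F \<longleftrightarrow> periodic F \<and> (\<forall>k x y. k \<ge> 1 \<longrightarrow> y \<in> cube x (eps k) \<longrightarrow> \<bar>F y - F x\<bar> \<le> C * eps k powr \<alpha>)"

lemma osc_bound_continuous:
  assumes "osc_bound \<alpha> C F" "0 < \<alpha>"
  shows "continuous_on UNIV F"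
proof -
  have "isCont F x" for x
    unfolding continuous_at_eps_delta
  proof (intro allI impI)
    fix e :: real assume e: "e > 0"
    have "(\<lambda>k. C * eps k powr \<alpha>) \<longlonglongrightarrow> C * 0"
    proof (intro tendsto_intros tendsto_zero_powrI)
      show "(\<lambda>k. \<alpha>) \<longlonglongrightarrow> \<alpha>" by simp
      show "\<forall>\<^sub>F k in sequentially. 0 \<le> eps k" using eps_pos less_imp_le by (intro always_eventually) blast
    qed (use eps_lim assms in auto)
    then have "\<forall>\<^sub>F k in sequentially. C * eps k powr \<alpha> < e" using e by (intro order_tendstoD(2)) auto
    then have "\<forall>\<^sub>F k in sequentially. C * eps k powr \<alpha> < e \<and> k \<ge> 1"
      using eventually_ge_at_top[of 1] by eventually_elim auto
    then obtain k where k: "C * eps k powr \<alpha> < e" "k \<ge> 1" by (auto simp: eventually_sequentially)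
    have "dist (F y) (F x) < e" if "dist y x < eps k" for y
    proof -
      have "\<bar>y $ i - x $ i\<bar> < eps k" for i
        using component_le_norm_cart[of "y - x" i] that by (simp add: dist_norm)
      then have "y \<in> cube x (eps k)" by (simp add: cube_def)
      then have "\<bar>F y - F x\<bar> \<le> C * eps k powr \<alpha>" using assms(1) k(2) unfolding osc_bound_def by blast
      then show ?thesis using k by (simp add: dist_real_def)
    qed
    then show "\<exists>d>0. \<forall>y. dist y x < d \<longrightarrow> dist (F y) (F x) < e" using eps_pos by blast
  qed
  then show ?thesis using continuous_at_imp_continuous_on by blast
qed


text \<open>Averages at consecutive dyadic scales differ by a multiple of \<open>N \<epsilon>\<^sup>\<alpha>\<close>, hence converge uniformly; averages
  at the same scale with centres at distance \<open>\<epsilon>\<close> differ by as much, which is the modulus of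
  continuity of the limit. The limit agrees with \<open>f\<close> almost everywhere since the averages of the
  difference tend to zero.\<close>

lemma morrey:
  fixes f :: "real^3 \<Rightarrow> real"
  assumes w: "\<And>j. weak_dx [j] f (g j)" and p: "periodic f" "\<And>j. periodic (g j)"
    and N: "grad_bound \<alpha> N g" "0 \<le> N" and \<alpha>: "0 < \<alpha>" "\<alpha> \<le> 1"
  obtains F where "osc_bound \<alpha> (sup_const \<alpha> * N) F"
    "\<And>x. \<bar>F x\<bar> \<le> sup_const \<alpha> * (N + (\<integral>y. \<bar>f y\<bar> \<partial>torus))" "AE x in torus. F x = f x"
proof -
  have i: "integrable torus f" using w by (auto simp: weak_dx_def weak_deriv_def)
  define m where "m k x = mol f (eps k) x" for k x
  define e where "e k = eps k powr \<alpha>" for k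
  define r where "r = 2 powr (- \<alpha>)"
  have half: "eps k \<le> 1 / 2" for k using eps_le[of k] by simp
  have r: "0 \<le> r" "r < 1" using \<alpha> powr_less_mono[of "- \<alpha>" 0 2] by (auto simp: r_def)
  have e: "e (Suc k) = r * e k" for k
  proof -
    have "e k = (2 * eps (Suc k)) powr \<alpha>" by (simp add: e_def eps_Suc)
    also have "\<dots> = 2 powr \<alpha> * e (Suc k)" using eps_pos[of "Suc k"] by (simp add: e_def powr_mult)
    finally show ?thesis by (simp add: r_def powr_minus)
  qed
  have e0: "0 \<le> e k" for k by (simp add: e_def)
  define c where "c = 12 * bumpA\<^sup>2 * N"
  have c: "0 \<le> c" using N(2) by (simp add: c_def)
  have c': "c / (1 - r) = morrey_const \<alpha> * N" by (simp add: c_def r_def morrey_const_def)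
  have mc: "0 \<le> morrey_const \<alpha>" using r by (simp add: morrey_const_def r_def)
  have osc: "\<bar>mol f \<epsilon> x - mol f \<epsilon>' y\<bar> \<le> c * e k"
    if "adm3 (2 * bumpA) (eps k) z (\<lambda>i. kern \<epsilon> (x $ i))" "adm3 (2 * bumpA) (eps k) z (\<lambda>i. kern \<epsilon>' (y $ i))"
    for \<epsilon> \<epsilon>' x y z k
    using oscillation[OF w p N(1) that eps_pos half] by (simp add: mol_def c_def e_def power_mult_distrib)
  have step: "\<bar>m (Suc k) x - m k x\<bar> \<le> c * e k" for k x
    unfolding m_def
    by (rule osc[of k x]; rule adm3_kern') (use eps_pos[of k] eps_pos[of "Suc k"] eps_Suc[of k] in auto)
  have "\<exists>L. (\<lambda>k. m k x) \<longlonglongrightarrow> L \<and> (\<forall>k. \<bar>L - m k x\<bar> \<le> c / (1 - r) * e k)" for x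
    using geometric_telescope[of "\<lambda>k. m k x" c e r, OF step e r e0 c] by metis
  then obtain F where F: "\<And>x. (\<lambda>k. m k x) \<longlonglongrightarrow> F x" "\<And>x k. \<bar>F x - m k x\<bar> \<le> morrey_const \<alpha> * N * e k"
    unfolding c' by metis
  have sc: "0 \<le> sup_const \<alpha>" "2 * morrey_const \<alpha> + 24 * bumpA\<^sup>2 \<le> sup_const \<alpha>" "(4 * bumpA) ^ 3 \<le> sup_const \<alpha>" "morrey_const \<alpha> \<le> sup_const \<alpha>"
  proof -
    have "0 \<le> bumpA\<^sup>2" "0 \<le> (4 * bumpA) ^ 3" using bumpA_pos by auto
    then show "0 \<le> sup_const \<alpha>" "2 * morrey_const \<alpha> + 24 * bumpA\<^sup>2 \<le> sup_const \<alpha>" "(4 * bumpA) ^ 3 \<le> sup_const \<alpha>" "morrey_const \<alpha> \<le> sup_const \<alpha>"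
      using mc unfolding sup_const_def by linarith+
  qed
  have Fosc: "\<bar>F y - F x\<bar> \<le> sup_const \<alpha> * N * eps k powr \<alpha>" if k: "k \<ge> 1" and y: "y \<in> cube x (eps k)" for x y k
  proof -
    obtain j where j: "k = Suc j" using k by (cases k) auto
    have yx: "\<bar>y $ i - x $ i\<bar> < eps k" for i using y by (simp add: cube_def)
    have "\<bar>m k y - m k x\<bar> \<le> c * e j"
      unfolding m_def
    proof (rule osc[of j x]; rule adm3_kern')
      show "eps k + \<bar>y $ i - x $ i\<bar> \<le> eps j" for i using yx[of i] eps_Suc[of j] by (simp add: j)
    qed (use eps_pos[of k] eps_Suc[of j] j in auto)
    also have "e j \<le> 2 * e k"
    proof -
      have "e j = 2 powr \<alpha> * e k" using e[of j] by (simp add: j r_def powr_minus field_simps)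
      moreover have "2 powr \<alpha> \<le> 2 powr 1" using \<alpha> by (intro powr_mono) auto
      ultimately show ?thesis using mult_right_mono[OF _ e0[of k], of "2 powr \<alpha>" 2] by simp
    qed
    finally have "\<bar>m k y - m k x\<bar> \<le> c * (2 * e k)" using c by (simp add: mult_left_mono)
    then have "\<bar>F y - F x\<bar> \<le> 2 * (morrey_const \<alpha> * N * e k) + c * (2 * e k)"
      using F(2)[of x k] F(2)[of y k] by linarith
    also have "\<dots> = (2 * morrey_const \<alpha> + 24 * bumpA\<^sup>2) * (N * e k)"
      by (simp add: c_def algebra_simps)
    also have "\<dots> \<le> sup_const \<alpha> * (N * e k)"
      using sc(2) N(2) e0 by (intro mult_right_mono) auto
    finally show ?thesis by (simp add: e_def mult.assoc)
  qed
  have "F (x + axis j 1) = F x" for x j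
    using F(1)[of "x + axis j 1"] F(1)[of x] mol_periodic[OF p(1) i eps_pos half]
    by (simp add: m_def LIMSEQ_unique)
  then have Fp: "periodic F" by (simp add: periodic_def)
  have Fo: "osc_bound \<alpha> (sup_const \<alpha> * N) F" unfolding osc_bound_def using Fosc Fp by blast
  have Fb: "\<bar>F x\<bar> \<le> sup_const \<alpha> * (N + (\<integral>y. \<bar>f y\<bar> \<partial>torus))" for x
  proof -
    have "e 0 \<le> 1" using \<alpha> by (simp add: e_def eps_def powr_le1)
    then have "morrey_const \<alpha> * N * e 0 \<le> morrey_const \<alpha> * N * 1"
      using mc N(2) by (intro mult_left_mono) auto
    also have "\<dots> \<le> sup_const \<alpha> * N" using sc N(2) by (simp add: mult_right_mono)
    finally have 1: "\<bar>F x - m 0 x\<bar> \<le> sup_const \<alpha> * N" using F(2)[of x 0] by linarith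
    have "\<bar>m 0 x\<bar> \<le> (4 * bumpA) ^ 3 * (\<integral>y. \<bar>f y\<bar> \<partial>torus)"
      using mol_bound[OF p(1) i eps_pos half, of 0 x] by (simp add: m_def eps_def mult.commute)
    also have "\<dots> \<le> sup_const \<alpha> * (\<integral>y. \<bar>f y\<bar> \<partial>torus)"
      using sc(3) by (intro mult_right_mono integral_nonneg_AE) auto
    finally show ?thesis using 1 by (simp add: distrib_left)
  qed
  have Fc: "continuous_on UNIV F" by (rule osc_bound_continuous[OF Fo \<alpha>(1)])
  have Fi: "integrable torus F" by (rule continuous_integrable_torus[OF Fc])
  have molD: "mol (\<lambda>y. f y - F y) \<epsilon> x = mol f \<epsilon> x - mol F \<epsilon> x" if "0 < \<epsilon>" "\<epsilon> \<le> 1 / 2" for \<epsilon> x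
  proof -
    note s = adm3_supp[OF adm3_kern[OF that(1)] that(2)]
    show ?thesis
      unfolding mol_def left_diff_distrib
      by (rule Bochner_Integration.integral_diff[OF torus_integral_tens(1)[OF s p(1) i] torus_integral_tens(1)[OF s Fp Fi]])
  qed
  have lim: "e \<longlonglongrightarrow> 0"
  proof -
    have ek: "e k = r ^ k * e 0" for k by (induction k) (auto simp: e)
    have "(\<lambda>k. r ^ k * e 0) \<longlonglongrightarrow> 0 * e 0"
      using r by (intro tendsto_intros LIMSEQ_power_zero) auto
    then show ?thesis by (simp only: ek[symmetric]) simp
  qed
  have "AE x in torus. f x - F x = 0"
  proof (rule mol_limit_zero[where \<epsilon> = "\<lambda>k. eps (Suc k)" and \<delta> = "\<lambda>k. (morrey_const \<alpha> * N + sup_const \<alpha> * N) * e (Suc k)"])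
    show "periodic (\<lambda>x. f x - F x)" using p(1) Fp by (simp add: periodic_def)
    show "integrable torus (\<lambda>x. f x - F x)" using i Fi by simp
    show "(\<lambda>k. eps (Suc k)) \<longlonglongrightarrow> 0" using LIMSEQ_Suc[OF eps_lim] .
    have "(\<lambda>k. (morrey_const \<alpha> * N + sup_const \<alpha> * N) * e (Suc k)) \<longlonglongrightarrow> (morrey_const \<alpha> * N + sup_const \<alpha> * N) * 0"
      by (intro tendsto_intros LIMSEQ_Suc[OF lim])
    then show "(\<lambda>k. (morrey_const \<alpha> * N + sup_const \<alpha> * N) * e (Suc k)) \<longlonglongrightarrow> 0" by simp
    show "\<bar>mol (\<lambda>x. f x - F x) (eps (Suc k)) x\<bar> \<le> (morrey_const \<alpha> * N + sup_const \<alpha> * N) * e (Suc k)" for k x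
    proof -
      have "\<bar>mol F (eps (Suc k)) x - F x\<bar> \<le> sup_const \<alpha> * N * e (Suc k)"
        by (rule mol_continuous_close[OF Fc Fp eps_pos half]) (use Fosc in \<open>auto simp: e_def\<close>)
      then show ?thesis
        using F(2)[of x "Suc k"] molD[OF eps_pos half, of "Suc k" x] by (simp add: m_def distrib_right)
    qed
  qed (use eps_pos half in auto)
  then have "AE x in torus. F x = f x" by eventually_elim simp
  then show thesis using that Fo Fb by blast
qed

section \<open>Calculus of weak derivatives\<close>

text \<open>The derivative chosen in the Sobolev norm is determined only on the unit cell; this extends its
  values there periodically.\<close>

definition periodize :: "(real^3 \<Rightarrow> 'b) \<Rightarrow> real^3 \<Rightarrow> 'b" where
  "periodize g x = g (\<chi> i. frac (x $ i))"

lemma periodize_periodic: "periodic (periodize g)"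
proof -
  have "(\<chi> i. frac ((x + axis k 1) $ i)) = (\<chi> i. frac (x $ i))" for x :: "real^3" and k
    by (simp add: vec_eq_iff axis_def frac_1_eq)
  then show ?thesis unfolding periodic_def periodize_def by metis
qed

lemma periodize_eq: "x \<in> unit_cell \<Longrightarrow> periodize g x = g x"
proof -
  assume "x \<in> unit_cell"
  then have "(\<chi> i. frac (x $ i)) = x" by (simp add: unit_cell_def vec_eq_iff frac_eq)
  then show ?thesis by (simp add: periodize_def)
qed

lemma space_torus [simp]: "space torus = unit_cell"
  by (simp add: torus_def)

lemma integrable_torus_cong:
  "(\<And>x. x \<in> unit_cell \<Longrightarrow> f x = g x) \<Longrightarrow> integrable torus f = integrable torus g"
  by (rule Bochner_Integration.integrable_cong) auto

lemma weak_dx_cong: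
  fixes f :: "real^3 \<Rightarrow> 'b::euclidean_space"
  assumes "weak_dx js f g" "\<And>x. x \<in> unit_cell \<Longrightarrow> f x = f' x" "\<And>x. x \<in> unit_cell \<Longrightarrow> g x = g' x"
  shows "weak_dx js f' g'"
proof -
  have "(\<integral>z. \<phi> z *\<^sub>R f' z \<partial>torus) = (\<integral>z. \<phi> z *\<^sub>R f z \<partial>torus)" "(\<integral>z. \<phi> z *\<^sub>R g' z \<partial>torus) = (\<integral>z. \<phi> z *\<^sub>R g z \<partial>torus)" for \<phi>
    using assms by (auto intro!: Bochner_Integration.integral_cong)
  then show ?thesis
    using assms(1) integrable_torus_cong[of f f'] integrable_torus_cong[of g g'] assms(2,3)
    unfolding weak_dx_def weak_deriv_def by simp
qed

lemma weak_dx_AE_cong: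
  fixes f :: "real^3 \<Rightarrow> 'b::euclidean_space"
  assumes w: "weak_dx js f g" and g': "integrable torus g'" "AE x in torus. g' x = g x"
  shows "weak_dx js f g'"
proof -
  have "(\<integral>z. \<phi> z *\<^sub>R g' z \<partial>torus) = (\<integral>z. \<phi> z *\<^sub>R g z \<partial>torus)" if "\<phi> \<in> torus_tests" for \<phi>
  proof (rule integral_cong_AE)
    have "\<phi> \<in> borel_measurable borel"
      using that by (auto simp: torus_tests_def intro!: borel_measurable_continuous_onI smooth_continuous_on)
    then have "\<phi> \<in> borel_measurable torus"
      unfolding torus_def by (simp add: measurable_completion measurable_restrict_space1)
    then show "(\<lambda>z. \<phi> z *\<^sub>R g' z) \<in> borel_measurable torus" "(\<lambda>z. \<phi> z *\<^sub>R g z) \<in> borel_measurable torus"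
      using w g' by (auto simp: weak_dx_def weak_deriv_def)
    show "AE x in torus. \<phi> x *\<^sub>R g' x = \<phi> x *\<^sub>R g x" using g'(2) by eventually_elim simp
  qed
  then show ?thesis using w g'(1) unfolding weak_dx_def weak_deriv_def by simp
qed

lemma torus_test_integrable:
  fixes f :: "real^3 \<Rightarrow> 'b::euclidean_space"
  assumes "smooth h" "integrable torus f"
  shows "integrable torus (\<lambda>z. h z *\<^sub>R f z)"
proof -
  have "bounded (h ` cbox 0 (\<chi> i. 1))"
    by (intro compact_imp_bounded compact_continuous_image smooth_continuous_on assms) auto
  then obtain B where B: "\<And>z. z \<in> cbox 0 (\<chi> i. 1) \<Longrightarrow> \<bar>h z\<bar> \<le> B" "B > 0" by (auto simp: bounded_pos)
  have sub: "unit_cell \<subseteq> cbox 0 (\<chi> i. 1)"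
    by (auto simp: unit_cell_def mem_box_cart) (metis less_eq_real_def)
  have m: "h \<in> borel_measurable torus"
    unfolding torus_def using borel_measurable_continuous_onI[OF smooth_continuous_on[OF assms(1)]]
    by (simp add: measurable_completion measurable_restrict_space1)
  show ?thesis
  proof (rule Bochner_Integration.integrable_bound[where f = "\<lambda>z. B *\<^sub>R f z"])
    show "AE z in torus. norm (h z *\<^sub>R f z) \<le> norm (B *\<^sub>R f z)"
      using B sub by (auto intro!: AE_I2 mult_right_mono)
  qed (use assms m in auto)
qed

lemma smooth_iter_dderiv: "smooth \<phi> \<Longrightarrow> smooth (iter_dderiv es \<phi>)"
  by (induction es) (auto simp: smooth_dderiv)

lemma weak_dx_nth:
  fixes f g :: "real^3 \<Rightarrow> real^3"
  assumes "weak_dx js f g"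
  shows "weak_dx js (\<lambda>x. f x $ k) (\<lambda>x. g x $ k)"
proof -
  have bl: "bounded_linear (\<lambda>v::real^3. v $ k)" by (rule bounded_linear_vec_nth)
  have E: "(\<integral>z. h z *\<^sub>R f z $ k \<partial>torus) = (\<integral>z. h z *\<^sub>R f z \<partial>torus) $ k"
    if "smooth h" "integrable torus f" for h and f :: "real^3 \<Rightarrow> real^3"
    using integral_bounded_linear[OF bl torus_test_integrable[OF that]] by simp
  have i: "integrable torus f" "integrable torus g" using assms by (auto simp: weak_dx_def weak_deriv_def)
  show ?thesis
    using assms i integrable_bounded_linear[OF bl i(1)] integrable_bounded_linear[OF bl i(2)]
    unfolding weak_dx_def weak_deriv_def
    by (auto simp: E smooth_iter_dderiv torus_tests_def simp del: real_scaleR_def)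
qed

lemma weak_dx_diff:
  fixes f g f' g' :: "real^3 \<Rightarrow> real"
  assumes "weak_dx js f g" "weak_dx js f' g'"
  shows "weak_dx js (\<lambda>x. f x - f' x) (\<lambda>x. g x - g' x)"
  using assms unfolding weak_dx_def weak_deriv_def
  by (auto simp: right_diff_distrib torus_test_integrable[where 'b = real, simplified] smooth_iter_dderiv torus_tests_def)

lemma periodic_dderiv:
  fixes \<phi> :: "real^3 \<Rightarrow> real"
  assumes "smooth \<phi>" "periodic \<phi>"
  shows "periodic (\<lambda>x. frechet_derivative \<phi> (at x) e)"
proof -
  have "frechet_derivative \<phi> (at (x + axis i 1)) = frechet_derivative \<phi> (at x)" for x i
  proof -
    have "(\<phi> has_derivative frechet_derivative \<phi> (at (x + axis i 1))) (at (x + axis i 1))"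
      by (rule smooth_has_derivative[OF assms(1)])
    moreover have "((\<lambda>x. x + axis i 1) has_derivative (\<lambda>x. x)) (at x)"
      by (auto intro!: derivative_eq_intros)
    ultimately have "((\<lambda>x. \<phi> (x + axis i 1)) has_derivative (\<lambda>e. frechet_derivative \<phi> (at (x + axis i 1)) e)) (at x)"
      using has_derivative_compose[of "\<lambda>x. x + axis i 1" "\<lambda>x. x" x UNIV \<phi>] by simp
    then have "(\<phi> has_derivative frechet_derivative \<phi> (at (x + axis i 1))) (at x)"
      using assms(2) by (simp add: periodic_def)
    then show ?thesis using frechet_derivative_at by metis
  qed
  then show ?thesis unfolding periodic_def by metis
qed

text \<open>The test function \<open>\<partial>\<^sub>j\<phi>\<close> in the identity for \<open>g\<close> produces the mixed derivative in the order in which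
  it occurs for \<open>h\<close>, so that symmetry of second derivatives does not enter.\<close>

lemma weak_dx_iter:
  fixes f g h :: "real^3 \<Rightarrow> real"
  assumes g: "weak_dx [i] f g" and h: "weak_dx [i, j] f h"
  shows "weak_dx [j] g h"
  unfolding weak_dx_def weak_deriv_def
proof (intro conjI ballI)
  show "integrable torus g" "integrable torus h"
    using assms by (auto simp: weak_dx_def weak_deriv_def)
  fix \<phi> assume \<phi>: "\<phi> \<in> torus_tests"
  define \<psi> where "\<psi> = iter_dderiv [axis j 1] \<phi>"
  have \<psi>: "\<psi> \<in> torus_tests"
    using \<phi> unfolding \<psi>_def torus_tests_def by (auto intro: smooth_dderiv periodic_dderiv)
  have "(\<integral>z. iter_dderiv [axis i 1] \<psi> z *\<^sub>R f z \<partial>torus) = - (\<integral>z. \<psi> z *\<^sub>R g z \<partial>torus)"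
    using g \<psi> by (simp add: weak_dx_def weak_deriv_def)
  moreover have "(\<integral>z. iter_dderiv [axis i 1] \<psi> z *\<^sub>R f z \<partial>torus) = (\<integral>z. \<phi> z *\<^sub>R h z \<partial>torus)"
    using h \<phi> unfolding \<psi>_def by (simp add: weak_dx_def weak_deriv_def)
  ultimately show "(\<integral>z. iter_dderiv (map (\<lambda>j. axis j 1) [j]) \<phi> z *\<^sub>R g z \<partial>torus)
      = (- 1) ^ length (map (\<lambda>j. axis j 1 :: real^3) [j]) *\<^sub>R (\<integral>z. \<phi> z *\<^sub>R h z \<partial>torus)"
    by (simp add: \<psi>_def)
qed

lemma weak_dx_nil:
  fixes f g :: "real^3 \<Rightarrow> real"
  assumes w: "weak_dx [] f g" and f: "periodic f"
  shows "AE x in torus. f x = g x"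
proof -
  have w': "weak_dx [] f (periodize g)" by (rule weak_dx_cong[OF w]) (auto simp: periodize_eq)
  have i: "integrable torus f" "integrable torus (periodize g)" using w' by (auto simp: weak_dx_def weak_deriv_def)
  have half: "eps k \<le> 1 / 2" for k using eps_le[of k] by simp
  have "AE x in torus. f x - periodize g x = 0"
  proof (rule mol_limit_zero[OF _ _ eps_lim eps_pos half])
    show "periodic (\<lambda>x. f x - periodize g x)" using f periodize_periodic[of g] by (simp add: periodic_def)
    show "integrable torus (\<lambda>x. f x - periodize g x)" using i by simp
    show "(\<lambda>_. 0) \<longlonglongrightarrow> (0::real)" by simp
    fix k x
    note s = adm3_supp[OF adm3_kern[OF eps_pos] half, of x k]
    let ?b = "\<lambda>i::3. kern (eps k) (x $ i)"
    note t = torus_integral_tens[OF s]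
    have "(\<integral>y. f y * tens ?b y \<partial>lebesgue) = (\<integral>y. periodize g y * tens ?b y \<partial>lebesgue)"
      unfolding t(3)[OF f i(1), symmetric] t(3)[OF periodize_periodic i(2), symmetric]
      using w' tens_wrap_test[OF s] by (simp add: weak_dx_def weak_deriv_def)
    then have "mol (\<lambda>x. f x - periodize g x) (eps k) x = 0"
      unfolding mol_def left_diff_distrib
      using Bochner_Integration.integral_diff[OF t(1)[OF f i(1)] t(1)[OF periodize_periodic i(2)]] by simp
    then show "\<bar>mol (\<lambda>x. f x - periodize g x) (eps k) x\<bar> \<le> 0" by simp
  qed
  then show ?thesis using AE_space by eventually_elim (simp add: periodize_eq)
qed

section \<open>Sobolev functions\<close>

lemma Lp_norm_le_imp:
  assumes "Lp_norm p f \<le> ennreal N" "0 \<le> N" "p > 0"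
  shows "(\<integral>\<^sup>+x. ennreal (norm (f x) powr p) \<partial>torus) \<le> ennreal (N powr p)"
proof -
  let ?I = "\<integral>\<^sup>+x. ennreal (norm (f x) powr p) \<partial>torus"
  have fin: "?I \<noteq> \<infinity>" using assms(1) by (auto simp: Lp_norm_def Let_def top_unique)
  then have "ennreal (enn2real ?I powr (1 / p)) \<le> ennreal N"
    using assms(1) by (simp add: Lp_norm_def Let_def)
  then have "enn2real ?I powr (1 / p) \<le> N" using assms(2) by simp
  then have "(enn2real ?I powr (1 / p)) powr p \<le> N powr p" using assms(3) by (intro powr_mono2) auto
  then have "enn2real ?I \<le> N powr p" using assms(3) by (simp add: powr_powr)
  then have "ennreal (enn2real ?I) \<le> ennreal (N powr p)" by (rule ennreal_leI)
  then show ?thesis using fin by (subst (asm) ennreal_enn2real) (auto simp: less_top)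
qed

lemma Lp_norm_mono:
  assumes "AE x in torus. norm (f x) \<le> norm (g x)" "p > 0"
  shows "Lp_norm p f \<le> Lp_norm p g"
proof -
  let ?I = "\<lambda>f. \<integral>\<^sup>+x. ennreal (norm (f x) powr p) \<partial>torus"
  have le: "?I f \<le> ?I g"
    by (rule nn_integral_mono_AE) (use assms in \<open>auto elim!: eventually_mono intro!: ennreal_leI powr_mono2\<close>)
  show ?thesis
  proof (cases "?I g = \<infinity>")
    case False
    then have "?I f \<noteq> \<infinity>" using le by (auto simp: top_unique)
    moreover have "enn2real (?I f) \<le> enn2real (?I g)" using le False by (simp add: enn2real_mono less_top)
    ultimately show ?thesis
      using False assms(2) by (simp add: Lp_norm_def Let_def ennreal_leI powr_mono2)
  qed (simp add: Lp_norm_def Let_def)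
qed

text \<open>Either \<open>a \<le> \<kappa>\<close>, or \<open>a\<^sup>1\<^sup>-\<^sup>q \<le> \<kappa>\<^sup>1\<^sup>-\<^sup>q\<close>. Integrated with an optimal \<open>\<kappa>\<close> this replaces Hoelder's
  inequality up to a constant.\<close>

lemma young_powr:
  fixes a \<kappa> q :: real
  assumes "0 \<le> a" "0 < \<kappa>" "1 \<le> q"
  shows "a \<le> \<kappa> powr (1 - q) * a powr q + \<kappa>"
proof (cases "a \<le> \<kappa>")
  case False
  then have a: "0 < a" "\<kappa> \<le> a" using assms by auto
  have "a = a powr (1 - q) * a powr q" using a by (simp add: powr_add[symmetric])
  also have "\<dots> \<le> \<kappa> powr (1 - q) * a powr q"
    using a assms by (intro mult_right_mono powr_mono2') auto
  finally show ?thesis using assms by linarith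
qed (use assms in \<open>simp add: add_increasing\<close>)

lemma Lp_power_integral:
  fixes g :: "real^3 \<Rightarrow> real"
  assumes g: "g \<in> borel_measurable torus" and N: "Lp_norm q g \<le> ennreal N" "0 \<le> N" "0 < q"
  shows "integrable torus (\<lambda>x. \<bar>g x\<bar> powr q)" "(\<integral>x. \<bar>g x\<bar> powr q \<partial>torus) \<le> N powr q"
proof -
  have nn: "(\<integral>\<^sup>+x. ennreal (\<bar>g x\<bar> powr q) \<partial>torus) \<le> ennreal (N powr q)" using Lp_norm_le_imp[OF N] by simp
  show i: "integrable torus (\<lambda>x. \<bar>g x\<bar> powr q)"
    by (rule integrableI_nonneg) (use g nn in \<open>auto intro: le_less_trans\<close>)
  have "ennreal (\<integral>x. \<bar>g x\<bar> powr q \<partial>torus) \<le> ennreal (N powr q)"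
    using nn nn_integral_eq_integral[OF i] by simp
  then show "(\<integral>x. \<bar>g x\<bar> powr q \<partial>torus) \<le> N powr q" by simp
qed

lemma L1_le_Lp:
  fixes f :: "real^3 \<Rightarrow> real"
  assumes f: "f \<in> borel_measurable torus" and N: "Lp_norm q f \<le> ennreal N" "0 < N" "1 \<le> q"
  shows "integrable torus f" "(\<integral>x. \<bar>f x\<bar> \<partial>torus) \<le> 2 * N"
proof -
  interpret finite_measure torus by (rule measure_torus)
  note p = Lp_power_integral[OF f N(1)]
  have i: "integrable torus (\<lambda>x. N powr (1 - q) * \<bar>f x\<bar> powr q + N)" using p N by simp
  have le: "\<bar>f x\<bar> \<le> N powr (1 - q) * \<bar>f x\<bar> powr q + N" for x using young_powr[of "\<bar>f x\<bar>" N q] N by simp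
  show fi: "integrable torus f"
    by (rule Bochner_Integration.integrable_bound[OF i f]) (use le N in \<open>auto intro!: AE_I2 order_trans[OF le]\<close>)
  have "(\<integral>x. \<bar>f x\<bar> \<partial>torus) \<le> (\<integral>x. N powr (1 - q) * \<bar>f x\<bar> powr q + N \<partial>torus)"
    by (rule integral_mono) (use fi i le in auto)
  also have "\<dots> = N powr (1 - q) * (\<integral>x. \<bar>f x\<bar> powr q \<partial>torus) + N"
    using p N measure_torus(1) by simp
  also have "\<dots> \<le> N powr (1 - q) * N powr q + N" using p N by (intro add_right_mono mult_left_mono) auto
  also have "\<dots> = 2 * N" using N by (simp add: powr_add[symmetric])
  finally show "(\<integral>x. \<bar>f x\<bar> \<partial>torus) \<le> 2 * N" .
qed

lemma cube_measure:
  assumes "0 < \<epsilon>"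
  shows "set_integrable lebesgue (cube x \<epsilon>) (\<lambda>_. c::real)" "(LINT y:cube x \<epsilon>|lebesgue. c) = 8 * \<epsilon> ^ 3 * c"
proof -
  have e: "cube x \<epsilon> = box (\<chi> i. x $ i - \<epsilon>) (\<chi> i. x $ i + \<epsilon>)"
    by (auto simp: cube_def mem_box_cart abs_if split: if_splits) (smt (verit))+
  have "measure lebesgue (cube x \<epsilon>) = (\<Prod>i\<in>(UNIV::3 set). 2 * \<epsilon>)"
  proof -
    have "measure lborel (cube x \<epsilon>) = (\<Prod>b\<in>Basis. ((\<chi> i. x $ i + \<epsilon>) - (\<chi> i. x $ i - \<epsilon>)) \<bullet> b)"
      unfolding e by (rule measure_lborel_box) (use assms in \<open>auto simp: Basis_vec_def inner_axis\<close>)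
    also have "\<dots> = (\<Prod>i\<in>(UNIV::3 set). 2 * \<epsilon>)"
    proof -
      have inj: "inj (\<lambda>i::3. axis i (1::real))" by (auto simp: inj_on_def axis_eq_axis)
      have Bs: "(Basis :: (real^3) set) = range (\<lambda>i. axis i 1)" by (auto simp: Basis_vec_def)
      show ?thesis unfolding Bs by (subst prod.reindex[OF inj]) (simp add: inner_axis)
    qed
    finally show ?thesis by simp
  qed
  then have m: "measure lebesgue (cube x \<epsilon>) = 8 * \<epsilon> ^ 3" by (simp add: power_mult_distrib)
  have fin: "emeasure lebesgue (cube x \<epsilon>) < \<infinity>"
    using emeasure_bounded_finite[OF bounded_box, of "\<chi> i. x $ i - \<epsilon>" "\<chi> i. x $ i + \<epsilon>"] unfolding e by simp
  then show "set_integrable lebesgue (cube x \<epsilon>) (\<lambda>_. c)"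
    unfolding set_integrable_def by (intro integrable_scaleR_left integrable_real_indicator) auto
  show "(LINT y:cube x \<epsilon>|lebesgue. c) = 8 * \<epsilon> ^ 3 * c"
    using fin by (simp add: set_lebesgue_integral_def m)
qed

text \<open>Hoelder's inequality on a cube: \<open>\<epsilon>\<^sup>3\<close> to the power \<open>1 - 1/q\<close> is \<open>\<epsilon>\<close> to the power \<open>2 + (1 - 3/q)\<close>.\<close>

lemma grad_bound_Lp:
  fixes g :: "3 \<Rightarrow> real^3 \<Rightarrow> real"
  assumes g: "\<And>j. periodic (g j)" "\<And>j. g j \<in> borel_measurable torus"
    and N: "\<And>j. Lp_norm q (g j) \<le> ennreal N" "0 < N" "1 \<le> q"
  shows "grad_bound (1 - 3 / q) (9 * N) g"
  unfolding grad_bound_def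
proof (intro allI impI)
  fix j :: 3 and x :: "real^3" and \<epsilon> :: real assume \<epsilon>: "0 < \<epsilon>" "\<epsilon> \<le> 1 / 2"
  \<comment> \<open>The threshold for which both terms of the pointwise inequality contribute the same power of
    \<open>\<epsilon>\<close>.\<close>
  define \<kappa> where "\<kappa> = N * \<epsilon> powr (- (3 / q))"
  have \<kappa>: "0 < \<kappa>" using N \<epsilon> by (simp add: \<kappa>_def)
  note p = Lp_power_integral[OF g(2) N(1), of j]
  have pq: "periodic (\<lambda>x. \<bar>g j x\<bar> powr q)" using g(1) by (simp add: periodic_def)
  have iq: "integrable torus (\<lambda>x. \<bar>g j x\<bar> powr q)" using p N by simp
  have cq: "set_integrable lebesgue (cube x \<epsilon>) (\<lambda>y. \<bar>g j y\<bar> powr q)" by (rule cube_integrable[OF pq iq \<epsilon>(2)])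
  have "(LINT y:cube x \<epsilon>|lebesgue. \<bar>g j y\<bar> powr q) \<le> (LINT y:cell_at (corner x)|lebesgue. \<bar>g j y\<bar> powr q)"
    unfolding set_lebesgue_integral_def
    by (rule integral_mono) (use cq torus_integral_cell(1)[OF pq iq] cube_subset_cell[OF \<epsilon>(2), of x] in
      \<open>auto simp: set_integrable_def indicator_def\<close>)
  also have "\<dots> \<le> N powr q" using torus_integral_cell(2)[OF pq iq] p N by simp
  finally have C: "(LINT y:cube x \<epsilon>|lebesgue. \<bar>g j y\<bar> powr q) \<le> N powr q" .
  have ig: "set_integrable lebesgue (cube x \<epsilon>) (\<lambda>y. \<bar>g j y\<bar>)"
    by (rule cube_integrable) (use g \<epsilon> L1_le_Lp(1)[OF g(2) N] in \<open>auto simp: periodic_def\<close>)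
  have i1: "set_integrable lebesgue (cube x \<epsilon>) (\<lambda>y. \<kappa> powr (1 - q) * \<bar>g j y\<bar> powr q)"
    using cq by (rule set_integrable_mult_right)
  have "(LINT y:cube x \<epsilon>|lebesgue. \<bar>g j y\<bar>) \<le> (LINT y:cube x \<epsilon>|lebesgue. \<kappa> powr (1 - q) * \<bar>g j y\<bar> powr q + \<kappa>)"
    by (rule set_integral_mono[OF ig set_integral_add(1)[OF i1 cube_measure(1)[OF \<epsilon>(1)]]])
      (use young_powr \<kappa> N in auto)
  also have "\<dots> = \<kappa> powr (1 - q) * (LINT y:cube x \<epsilon>|lebesgue. \<bar>g j y\<bar> powr q) + 8 * \<epsilon> ^ 3 * \<kappa>"
    using set_integral_add(2)[OF i1 cube_measure(1)[OF \<epsilon>(1)]] cube_measure(2)[OF \<epsilon>(1)] by simp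
  also have "\<dots> \<le> \<kappa> powr (1 - q) * N powr q + 8 * \<epsilon> ^ 3 * \<kappa>" using C by (simp add: mult_left_mono)
  also have "\<kappa> powr (1 - q) * N powr q = N * \<epsilon> powr (3 - 3 / q)"
  proof -
    have "\<kappa> powr (1 - q) = N powr (1 - q) * \<epsilon> powr (- (3 / q) * (1 - q))"
      using N \<epsilon> by (simp add: \<kappa>_def powr_mult powr_powr)
    moreover have "- (3 / q) * (1 - q) = 3 - 3 / q" using N(3) by (simp add: field_simps)
    moreover have "N powr (1 - q) * N powr q = N" using N(2) by (simp add: powr_add[symmetric])
    ultimately show ?thesis by (simp add: mult_ac)
  qed
  also have "8 * \<epsilon> ^ 3 * \<kappa> = 8 * (N * \<epsilon> powr (3 - 3 / q))"
  proof -
    have "\<epsilon> powr (3 - 3 / q) = \<epsilon> powr 3 * \<epsilon> powr (- (3 / q))" by (simp only: powr_add[symmetric]) simp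
    moreover have "\<epsilon> powr 3 = \<epsilon> ^ 3" using \<epsilon> by simp
    ultimately show ?thesis by (simp only: \<kappa>_def) (simp only: mult_ac)
  qed
  finally have "(LINT y:cube x \<epsilon>|lebesgue. \<bar>g j y\<bar>) \<le> 9 * (N * \<epsilon> powr (3 - 3 / q))" by simp
  then show "(LINT y:cube x \<epsilon>|lebesgue. \<bar>g j y\<bar>) \<le> 9 * N * \<epsilon> powr (2 + (1 - 3 / q))" by simp
qed

lemma grad_bound_bounded:
  fixes g :: "3 \<Rightarrow> real^3 \<Rightarrow> real"
  assumes g: "\<And>j. periodic (g j)" "\<And>j. integrable torus (g j)" and B: "\<And>j x. \<bar>g j x\<bar> \<le> B"
  shows "grad_bound 1 (8 * B) g"
  unfolding grad_bound_def
proof (intro allI impI)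
  fix j :: 3 and x :: "real^3" and \<epsilon> :: real assume \<epsilon>: "0 < \<epsilon>" "\<epsilon> \<le> 1 / 2"
  have ig: "set_integrable lebesgue (cube x \<epsilon>) (\<lambda>y. \<bar>g j y\<bar>)"
    by (rule cube_integrable) (use g \<epsilon> in \<open>auto simp: periodic_def\<close>)
  have "(LINT y:cube x \<epsilon>|lebesgue. \<bar>g j y\<bar>) \<le> (LINT y:cube x \<epsilon>|lebesgue. B)"
    by (rule set_integral_mono[OF ig cube_measure(1)[OF \<epsilon>(1)]]) (rule B)
  also have "\<dots> = 8 * B * \<epsilon> powr (2 + 1)" using cube_measure(2)[OF \<epsilon>(1)] \<epsilon> by (simp add: powr_numeral)
  finally show "(LINT y:cube x \<epsilon>|lebesgue. \<bar>g j y\<bar>) \<le> 8 * B * \<epsilon> powr (2 + 1)" .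
qed


definition rep_const :: "real \<Rightarrow> real" where
  "rep_const q = 11 * sup_const (1 - 3 / q)"

lemma sup_const_pos:
  assumes "0 < \<alpha>"
  shows "0 < sup_const \<alpha>"
proof -
  have "2 powr - \<alpha> < 1" using assms powr_less_mono[of "- \<alpha>" 0 2] by simp
  then have "0 \<le> morrey_const \<alpha>" by (simp add: morrey_const_def)
  moreover have "0 < bumpA\<^sup>2" "0 < (4 * bumpA) ^ 3" using bumpA_pos by auto
  ultimately show ?thesis unfolding sup_const_def by linarith
qed

lemma osc_bound_mono:
  assumes "osc_bound \<alpha> C F" "C \<le> C'"
  shows "osc_bound \<alpha> C' F"
proof -
  have "C * eps k powr \<alpha> \<le> C' * eps k powr \<alpha>" for k using assms(2) by (intro mult_right_mono) auto
  then show ?thesis using assms(1) unfolding osc_bound_def by (meson order_trans)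
qed

lemma sobolev_rep:
  fixes f :: "real^3 \<Rightarrow> real"
  assumes q: "3 < q" and f: "periodic f" and N: "Lp_norm q f \<le> ennreal N" "0 < N"
    and w: "\<And>j. weak_dx [j] f (g j)" and gN: "\<And>j. Lp_norm q (g j) \<le> ennreal N"
  obtains F where "osc_bound (1 - 3 / q) (rep_const q * N) F" "\<And>x. \<bar>F x\<bar> \<le> rep_const q * N"
    "AE x in torus. F x = f x"
proof -
  define \<alpha> where "\<alpha> = 1 - 3 / q"
  have \<alpha>: "0 < \<alpha>" "\<alpha> \<le> 1" using q by (auto simp: \<alpha>_def)
  define g' where "g' j = periodize (g j)" for j
  have w': "weak_dx [j] f (g' j)" for j
    by (rule weak_dx_cong[OF w[of j]]) (auto simp: periodize_eq g'_def)
  have "Lp_norm q (g' j) \<le> Lp_norm q (g j)" for j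
    by (rule Lp_norm_mono) (use q in \<open>auto simp: g'_def periodize_eq intro!: AE_I2\<close>)
  then have gN': "Lp_norm q (g' j) \<le> ennreal N" for j using gN[of j] order_trans by blast
  have i: "integrable torus f" "integrable torus (g' j)" for j
    using w'[of j] by (auto simp: weak_dx_def weak_deriv_def)
  have gb: "grad_bound \<alpha> (9 * N) g'"
    unfolding \<alpha>_def by (rule grad_bound_Lp) (use gN' q N i in \<open>auto simp: g'_def periodize_periodic\<close>)
  have pg: "periodic (g' j)" for j by (simp add: g'_def periodize_periodic)
  have nn: "0 \<le> 9 * N" using N by simp
  obtain F where F: "osc_bound \<alpha> (sup_const \<alpha> * (9 * N)) F"
    "\<And>x. \<bar>F x\<bar> \<le> sup_const \<alpha> * (9 * N + (\<integral>y. \<bar>f y\<bar> \<partial>torus))" "AE x in torus. F x = f x"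
    using morrey[OF w' f pg gb nn \<alpha>] by blast
  have C: "0 < sup_const \<alpha>" by (rule sup_const_pos[OF \<alpha>(1)])
  have L1: "(\<integral>y. \<bar>f y\<bar> \<partial>torus) \<le> 2 * N" using L1_le_Lp(2)[of f q N] i N q by auto
  show thesis
  proof (rule that)
    have "sup_const \<alpha> * (9 * N) \<le> rep_const q * N" using C N by (simp add: rep_const_def \<alpha>_def)
    then show "osc_bound (1 - 3 / q) (rep_const q * N) F"
      unfolding \<alpha>_def[symmetric] by (rule osc_bound_mono[OF F(1)])
    have "sup_const \<alpha> * (9 * N + (\<integral>y. \<bar>f y\<bar> \<partial>torus)) \<le> sup_const \<alpha> * (9 * N + 2 * N)"
      using C L1 by (intro mult_left_mono) auto
    then show "\<bar>F x\<bar> \<le> rep_const q * N" for x using F(2)[of x] by (simp add: rep_const_def \<alpha>_def)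
  qed (rule F)
qed

lemma finite_lists3: "finite {js :: 3 list. length js \<le> k}"
  using finite_lists_length_le[of "UNIV :: 3 set" k] by simp

lemma sobolev_norm_ge: "length js \<le> k \<Longrightarrow> Lp_norm p (dx js f) \<le> sobolev_norm k p f"
  unfolding sobolev_norm_def by (rule member_le_sum) (auto simp: finite_lists3)

lemma weak_dx_dx: "weak_dx js f g \<Longrightarrow> weak_dx js f (dx js f)"
  using someI[of "weak_dx js f" g] by (simp add: dx_def)

lemma sobolev_weak_dx: "f \<in> sobolev k p \<Longrightarrow> length js \<le> k \<Longrightarrow> weak_dx js f (dx js f)"
  unfolding sobolev_def using weak_dx_dx by blast

lemma sobolev_periodic: "f \<in> sobolev k p \<Longrightarrow> periodic f"
  by (simp add: sobolev_def Lp_space_def)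

lemma Lp_norm_dx_nil:
  fixes f :: "real^3 \<Rightarrow> real"
  assumes "periodic f" "weak_dx [] f g" "0 < p"
  shows "Lp_norm p f \<le> Lp_norm p (dx [] f)"
  by (rule Lp_norm_mono) (use weak_dx_nil[OF weak_dx_dx[OF assms(2)] assms(1)] assms(3) in auto)

lemma sobolev_1_rep:
  fixes f :: "real^3 \<Rightarrow> real"
  assumes q: "3 < q" and f: "periodic f" and w: "\<And>js. length js \<le> 1 \<Longrightarrow> \<exists>g. weak_dx js f g"
    and N: "sobolev_norm 1 q f \<le> ennreal N" "0 < N"
  obtains F where "osc_bound (1 - 3 / q) (rep_const q * N) F" "\<And>x. \<bar>F x\<bar> \<le> rep_const q * N"
    "AE x in torus. F x = f x"
proof (rule sobolev_rep[OF q f _ N(2)])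
  obtain g where g: "weak_dx [] f g" using w[of "[]"] by auto
  have "Lp_norm q f \<le> Lp_norm q (dx [] f)" by (rule Lp_norm_dx_nil[OF f g]) (use q in simp)
  also have "\<dots> \<le> sobolev_norm 1 q f" by (rule sobolev_norm_ge) simp
  finally show "Lp_norm q f \<le> ennreal N" using N by order
  show "weak_dx [j] f (dx [j] f)" for j using w[of "[j]"] weak_dx_dx by auto
  show "Lp_norm q (dx [j] f) \<le> ennreal N" for j
    using order_trans[OF sobolev_norm_ge[of "[j]" 1 q f] N(1)] by simp
qed (use that in blast)

definition lip_const :: "real \<Rightarrow> real" where
  "lip_const q = 8 * sup_const 1 * rep_const q"

text \<open>Morrey's embedding is used twice: first for the derivatives, which are thereby bounded, and then
  for the function itself with exponent one.\<close>

lemma sobolev_2_lipschitz: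
  fixes f :: "real^3 \<Rightarrow> real^3"
  assumes q: "3 < q" and f: "f \<in> sobolev 2 q" and N: "sobolev_norm 2 q f \<le> ennreal N" "0 < N"
  obtains F where "osc_bound 1 (lip_const q * N) F" "AE x in torus. F x = f x $ k"
proof -
  have "\<exists>G. osc_bound (1 - 3 / q) (rep_const q * N) G \<and> (\<forall>x. \<bar>G x\<bar> \<le> rep_const q * N) \<and>
      (AE x in torus. G x = dx [i] f x $ k)" for i
  proof -
    have w1: "weak_dx [i] (\<lambda>x. f x $ k) (\<lambda>x. dx [i] f x $ k)"
      by (rule weak_dx_nth[OF sobolev_weak_dx[OF f]]) simp
    have w2: "weak_dx [i, j] (\<lambda>x. f x $ k) (\<lambda>x. dx [i, j] f x $ k)" for j
      by (rule weak_dx_nth[OF sobolev_weak_dx[OF f]]) simp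
    have w3: "weak_dx [j] (periodize (\<lambda>x. dx [i] f x $ k)) (\<lambda>x. dx [i, j] f x $ k)" for j
      by (rule weak_dx_cong[OF weak_dx_iter[OF w1 w2]]) (auto simp: periodize_eq)
    have L: "Lp_norm q h \<le> ennreal N" if "\<And>x. x \<in> unit_cell \<Longrightarrow> \<bar>h x\<bar> \<le> norm (dx js f x)" "length js \<le> 2"
      for h :: "real^3 \<Rightarrow> real" and js
    proof -
      have "Lp_norm q h \<le> Lp_norm q (dx js f)"
        by (rule Lp_norm_mono) (use that q in \<open>auto intro!: AE_I2\<close>)
      also have "\<dots> \<le> sobolev_norm 2 q f" by (rule sobolev_norm_ge[OF that(2)])
      finally show ?thesis using N by order
    qed
    have L0: "Lp_norm q (periodize (\<lambda>x. dx [i] f x $ k)) \<le> ennreal N"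
      by (rule L[of _ "[i]"]) (auto simp: periodize_eq component_le_norm_cart)
    have L1: "Lp_norm q (\<lambda>x. dx [i, j] f x $ k) \<le> ennreal N" for j
      by (rule L[of _ "[i, j]"]) (auto simp: component_le_norm_cart)
    obtain G where G: "osc_bound (1 - 3 / q) (rep_const q * N) G" "\<And>x. \<bar>G x\<bar> \<le> rep_const q * N"
      "AE x in torus. G x = periodize (\<lambda>x. dx [i] f x $ k) x"
      using sobolev_rep[OF q periodize_periodic L0 N(2) w3 L1] by blast
    have "AE x in torus. G x = dx [i] f x $ k"
      using G(3) AE_space by eventually_elim (simp add: periodize_eq)
    then show ?thesis using G by blast
  qed
  then have "\<forall>i. \<exists>G. osc_bound (1 - 3 / q) (rep_const q * N) G \<and> (\<forall>x. \<bar>G x\<bar> \<le> rep_const q * N) \<and>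
      (AE x in torus. G x = dx [i] f x $ k)" by blast
  from choice[OF this] obtain G where G': "\<forall>i. osc_bound (1 - 3 / q) (rep_const q * N) (G i) \<and>
      (\<forall>x. \<bar>G i x\<bar> \<le> rep_const q * N) \<and> (AE x in torus. G i x = dx [i] f x $ k)" by (elim exE)
  have G: "osc_bound (1 - 3 / q) (rep_const q * N) (G i)" "\<bar>G i x\<bar> \<le> rep_const q * N"
    "AE x in torus. G i x = dx [i] f x $ k" for i x using G' by simp_all
  have \<alpha>: "0 < 1 - 3 / q" using q by simp
  have Gi: "integrable torus (G i)" for i
    by (rule continuous_integrable_torus[OF osc_bound_continuous[OF G(1) \<alpha>]])
  have Gp: "periodic (G i)" for i using G(1) by (simp add: osc_bound_def)
  have w: "weak_dx [i] (\<lambda>x. f x $ k) (G i)" for i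
    by (rule weak_dx_AE_cong[OF weak_dx_nth[OF sobolev_weak_dx[OF f]] Gi G(3)]) simp
  have gb: "grad_bound 1 (8 * (rep_const q * N)) G" by (rule grad_bound_bounded[OF Gp Gi G(2)])
  have rc: "0 \<le> rep_const q" using sup_const_pos[OF \<alpha>] by (simp add: rep_const_def)
  have nn: "0 \<le> 8 * (rep_const q * N)" using rc N(2) by simp
  have pf: "periodic (\<lambda>x. f x $ k)" using sobolev_periodic[OF f] by (simp add: periodic_def)
  obtain F where F: "osc_bound 1 (sup_const 1 * (8 * (rep_const q * N))) F" "AE x in torus. F x = f x $ k"
    using morrey[OF w pf Gp gb nn zero_less_one order_refl] by blast
  show thesis
    by (rule that[OF _ F(2)]) (use F(1) in \<open>simp add: lip_const_def mult_ac\<close>)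
qed

section \<open>Continuous representatives\<close>

lemma eps_half: "eps k \<le> 1 / 2"
  using eps_le[of k] by simp

lemma mol_lim:
  assumes F: "continuous_on UNIV F" "periodic F"
  shows "(\<lambda>k. mol F (eps k) x) \<longlonglongrightarrow> F x"
proof (rule LIMSEQ_I)
  fix e :: real assume e: "0 < e"
  have "isCont F x" using F(1) continuous_on_eq_continuous_at by blast
  then obtain d where d: "0 < d" "\<And>y. dist y x < d \<Longrightarrow> dist (F y) (F x) < e / 2"
    using e unfolding continuous_at_eps_delta by (meson half_gt_zero)
  have "\<forall>\<^sub>F k in sequentially. eps k < d / 3" using eps_lim d by (intro order_tendstoD(2)) auto
  then obtain K where K: "\<And>k. k \<ge> K \<Longrightarrow> eps k < d / 3" by (auto simp: eventually_sequentially)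
  have "norm (mol F (eps k) x - F x) < e" if "k \<ge> K" for k
  proof -
    have "\<bar>mol F (eps k) x - F x\<bar> \<le> e / 2"
    proof (rule mol_continuous_close[OF F eps_pos eps_half])
      fix y assume y: "y \<in> cube x (eps k)"
      have "norm (y - x) \<le> (\<Sum>i\<in>UNIV. \<bar>(y - x) $ i\<bar>)" by (rule norm_le_l1_cart)
      also have "\<dots> \<le> (\<Sum>i\<in>(UNIV::3 set). eps k)"
        using y by (intro sum_mono) (auto simp: cube_def intro: less_imp_le)
      also have "\<dots> < d" using K[OF that] by simp
      finally show "\<bar>F y - F x\<bar> \<le> e / 2" using d(2)[of y] by (simp add: dist_norm less_imp_le)
    qed
    then show ?thesis using e by simp
  qed
  then show "\<exists>no. \<forall>k\<ge>no. norm (mol F (eps k) x - F x) < e" by blast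
qed

text \<open>Averages only see equivalence classes of functions on the torus, although the kernels live on the
  whole space.\<close>

lemma mol_mono_AE:
  assumes f: "periodic f" "integrable torus f" and g: "periodic g" "integrable torus g"
    and le: "AE x in torus. f x \<le> g x" and b: "adm3 A \<epsilon> x b" "\<epsilon> \<le> 1 / 2"
  shows "(\<integral>y. f y * tens b y \<partial>lebesgue) \<le> (\<integral>y. g y * tens b y \<partial>lebesgue)"
proof -
  note s = adm3_supp[OF b]
  let ?W = "tens (\<lambda>i. wrap (corner x $ i) (b i))"
  have W: "0 \<le> ?W y" for y
  proof -
    have "?W y = tens b (\<chi> i. corner x $ i + frac (y $ i - corner x $ i))"
      by (simp add: tens_def wrap_def)
    then show ?thesis using tens_nonneg[OF b(1)] by simp
  qed
  have "(\<integral>y. ?W y * f y \<partial>torus) \<le> (\<integral>y. ?W y * g y \<partial>torus)"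
    by (rule integral_mono_AE[OF torus_integral_tens(2)[OF s f] torus_integral_tens(2)[OF s g]])
      (use le W in \<open>auto elim!: eventually_mono intro: mult_left_mono\<close>)
  then show ?thesis using torus_integral_tens(3)[OF s f] torus_integral_tens(3)[OF s g] by simp
qed

lemma tens_integral_AE_eq:
  assumes f: "periodic f" "integrable torus f" and g: "periodic g" "integrable torus g"
    and eq: "AE x in torus. f x = (g x :: real)" and s: "supp_at a b"
  shows "(\<integral>y. f y * tens b y \<partial>lebesgue) = (\<integral>y. g y * tens b y \<partial>lebesgue)"
proof -
  have "(\<integral>y. tens (\<lambda>i. wrap (a $ i) (b i)) y * f y \<partial>torus) = (\<integral>y. tens (\<lambda>i. wrap (a $ i) (b i)) y * g y \<partial>torus)"
    by (rule integral_cong_AE)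
      (use eq borel_measurable_integrable[OF torus_integral_tens(2)[OF s f]]
        borel_measurable_integrable[OF torus_integral_tens(2)[OF s g]] in \<open>auto elim!: eventually_mono\<close>)
  then show ?thesis using torus_integral_tens(3)[OF s f] torus_integral_tens(3)[OF s g] by simp
qed

lemma mol_const: "0 < \<epsilon> \<Longrightarrow> mol (\<lambda>_. c) \<epsilon> x = c"
  using tens_mass(4)[OF adm3_kern] by (simp add: mol_def)

lemma const_torus: "periodic (\<lambda>_. c)" "integrable torus (\<lambda>_. c :: real)"
proof -
  interpret finite_measure torus by (rule measure_torus)
  show "periodic (\<lambda>_. c)" "integrable torus (\<lambda>_. c :: real)" by (auto simp: periodic_def)
qed

text \<open>An almost everywhere bound passes to the averages, and these converge to a continuous function at
  every point.\<close>

lemma cont_AE_ge: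
  fixes F :: "real^3 \<Rightarrow> real"
  assumes F: "continuous_on UNIV F" "periodic F" and ge: "AE x in torus. c \<le> F x"
  shows "c \<le> F x"
proof (rule LIMSEQ_le_const[OF mol_lim[OF F]], intro exI allI impI)
  fix k :: nat
  have "mol (\<lambda>_. c) (eps k) x \<le> mol F (eps k) x"
    unfolding mol_def
    by (rule mol_mono_AE[OF const_torus F(2) continuous_integrable_torus[OF F(1)] ge adm3_kern[OF eps_pos] eps_half])
  then show "c \<le> mol F (eps k) x" by (simp add: mol_const eps_pos)
qed

lemma cont_AE_eq:
  fixes F G :: "real^3 \<Rightarrow> real"
  assumes F: "continuous_on UNIV F" "periodic F" and G: "continuous_on UNIV G" "periodic G"
    and eq: "AE x in torus. F x = G x"
  shows "F x = G x"
proof -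
  have p: "periodic (\<lambda>x. F x - G x)" "periodic (\<lambda>x. G x - F x)" using F(2) G(2) by (simp_all add: periodic_def)
  have "0 \<le> F x - G x"
    by (rule cont_AE_ge[OF _ p(1)]) (use F G eq in \<open>auto intro!: continuous_intros\<close>)
  moreover have "0 \<le> G x - F x"
    by (rule cont_AE_ge[OF _ p(2)]) (use F G eq in \<open>auto intro!: continuous_intros\<close>)
  ultimately show ?thesis by simp
qed

lemma cont_rep_eq:
  assumes F: "continuous_on UNIV F" "periodic F" and eq: "AE x in torus. F x = f x"
  shows "cont_rep f = F"
proof -
  have "continuous_on UNIV (cont_rep f) \<and> periodic (cont_rep f) \<and> (AE x in torus. cont_rep f x = f x)"
    unfolding cont_rep_def by (rule someI[of _ F]) (use assms in blast)
  then have c: "continuous_on UNIV (cont_rep f)" "periodic (cont_rep f)" "AE x in torus. cont_rep f x = f x" by auto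
  have "AE x in torus. cont_rep f x = F x" using c(3) eq by eventually_elim simp
  then show ?thesis using cont_AE_eq[OF c(1,2) F] by blast
qed

lemma Lp_space_bound:
  assumes "g \<in> Lp_space q"
  obtains N where "0 < N" "Lp_norm q g \<le> ennreal N"
proof (rule that[of "enn2real (Lp_norm q g) + 1"])
  have "Lp_norm q g < \<infinity>" using assms by (simp add: Lp_space_def)
  then have "Lp_norm q g = ennreal (enn2real (Lp_norm q g))" by (simp add: less_top)
  also have "\<dots> \<le> ennreal (enn2real (Lp_norm q g) + 1)" by (intro ennreal_leI) simp
  finally show "Lp_norm q g \<le> ennreal (enn2real (Lp_norm q g) + 1)" .
qed (simp add: add_nonneg_pos)

lemma sobolev_1_exists_rep:
  fixes f :: "real^3 \<Rightarrow> real"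
  assumes q: "3 < q" and f: "f \<in> sobolev 1 q"
  obtains F B where "osc_bound (1 - 3 / q) B F" "\<And>x. \<bar>F x\<bar> \<le> B" "AE x in torus. F x = f x"
proof -
  have "\<forall>j. \<exists>g\<in>Lp_space q. weak_dx [j] f g" using f unfolding sobolev_def by auto
  then obtain g where g: "\<And>j. g j \<in> Lp_space q" "\<And>j. weak_dx [j] f (g j)" by metis
  have "\<forall>j. \<exists>N. 0 < N \<and> Lp_norm q (g j) \<le> ennreal N" using Lp_space_bound[OF g(1)] by metis
  then obtain N where N: "\<And>j. 0 < N j" "\<And>j. Lp_norm q (g j) \<le> ennreal (N j)" by metis
  obtain N0 where N0: "0 < N0" "Lp_norm q f \<le> ennreal N0"
    using f Lp_space_bound[of f q] unfolding sobolev_def by blast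
  define M where "M = N0 + (\<Sum>j\<in>UNIV. N j)"
  have M: "0 < M" "N0 \<le> M" "N j \<le> M" for j
  proof -
    have "N j \<le> (\<Sum>j\<in>UNIV. N j)" for j by (rule member_le_sum) (use N less_imp_le in auto)
    moreover have "0 \<le> (\<Sum>j\<in>UNIV. N j)" by (rule sum_nonneg) (use N less_imp_le in auto)
    ultimately show "0 < M" "N0 \<le> M" "N j \<le> M" for j
      unfolding M_def using N0(1) by (auto intro: add_increasing)
  qed
  have 1: "Lp_norm q f \<le> ennreal M" "Lp_norm q (g j) \<le> ennreal M" for j
    using N0(2) N(2)[of j] M(2,3)[THEN ennreal_leI] order_trans by blast+
  show thesis
    by (rule sobolev_rep[OF q sobolev_periodic[OF f] 1(1) M(1) g(2) 1(2)]) (rule that)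
qed

lemma compact_uniform_bound:
  fixes S :: "real set" and P :: "real \<Rightarrow> real \<Rightarrow> bool"
  assumes S: "compact S" and loc: "\<And>t. t \<in> S \<Longrightarrow> \<exists>d>0. \<exists>B. \<forall>s\<in>S. dist s t < d \<longrightarrow> P s B"
    and mono: "\<And>s B B'. P s B \<Longrightarrow> B \<le> B' \<Longrightarrow> P s B'"
  obtains B where "\<And>s. s \<in> S \<Longrightarrow> P s B"
proof -
  obtain d B where dB: "\<And>t. t \<in> S \<Longrightarrow> 0 < d t" "\<And>t s. t \<in> S \<Longrightarrow> s \<in> S \<Longrightarrow> dist s t < d t \<Longrightarrow> P s (B t)"
    using loc by metis
  have "S \<subseteq> (\<Union>t\<in>S. ball t (d t))" using dB(1) by auto
  then obtain C where C: "C \<subseteq> S" "finite C" "S \<subseteq> (\<Union>t\<in>C. ball t (d t))"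
    using compactE_image[OF S, of S "\<lambda>t. ball t (d t)"] by auto
  have "P s (\<Sum>t\<in>C. \<bar>B t\<bar>)" if s: "s \<in> S" for s
  proof -
    obtain t where t: "t \<in> C" "dist s t < d t" using C(3) s by (auto simp: dist_commute)
    have "\<bar>B t\<bar> \<le> (\<Sum>t\<in>C. \<bar>B t\<bar>)" by (rule member_le_sum[OF t(1)]) (use C in auto)
    then show ?thesis using mono[OF dB(2)[of t s], of "\<Sum>t\<in>C. \<bar>B t\<bar>"] t C(1) s by auto
  qed
  then show thesis using that by blast
qed

lemma osc_bound_add:
  assumes "osc_bound \<alpha> B F" "osc_bound \<alpha> C G"
  shows "osc_bound \<alpha> (B + C) (\<lambda>x. F x + G x)"
  unfolding osc_bound_def
proof (intro conjI allI impI)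
  show "periodic (\<lambda>x. F x + G x)" using assms by (simp add: osc_bound_def periodic_def)
  fix k x y assume "k \<ge> (1::nat)" "y \<in> cube x (eps k)"
  then have "\<bar>F y - F x\<bar> \<le> B * eps k powr \<alpha>" "\<bar>G y - G x\<bar> \<le> C * eps k powr \<alpha>"
    using assms unfolding osc_bound_def by blast+
  then show "\<bar>F y + G y - (F x + G x)\<bar> \<le> (B + C) * eps k powr \<alpha>" by (simp add: distrib_right)
qed

text \<open>The representative of \<open>f s - f t\<close> is the difference of the representatives, so continuity in time
  in \<open>W\<^sup>1\<^sup>,\<^sup>q\<close> gives continuity in time in the supremum norm, and a modulus of continuity in space that
  is uniform in time.\<close>

lemma C_sobolev_rep:
  fixes f :: "real \<Rightarrow> real^3 \<Rightarrow> real"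
  assumes q: "3 < q" and f: "f \<in> C_sobolev T 1 q"
  obtains B R where "\<And>t. t \<in> {0..T} \<Longrightarrow> osc_bound (1 - 3 / q) B (R t)"
    "\<And>t x. t \<in> {0..T} \<Longrightarrow> \<bar>R t x\<bar> \<le> B" "\<And>t. t \<in> {0..T} \<Longrightarrow> AE x in torus. R t x = f t x"
    "\<And>t e. t \<in> {0..T} \<Longrightarrow> 0 < e \<Longrightarrow> \<exists>d>0. \<forall>s\<in>{0..T}. dist s t < d \<longrightarrow> (\<forall>x. \<bar>R s x - R t x\<bar> \<le> e)"
proof -
  let ?\<alpha> = "1 - 3 / q"
  have \<alpha>: "0 < ?\<alpha>" using q by simp
  have sob: "f t \<in> sobolev 1 q" if "t \<in> {0..T}" for t using f that by (simp add: C_sobolev_def)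
  have "\<exists>F B. osc_bound ?\<alpha> B F \<and> (\<forall>x. \<bar>F x\<bar> \<le> B) \<and> (AE x in torus. F x = f t x)" if "t \<in> {0..T}" for t
    using sobolev_1_exists_rep[OF q sob[OF that]] by metis
  then have "\<forall>t. \<exists>F. t \<in> {0..T} \<longrightarrow> (\<exists>B. osc_bound ?\<alpha> B F \<and> (\<forall>x. \<bar>F x\<bar> \<le> B) \<and> (AE x in torus. F x = f t x))"
    by blast
  from choice[OF this] obtain R where R: "\<And>t. t \<in> {0..T} \<Longrightarrow> \<exists>B. osc_bound ?\<alpha> B (R t) \<and> (\<forall>x. \<bar>R t x\<bar> \<le> B)"
    "\<And>t. t \<in> {0..T} \<Longrightarrow> AE x in torus. R t x = f t x" by blast
  have Rc: "continuous_on UNIV (R t)" "periodic (R t)" if "t \<in> {0..T}" for t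
    using R(1)[OF that] osc_bound_continuous[OF _ \<alpha>] by (auto simp: osc_bound_def)
  have rc: "0 < rep_const q" using sup_const_pos[OF \<alpha>] by (simp add: rep_const_def)
  have near: "\<exists>d>0. \<forall>s\<in>{0..T}. dist s t < d \<longrightarrow>
      osc_bound ?\<alpha> (rep_const q * N) (\<lambda>x. R s x - R t x) \<and> (\<forall>x. \<bar>R s x - R t x\<bar> \<le> rep_const q * N)"
    if t: "t \<in> {0..T}" and N: "0 < N" for t N
  proof -
    have "((\<lambda>s. sobolev_norm 1 q (\<lambda>x. f s x - f t x)) \<longlongrightarrow> 0) (at t within {0..T})"
      using f t by (simp add: C_sobolev_def)
    then have "\<forall>\<^sub>F s in at t within {0..T}. sobolev_norm 1 q (\<lambda>x. f s x - f t x) < ennreal N"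
      using N by (intro order_tendstoD(2)) auto
    then obtain d where d: "d > 0" "\<And>s. s \<in> {0..T} \<Longrightarrow> s \<noteq> t \<Longrightarrow> dist s t < d \<Longrightarrow> sobolev_norm 1 q (\<lambda>x. f s x - f t x) < ennreal N"
      unfolding eventually_at by blast
    have "osc_bound ?\<alpha> (rep_const q * N) (\<lambda>x. R s x - R t x) \<and> (\<forall>x. \<bar>R s x - R t x\<bar> \<le> rep_const q * N)"
      if s: "s \<in> {0..T}" "dist s t < d" for s
    proof (cases "s = t")
      case True
      then show ?thesis using rc N by (simp add: osc_bound_def periodic_def)
    next
      case False
      have nrm: "sobolev_norm 1 q (\<lambda>x. f s x - f t x) \<le> ennreal N" using d(2)[OF s(1) False s(2)] by simp
      have p: "periodic (\<lambda>x. f s x - f t x)"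
        using sobolev_periodic[OF sob[OF s(1)]] sobolev_periodic[OF sob[OF t]] by (simp add: periodic_def)
      have w: "\<exists>g. weak_dx js (\<lambda>x. f s x - f t x) g" if "length js \<le> 1" for js
        using weak_dx_diff[OF sobolev_weak_dx[OF sob[OF s(1)] that] sobolev_weak_dx[OF sob[OF t] that]] by blast
      obtain F where F: "osc_bound ?\<alpha> (rep_const q * N) F" "\<And>x. \<bar>F x\<bar> \<le> rep_const q * N"
        "AE x in torus. F x = f s x - f t x"
        using sobolev_1_rep[OF q p w nrm N] by blast
      have "AE x in torus. F x = R s x - R t x"
        using F(3) R(2)[OF s(1)] R(2)[OF t] by eventually_elim simp
      moreover have "periodic (\<lambda>x. R s x - R t x)" using Rc(2)[OF s(1)] Rc(2)[OF t] by (simp add: periodic_def)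
      moreover have "continuous_on UNIV (\<lambda>x. R s x - R t x)" using Rc(1)[OF s(1)] Rc(1)[OF t] by (intro continuous_intros)
      ultimately have "F x = R s x - R t x" for x
        using cont_AE_eq[of F "\<lambda>x. R s x - R t x"] osc_bound_continuous[OF F(1) \<alpha>] F(1) by (simp add: osc_bound_def)
      then have "F = (\<lambda>x. R s x - R t x)" by auto
      then show ?thesis using F(1,2) by simp
    qed
    then show ?thesis using d(1) by blast
  qed
  obtain B where B: "\<And>s. s \<in> {0..T} \<Longrightarrow> osc_bound ?\<alpha> B (R s) \<and> (\<forall>x. \<bar>R s x\<bar> \<le> B)"
  proof (rule compact_uniform_bound[of "{0..T}" "\<lambda>s B. osc_bound ?\<alpha> B (R s) \<and> (\<forall>x. \<bar>R s x\<bar> \<le> B)"])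
    fix t assume t: "t \<in> {0..T}"
    obtain B where B: "osc_bound ?\<alpha> B (R t)" "\<And>x. \<bar>R t x\<bar> \<le> B" using R(1)[OF t] by blast
    obtain d where d: "d > 0" "\<And>s. s \<in> {0..T} \<Longrightarrow> dist s t < d \<Longrightarrow>
      osc_bound ?\<alpha> (rep_const q * 1) (\<lambda>x. R s x - R t x) \<and> (\<forall>x. \<bar>R s x - R t x\<bar> \<le> rep_const q * 1)"
      using near[OF t, of 1] by auto
    have "osc_bound ?\<alpha> (B + rep_const q * 1) (R s) \<and> (\<forall>x. \<bar>R s x\<bar> \<le> B + rep_const q * 1)"
      if s: "s \<in> {0..T}" "dist s t < d" for s
    proof
      show "osc_bound ?\<alpha> (B + rep_const q * 1) (R s)"
        using osc_bound_add[OF B(1) d(2)[OF s, THEN conjunct1]] by simp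
      show "\<forall>x. \<bar>R s x\<bar> \<le> B + rep_const q * 1"
      proof
        fix x
        have "\<bar>R s x - R t x\<bar> \<le> rep_const q * 1" using d(2)[OF s] by blast
        then show "\<bar>R s x\<bar> \<le> B + rep_const q * 1" using B(2)[of x] by linarith
      qed
    qed
    then show "\<exists>d>0. \<exists>B. \<forall>s\<in>{0..T}. dist s t < d \<longrightarrow> osc_bound ?\<alpha> B (R s) \<and> (\<forall>x. \<bar>R s x\<bar> \<le> B)"
      using d(1) by blast
  next
    show "osc_bound ?\<alpha> B' (R s) \<and> (\<forall>x. \<bar>R s x\<bar> \<le> B')"
      if "osc_bound ?\<alpha> B (R s) \<and> (\<forall>x. \<bar>R s x\<bar> \<le> B)" "B \<le> B'" for s B B'
      using that osc_bound_mono order_trans by blast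
  qed auto
  show thesis
  proof (rule that[of B R])
    fix t e assume t: "t \<in> {0..T}" and e: "0 < (e::real)"
    have "0 < e / rep_const q" using e rc by simp
    from near[OF t this] show "\<exists>d>0. \<forall>s\<in>{0..T}. dist s t < d \<longrightarrow> (\<forall>x. \<bar>R s x - R t x\<bar> \<le> e)"
      using rc by simp blast
  qed (use B R in auto)
qed

section \<open>Time evolution of averages\<close>

text \<open>Lebesgue measure on space-time is the completion of the product measure, so Fubini is applied to a
  Borel version. The slice integrals agree with those of \<open>f\<close> for almost every time.\<close>

lemma spacetime_integral:
  fixes f :: "real \<times> (real^3) \<Rightarrow> real"
  assumes f: "integrable (spacetime T) f" and ft: "\<And>t. t \<in> {0..T} \<Longrightarrow> integrable torus (\<lambda>x. f (t, x))"
    and G: "continuous_on {0..T} G" "\<And>t. t \<in> {0..T} \<Longrightarrow> G t = (\<integral>x. f (t, x) \<partial>torus)"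
  shows "(\<integral>z. f z \<partial>spacetime T) = integral {0..T} G"
proof -
  let ?S = "{0..T} \<times> unit_cell"
  have "?S \<in> sets borel" using borel_Times[of "{0..T}" unit_cell] cell_at_borel[of 0] by (simp add: unit_cell_eq)
  then have S: "?S \<in> sets lebesgue" by simp
  define f0 where "f0 z = indicator ?S z *\<^sub>R f z" for z
  have i0: "integrable lebesgue f0" and e0: "(\<integral>z. f z \<partial>spacetime T) = (\<integral>z. f0 z \<partial>lebesgue)"
    using f S by (simp_all add: spacetime_def f0_def[abs_def] integrable_restrict_space integral_restrict_space)
  have "f0 \<in> borel_measurable (completion lborel)" using i0 by simp
  from completion_ex_borel_measurable_real[OF this]
  obtain f1 where f1: "f1 \<in> borel_measurable lborel" "AE z in lborel. f0 z = f1 z" by blast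
  have "integrable lebesgue f1"
    by (rule integrable_cong_AE_imp[OF i0 measurable_completion[OF f1(1)]]) (use AE_completion[OF f1(2)] in \<open>auto elim!: eventually_mono\<close>)
  then have i1: "integrable lborel f1" using f1(1) by (simp add: integrable_completion)
  have "(\<integral>z. f0 z \<partial>lebesgue) = (\<integral>z. f1 z \<partial>lebesgue)"
    by (rule integral_cong_AE) (use i0 measurable_completion[OF f1(1)] AE_completion[OF f1(2)] in auto)
  also have "\<dots> = (\<integral>z. f1 z \<partial>(lborel \<Otimes>\<^sub>M lborel))" using f1(1) by (simp add: integral_completion lborel_prod)
  also have "\<dots> = (\<integral>t. (\<integral>x. f1 (t, x) \<partial>lborel) \<partial>lborel)"
    by (rule lborel_pair.integral_fst'[symmetric]) (use i1 in \<open>simp add: lborel_prod\<close>)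
  also have "\<dots> = (\<integral>t. indicator {0..T} t *\<^sub>R G t \<partial>lborel)"
  proof (rule integral_cong_AE)
    have "f1 \<in> borel_measurable (lborel \<Otimes>\<^sub>M lborel)" using f1(1) by (simp add: lborel_prod)
    then show "(\<lambda>t. \<integral>x. f1 (t, x) \<partial>lborel) \<in> borel_measurable lborel" by measurable
    show "(\<lambda>t. indicator {0..T} t *\<^sub>R G t) \<in> borel_measurable lborel"
      using borel_integrable_atLeastAtMost'[OF G(1)] by (simp add: set_integrable_def)
    have "AE z in lborel \<Otimes>\<^sub>M lborel. f0 z = f1 z" unfolding lborel_prod by (rule f1(2))
    from lborel_pair.AE_pair[OF this]
    show "AE t in lborel. (\<integral>x. f1 (t, x) \<partial>lborel) = indicator {0..T} t *\<^sub>R G t"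
    proof eventually_elim
      case (elim t)
      have m1: "(\<lambda>x. f1 (t, x)) \<in> borel_measurable lborel" using f1(1) by simp
      have f0t: "f0 (t, x) = indicator {0..T} t * (indicator unit_cell x * f (t, x))" for x
        by (simp add: f0_def indicator_times)
      have "integrable lebesgue (\<lambda>x. f0 (t, x))"
      proof (cases "t \<in> {0..T}")
        case True
        then show ?thesis using ft[OF True] by (simp add: f0t integrable_torus_iff set_integrable_def)
      qed (simp add: f0t)
      then have m0: "(\<lambda>x. f0 (t, x)) \<in> borel_measurable lebesgue" by simp
      have "(\<integral>x. f1 (t, x) \<partial>lborel) = (\<integral>x. f1 (t, x) \<partial>lebesgue)"
        by (rule integral_completion[symmetric, OF m1])
      also have "\<dots> = (\<integral>x. f0 (t, x) \<partial>lebesgue)"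
        by (rule integral_cong_AE[OF measurable_completion[OF m1] m0])
          (use AE_completion[OF elim] in \<open>auto elim!: eventually_mono\<close>)
      also have "\<dots> = indicator {0..T} t *\<^sub>R G t"
        using G(2)[of t] by (cases "t \<in> {0..T}") (simp_all add: f0t integral_torus_eq set_lebesgue_integral_def)
      finally show ?case .
    qed
  qed
  also have "\<dots> = integral {0..T} G"
    using set_borel_integral_eq_integral(2)[OF borel_integrable_atLeastAtMost'[OF G(1)]]
    by (simp add: set_lebesgue_integral_def)
  finally show ?thesis using e0 by simp
qed

lemma spacetime_test_integrable:
  assumes f: "integrable (spacetime T) f"
    and h: "smooth h" "\<And>z. \<bar>h z\<bar> \<le> B"
  shows "integrable (spacetime T) (\<lambda>z. h z * f z :: real)"
proof (rule Bochner_Integration.integrable_bound[where f = "\<lambda>z. B * f z"])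
  have "h \<in> borel_measurable borel" by (intro borel_measurable_continuous_onI smooth_continuous_on h)
  then have "h \<in> borel_measurable (spacetime T)"
    unfolding spacetime_def by (simp add: measurable_completion measurable_restrict_space1)
  then show "(\<lambda>z. h z * f z) \<in> borel_measurable (spacetime T)" using f by simp
  have "\<bar>h z\<bar> * \<bar>f z\<bar> \<le> \<bar>B\<bar> * \<bar>f z\<bar>" for z
    using h(2)[of z] by (intro mult_right_mono) auto
  then show "AE z in spacetime T. norm (h z * f z) \<le> norm (B * f z)" by (simp add: abs_mult)
qed (use f in simp)

text \<open>With a product of a function of time and a spatial kernel as test function, all terms become time
  integrals of continuous functions, to which du Bois-Reymond's lemma applies.\<close>

lemma continuity_weak:
  fixes \<rho> :: "real \<Rightarrow> real^3 \<Rightarrow> real" and u :: "real \<Rightarrow> real^3 \<Rightarrow> real^3"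
  assumes ce: "continuity_eq T \<rho> u" and b: "supp_at c b"
    and \<psi>: "smooth \<psi>" "0 < l" "r < T" "\<And>s. s \<notin> {l<..<r} \<Longrightarrow> \<psi> s = 0"
    and p: "\<And>t. t \<in> {0..T} \<Longrightarrow> periodic (\<rho> t)" "\<And>t j. t \<in> {0..T} \<Longrightarrow> periodic (\<lambda>x. \<rho> t x * u t x $ j)"
    and i: "\<And>t. t \<in> {0..T} \<Longrightarrow> integrable torus (\<rho> t)" "\<And>t j. t \<in> {0..T} \<Longrightarrow> integrable torus (\<lambda>x. \<rho> t x * u t x $ j)"
    and g: "continuous_on {0..T} (\<lambda>t. \<integral>y. \<rho> t y * tens b y \<partial>lebesgue)"
    and h: "\<And>j. continuous_on {0..T} (\<lambda>t. \<integral>y. (\<rho> t y * u t y $ j) * tens (b(j := deriv (b j))) y \<partial>lebesgue)"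
  shows "integral {0..T} (\<lambda>t. deriv \<psi> t * (\<integral>y. \<rho> t y * tens b y \<partial>lebesgue))
    = - integral {0..T} (\<lambda>t. \<psi> t * (\<Sum>j\<in>UNIV. \<integral>y. (\<rho> t y * u t y $ j) * tens (b(j := deriv (b j))) y \<partial>lebesgue))"
proof -
  let ?\<W> = "\<lambda>b. tens (\<lambda>i. wrap (c $ i) (b i))"
  let ?bj = "\<lambda>j. b(j := deriv (b j))"
  define \<Phi> where "\<Phi> z = \<psi> (fst z) * ?\<W> b (snd z)" for z
  obtain \<rho>t flux where w: "st_weak_dt T \<rho> \<rho>t" "\<And>j. st_weak_dx T [j] (\<lambda>t x. \<rho> t x * u t x $ j) (flux j)"
    and ae: "AE (t, x) in spacetime T. \<rho>t t x + (\<Sum>j\<in>UNIV. flux j t x) = 0"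
    using ce unfolding continuity_eq_def by blast
  have sw: "smooth (wrap (c $ i) (b i))" for i by (rule supp_at_wrap_smooth[OF b])
  have swj: "smooth (wrap (c $ i) (?bj j i))" for i j by (rule supp_at_wrap_smooth[OF supp_at_deriv[OF b]])
  have s\<Phi>: "smooth \<Phi>" unfolding \<Phi>_def[abs_def] by (rule smooth_sttens[OF sw \<psi>(1)])
  have test: "\<Phi> \<in> spacetime_tests T"
  proof -
    have "\<forall>t. periodic (\<lambda>x. \<Phi> (t, x))"
      using periodic_tens_wrap[of c b] by (simp add: \<Phi>_def periodic_def)
    moreover have "\<forall>t x. t \<notin> {l..r} \<longrightarrow> \<Phi> (t, x) = 0" using \<psi>(4) by (auto simp: \<Phi>_def)
    ultimately show ?thesis using s\<Phi> \<psi>(2,3) unfolding spacetime_tests_def by blast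
  qed
  have D: "frechet_derivative \<Phi> (at z) = (\<lambda>e. \<psi> (fst z) * (\<Sum>j\<in>UNIV. snd e $ j *
      tens ((\<lambda>i. wrap (c $ i) (b i))(j := deriv (wrap (c $ j) (b j)))) (snd z)) + deriv \<psi> (fst z) * fst e * ?\<W> b (snd z))" for z
    unfolding \<Phi>_def[abs_def] by (rule frechet_derivative_at[OF sttens_has_derivative[OF sw \<psi>(1)], symmetric])
  have upd: "(\<lambda>i. wrap (c $ i) (b i))(j := deriv (wrap (c $ j) (b j))) = (\<lambda>i. wrap (c $ i) (?bj j i))" for j
    using deriv_wrap[OF b, of j] by auto
  have Dt: "iter_dderiv [(1, 0)] \<Phi> z = deriv \<psi> (fst z) * ?\<W> b (snd z)" for z by (simp add: D)
  have Dx: "iter_dderiv [(0, axis j 1)] \<Phi> z = \<psi> (fst z) * ?\<W> (?bj j) (snd z)" for z j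
    by (simp add: D upd axis_def if_distrib[of "\<lambda>x. x * _"] cong: if_cong)
  have e1: "(\<integral>z. deriv \<psi> (fst z) * ?\<W> b (snd z) * \<rho> (fst z) (snd z) \<partial>spacetime T) = - (\<integral>z. \<Phi> z * \<rho>t (fst z) (snd z) \<partial>spacetime T)"
  proof -
    have "(\<integral>z. iter_dderiv [(1, 0)] \<Phi> z * \<rho> (fst z) (snd z) \<partial>spacetime T) = - (\<integral>z. \<Phi> z * \<rho>t (fst z) (snd z) \<partial>spacetime T)"
      using w(1) test by (simp add: st_weak_dt_def weak_deriv_def case_prod_unfold del: iter_dderiv.simps)
    then show ?thesis by (simp only: Dt)
  qed
  have e2: "(\<integral>z. \<psi> (fst z) * ?\<W> (?bj j) (snd z) * (\<rho> (fst z) (snd z) * u (fst z) (snd z) $ j) \<partial>spacetime T)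
      = - (\<integral>z. \<Phi> z * flux j (fst z) (snd z) \<partial>spacetime T)" for j
  proof -
    have "(\<integral>z. iter_dderiv [(0, axis j 1)] \<Phi> z * (\<rho> (fst z) (snd z) * u (fst z) (snd z) $ j) \<partial>spacetime T)
        = - (\<integral>z. \<Phi> z * flux j (fst z) (snd z) \<partial>spacetime T)"
      using w(2)[of j] test by (simp add: st_weak_dx_def weak_deriv_def case_prod_unfold del: iter_dderiv.simps)
    then show ?thesis by (simp only: Dx)
  qed
  obtain B1 where B1: "0 < B1" "\<And>s. \<bar>\<psi> s\<bar> \<le> B1" using smooth_compact_bounded[OF \<psi>(1,4)] by blast
  obtain B1' where B1': "0 < B1'" "\<And>s. \<bar>deriv \<psi> s\<bar> \<le> B1'"
    using smooth_compact_bounded[OF smooth_deriv[OF \<psi>(1)], of l r] deriv_eq_0_outside[OF \<psi>(1,4)] by blast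
  obtain B2 where B2: "0 < B2" "\<And>y. \<bar>?\<W> b y\<bar> \<le> B2" using tens_wrap_bounded[OF b] by blast
  have \<Phi>B: "\<bar>\<Phi> z\<bar> \<le> B1 * B2" for z
    unfolding \<Phi>_def abs_mult using B1 B2 by (intro mult_mono) (auto simp: less_imp_le)
  have ir: "integrable (spacetime T) (\<lambda>z. \<rho> (fst z) (snd z))" "integrable (spacetime T) (\<lambda>z. \<rho>t (fst z) (snd z))"
    using w(1) by (simp_all add: st_weak_dt_def weak_deriv_def case_prod_unfold)
  have iflux: "integrable (spacetime T) (\<lambda>z. flux j (fst z) (snd z))"
    "integrable (spacetime T) (\<lambda>z. \<rho> (fst z) (snd z) * u (fst z) (snd z) $ j)" for j
    using w(2)[of j] by (simp_all add: st_weak_dx_def weak_deriv_def case_prod_unfold)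
  have \<Phi>i: "integrable (spacetime T) (\<lambda>z. \<Phi> z * \<rho>t (fst z) (snd z))" "integrable (spacetime T) (\<lambda>z. \<Phi> z * flux j (fst z) (snd z))" for j
    by (rule spacetime_test_integrable[OF _ s\<Phi> \<Phi>B]; fact ir iflux)+
  have "(\<integral>z. \<Phi> z * \<rho>t (fst z) (snd z) \<partial>spacetime T) = (\<integral>z. - (\<Sum>j\<in>UNIV. \<Phi> z * flux j (fst z) (snd z)) \<partial>spacetime T)"
  proof (rule integral_cong_AE)
    show "AE z in spacetime T. \<Phi> z * \<rho>t (fst z) (snd z) = - (\<Sum>j\<in>UNIV. \<Phi> z * flux j (fst z) (snd z))"
      using ae
    proof eventually_elim
      case (elim z)
      then have "\<rho>t (fst z) (snd z) = - (\<Sum>j\<in>UNIV. flux j (fst z) (snd z))" by (simp add: case_prod_unfold)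
      then show ?case by (simp add: sum_distrib_left)
    qed
  qed (use \<Phi>i in auto)
  also have "\<dots> = - (\<Sum>j\<in>UNIV. \<integral>z. \<Phi> z * flux j (fst z) (snd z) \<partial>spacetime T)"
    using \<Phi>i by (simp add: Bochner_Integration.integral_sum)
  finally have e3: "(\<integral>z. deriv \<psi> (fst z) * ?\<W> b (snd z) * \<rho> (fst z) (snd z) \<partial>spacetime T)
     = - (\<Sum>j\<in>UNIV. \<integral>z. \<psi> (fst z) * ?\<W> (?bj j) (snd z) * (\<rho> (fst z) (snd z) * u (fst z) (snd z) $ j) \<partial>spacetime T)"
    unfolding e1 e2 by (simp add: sum_negf)
  have L: "(\<integral>z. \<theta> (fst z) * ?\<W> b' (snd z) * \<kappa> (fst z) (snd z) \<partial>spacetime T)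
      = integral {0..T} (\<lambda>t. \<theta> t * (\<integral>y. \<kappa> t y * tens b' y \<partial>lebesgue))"
    if b': "supp_at c b'" and \<theta>: "smooth \<theta>" "\<And>s. \<bar>\<theta> s\<bar> \<le> B"
      and \<kappa>: "integrable (spacetime T) (\<lambda>z. \<kappa> (fst z) (snd z))" "\<And>t. t \<in> {0..T} \<Longrightarrow> periodic (\<kappa> t)"
        "\<And>t. t \<in> {0..T} \<Longrightarrow> integrable torus (\<kappa> t)"
      and cont: "continuous_on {0..T} (\<lambda>t. \<integral>y. \<kappa> t y * tens b' y \<partial>lebesgue)" for \<theta> b' \<kappa> B
  proof -
    obtain B2 where B2: "0 < B2" "\<And>y. \<bar>?\<W> b' y\<bar> \<le> B2" using tens_wrap_bounded[OF b'] by blast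
    have sm: "smooth (\<lambda>z::real \<times> (real^3). \<theta> (fst z) * ?\<W> b' (snd z))"
      by (rule smooth_sttens[OF supp_at_wrap_smooth[OF b'] \<theta>(1)])
    have B: "\<bar>\<theta> (fst z) * ?\<W> b' (snd z)\<bar> \<le> B * B2" for z
      unfolding abs_mult using B2 \<theta>(2)[of "fst z"] order_trans[OF abs_ge_zero \<theta>(2)] by (intro mult_mono) auto
    show ?thesis
    proof (rule spacetime_integral)
      show "integrable (spacetime T) (\<lambda>z. \<theta> (fst z) * ?\<W> b' (snd z) * \<kappa> (fst z) (snd z))"
        by (rule spacetime_test_integrable[OF \<kappa>(1) sm B])
      show "continuous_on {0..T} (\<lambda>t. \<theta> t * (\<integral>y. \<kappa> t y * tens b' y \<partial>lebesgue))"
        by (intro continuous_intros smooth_continuous_on \<theta> cont)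
      fix t assume t: "t \<in> {0..T}"
      have E: "\<theta> (fst (t, x)) * ?\<W> b' (snd (t, x)) * \<kappa> (fst (t, x)) (snd (t, x)) = \<theta> t * (?\<W> b' x * \<kappa> t x)" for x by simp
      note tt = torus_integral_tens[OF b' \<kappa>(2)[OF t] \<kappa>(3)[OF t]]
      show "integrable torus (\<lambda>x. \<theta> (fst (t, x)) * ?\<W> b' (snd (t, x)) * \<kappa> (fst (t, x)) (snd (t, x)))"
        unfolding E using tt(2) by simp
      show "\<theta> t * (\<integral>y. \<kappa> t y * tens b' y \<partial>lebesgue)
          = (\<integral>x. \<theta> (fst (t, x)) * ?\<W> b' (snd (t, x)) * \<kappa> (fst (t, x)) (snd (t, x)) \<partial>torus)"
        unfolding E using tt(3) by simp
    qed
  qed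
  have l1: "(\<integral>z. deriv \<psi> (fst z) * ?\<W> b (snd z) * \<rho> (fst z) (snd z) \<partial>spacetime T)
      = integral {0..T} (\<lambda>t. deriv \<psi> t * (\<integral>y. \<rho> t y * tens b y \<partial>lebesgue))"
    by (rule L[OF b smooth_deriv[OF \<psi>(1)] B1'(2) ir(1) p(1) i(1) g])
  have l2: "(\<integral>z. \<psi> (fst z) * ?\<W> (?bj j) (snd z) * (\<rho> (fst z) (snd z) * u (fst z) (snd z) $ j) \<partial>spacetime T)
      = integral {0..T} (\<lambda>t. \<psi> t * (\<integral>y. (\<rho> t y * u t y $ j) * tens (?bj j) y \<partial>lebesgue))" for j
    by (rule L[OF supp_at_deriv[OF b] \<psi>(1) B1(2), where \<kappa> = "\<lambda>t y. \<rho> t y * u t y $ j", OF iflux(2) p(2) i(2) h])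
  have "integral {0..T} (\<lambda>t. deriv \<psi> t * (\<integral>y. \<rho> t y * tens b y \<partial>lebesgue))
      = - (\<Sum>j\<in>UNIV. integral {0..T} (\<lambda>t. \<psi> t * (\<integral>y. (\<rho> t y * u t y $ j) * tens (?bj j) y \<partial>lebesgue)))"
    using e3 by (simp only: l1 l2)
  also have "\<dots> = - integral {0..T} (\<lambda>t. \<Sum>j\<in>UNIV. \<psi> t * (\<integral>y. (\<rho> t y * u t y $ j) * tens (?bj j) y \<partial>lebesgue))"
    by (subst integral_sum)
      (auto intro!: integrable_continuous_interval continuous_on_mult h smooth_continuous_on[OF \<psi>(1)])
  finally show ?thesis by (simp add: sum_distrib_left)
qed


lemma kern_integral:
  assumes "0 < \<epsilon>" "0 \<le> t - \<epsilon>" "t + \<epsilon> \<le> T"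
  shows "integral {0..T} (kern \<epsilon> t) = 1"
proof -
  obtain G where G: "\<And>s. (G has_real_derivative kern \<epsilon> t s) (at s)" "\<And>s. s \<le> t - \<epsilon> \<Longrightarrow> G s = 0"
    "\<And>s. s \<ge> t + \<epsilon> \<Longrightarrow> G s = 1"
    using adm_primitive[OF adm_kern[OF assms(1)] assms(1)] by metis
  have "(kern \<epsilon> t has_integral (G T - G 0)) {0..T}"
    by (rule fundamental_theorem_of_calculus)
      (use assms G(1) in \<open>auto simp: has_real_derivative_iff_has_vector_derivative[symmetric] intro: DERIV_subset\<close>)
  then show ?thesis using G(2)[of 0] G(3)[of T] assms by (simp add: integral_unique)
qed

lemma kern_average_lim:
  fixes D :: "real \<Rightarrow> real"
  assumes D: "continuous_on {0..T} D" and t: "0 < t" "t < T"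
  shows "(\<lambda>k. integral {0..T} (\<lambda>s. kern (eps k) t s * D s)) \<longlonglongrightarrow> D t"
proof (rule LIMSEQ_I)
  fix e :: real assume e: "0 < e"
  have "t \<in> {0..T}" "0 < e / 2" using t e by auto
  from D[unfolded continuous_on_iff, rule_format, OF this]
  obtain d where d: "0 < d" "\<And>s. s \<in> {0..T} \<Longrightarrow> dist s t < d \<Longrightarrow> dist (D s) (D t) < e / 2" by blast
  have "\<forall>\<^sub>F k in sequentially. eps k < min d (min t (T - t))"
    using eps_lim d t by (intro order_tendstoD(2)) auto
  then obtain K where K: "\<And>k. k \<ge> K \<Longrightarrow> eps k < min d (min t (T - t))" by (auto simp: eventually_sequentially)
  have "norm (integral {0..T} (\<lambda>s. kern (eps k) t s * D s) - D t) < e" if "k \<ge> K" for k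
  proof -
    note a = adm_kern[OF eps_pos, of k t]
    have kc: "continuous_on S (kern (eps k) t)" for S by (rule smooth_continuous_on[OF admD(1)[OF a]])
    have one: "integral {0..T} (kern (eps k) t) = 1" by (rule kern_integral) (use K[OF that] eps_pos in auto)
    have "D t = integral {0..T} (\<lambda>s. kern (eps k) t s * D t)" using one by simp
    then have "integral {0..T} (\<lambda>s. kern (eps k) t s * D s) - D t
        = integral {0..T} (\<lambda>s. kern (eps k) t s * D s) - integral {0..T} (\<lambda>s. kern (eps k) t s * D t)" by simp
    also have "\<dots> = integral {0..T} (\<lambda>s. kern (eps k) t s * D s - kern (eps k) t s * D t)"
      by (intro integral_diff[symmetric] integrable_continuous_interval continuous_on_mult kc D continuous_on_const)
    finally have "norm (integral {0..T} (\<lambda>s. kern (eps k) t s * D s) - D t)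
        \<le> integral {0..T} (\<lambda>s. kern (eps k) t s * (e / 2))"
    proof (simp only:, intro integral_norm_bound_integral integrable_continuous_interval continuous_on_diff continuous_on_mult kc D continuous_on_const)
      fix s assume s: "s \<in> {0..T}"
      show "norm (kern (eps k) t s * D s - kern (eps k) t s * D t) \<le> kern (eps k) t s * (e / 2)"
      proof (cases "\<bar>s - t\<bar> < eps k")
        case True
        then have "\<bar>D s - D t\<bar> \<le> e / 2" using d(2)[OF s] K[OF that] by (auto simp: dist_real_def)
        have "norm (kern (eps k) t s * D s - kern (eps k) t s * D t) = kern (eps k) t s * \<bar>D s - D t\<bar>"
          using admD(2)[OF a, of s] by (simp only: right_diff_distrib[symmetric] real_norm_def abs_mult)
        then show ?thesis using mult_left_mono[OF \<open>\<bar>D s - D t\<bar> \<le> e / 2\<close> admD(2)[OF a, of s]] by linarith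
      qed (use admD(4)[OF a, of s] in simp)
    qed
    also have "\<dots> = e / 2" using one by simp
    finally show ?thesis using e by simp
  qed
  then show "\<exists>no. \<forall>k\<ge>no. norm (integral {0..T} (\<lambda>s. kern (eps k) t s * D s) - D t) < e" by blast
qed

text \<open>The difference of \<open>g\<close> and the primitive of \<open>h\<close> is orthogonal to all derivatives of test functions.
  The difference of two kernels centred at interior times is such a derivative, so the averages at
  any two interior times coincide in the limit.\<close>

lemma du_bois_reymond:
  fixes g h :: "real \<Rightarrow> real"
  assumes T: "0 < T" and g: "continuous_on {0..T} g" and h: "continuous_on {0..T} h"
    and weak: "\<And>\<psi> l r. smooth \<psi> \<Longrightarrow> 0 < l \<Longrightarrow> r < T \<Longrightarrow> (\<And>s. s \<notin> {l<..<r} \<Longrightarrow> \<psi> s = 0) \<Longrightarrow>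
       integral {0..T} (\<lambda>t. deriv \<psi> t * g t) = - integral {0..T} (\<lambda>t. \<psi> t * h t)"
    and t: "t \<in> {0..T}"
  shows "g t = g 0 + integral {0..t} h"
proof -
  define H where "H t = integral {0..t} h" for t
  have Hd: "(H has_real_derivative h s) (at s within {0..T})" if "s \<in> {0..T}" for s
    unfolding H_def by (rule integral_has_real_derivative[OF h that])
  have Hc: "continuous_on {0..T} H" using Hd DERIV_continuous_on by blast
  define D where "D t = g t - H t" for t
  have Dc: "continuous_on {0..T} D" unfolding D_def by (intro continuous_intros g Hc)
  have zero: "integral {0..T} (\<lambda>t. deriv \<psi> t * D t) = 0"
    if \<psi>: "smooth \<psi>" "0 < l" "r < T" "\<And>s. s \<notin> {l<..<r} \<Longrightarrow> \<psi> s = 0" for \<psi> l r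
  proof -
    have c: "continuous_on S \<psi>" "continuous_on S (deriv \<psi>)" for S
      using smooth_continuous_on \<psi>(1) smooth_deriv by blast+
    have "((\<lambda>s. deriv \<psi> s * H s + \<psi> s * h s) has_integral (\<psi> T * H T - \<psi> 0 * H 0)) {0..T}"
    proof (rule fundamental_theorem_of_calculus)
      fix s assume s: "s \<in> {0..T}"
      have "((\<lambda>s. \<psi> s * H s) has_real_derivative deriv \<psi> s * H s + h s * \<psi> s) (at s within {0..T})"
        by (rule DERIV_mult[OF DERIV_subset[OF smooth_has_real_derivative[OF \<psi>(1)]] Hd[OF s]]) simp
      then show "((\<lambda>s. \<psi> s * H s) has_vector_derivative deriv \<psi> s * H s + \<psi> s * h s) (at s within {0..T})"
        by (simp add: has_real_derivative_iff_has_vector_derivative mult.commute)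
    qed (use T in simp)
    moreover have "\<psi> T = 0" "\<psi> 0 = 0" using \<psi> by auto
    ultimately have "integral {0..T} (\<lambda>s. deriv \<psi> s * H s + \<psi> s * h s) = 0" by (simp add: integral_unique)
    moreover have "integral {0..T} (\<lambda>s. deriv \<psi> s * H s + \<psi> s * h s)
       = integral {0..T} (\<lambda>s. deriv \<psi> s * H s) + integral {0..T} (\<lambda>s. \<psi> s * h s)"
      by (intro integral_add integrable_continuous_interval continuous_on_mult c Hc h)
    moreover have "integral {0..T} (\<lambda>t. deriv \<psi> t * D t) = integral {0..T} (\<lambda>s. deriv \<psi> s * g s) - integral {0..T} (\<lambda>s. deriv \<psi> s * H s)"
      unfolding D_def right_diff_distrib
      by (intro integral_diff integrable_continuous_interval continuous_on_mult c Hc g)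
    ultimately show ?thesis using weak[OF \<psi>] by simp
  qed
  have const: "D t1 = D t2" if t1: "0 < t1" "t1 < T" and t2: "0 < t2" "t2 < T" for t1 t2
  proof -
    define l where "l = min t1 t2 / 2"
    define r where "r = (max t1 t2 + T) / 2"
    have lr: "0 < l" "r < T" "l < t1" "l < t2" "t1 < r" "t2 < r" using t1 t2 by (auto simp: l_def r_def)
    define m where "m = min (min (t1 - l) (t2 - l)) (min (r - t1) (r - t2))"
    have "\<forall>\<^sub>F k in sequentially. eps k < m"
      using eps_lim lr by (intro order_tendstoD(2)) (auto simp: m_def)
    then have "\<forall>\<^sub>F k in sequentially. integral {0..T} (\<lambda>s. kern (eps k) t2 s * D s) = integral {0..T} (\<lambda>s. kern (eps k) t1 s * D s)"
    proof eventually_elim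
      case (elim k)
      note a = adm_kern[OF eps_pos, of k]
      obtain G1 where G1: "\<And>s. (G1 has_real_derivative kern (eps k) t1 s) (at s)" "\<And>s. s \<le> t1 - eps k \<Longrightarrow> G1 s = 0"
        "\<And>s. s \<ge> t1 + eps k \<Longrightarrow> G1 s = 1"
        using adm_primitive[OF a eps_pos] by metis
      obtain G2 where G2: "\<And>s. (G2 has_real_derivative kern (eps k) t2 s) (at s)" "\<And>s. s \<le> t2 - eps k \<Longrightarrow> G2 s = 0"
        "\<And>s. s \<ge> t2 + eps k \<Longrightarrow> G2 s = 1"
        using adm_primitive[OF a eps_pos] by metis
      have d: "((\<lambda>s. G1 s - G2 s) has_real_derivative kern (eps k) t1 s - kern (eps k) t2 s) (at s)" for s
        by (rule DERIV_diff[OF G1(1) G2(1)])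
      have sm: "smooth (\<lambda>s. G1 s - G2 s)"
        by (rule smooth_antiderivative[OF d]) (intro smooth_diff admD(1)[OF a])
      have out: "G1 s - G2 s = 0" if "s \<notin> {l<..<r}" for s
      proof (cases "s \<le> l")
        case True
        then show ?thesis using G1(2)[of s] G2(2)[of s] elim by (simp add: m_def)
      next
        case False
        then have "s \<ge> r" using that by auto
        then show ?thesis using G1(3)[of s] G2(3)[of s] elim by (simp add: m_def)
      qed
      have c: "continuous_on S (kern (eps k) t)" for S t by (rule smooth_continuous_on[OF admD(1)[OF a]])
      have "integral {0..T} (\<lambda>t. (kern (eps k) t1 t - kern (eps k) t2 t) * D t) = 0"
        using zero[OF sm lr(1,2) out] DERIV_imp_deriv[OF d] by simp
      moreover have "integral {0..T} (\<lambda>t. (kern (eps k) t1 t - kern (eps k) t2 t) * D t)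
          = integral {0..T} (\<lambda>s. kern (eps k) t1 s * D s) - integral {0..T} (\<lambda>s. kern (eps k) t2 s * D s)"
        unfolding left_diff_distrib
        by (intro integral_diff integrable_continuous_interval continuous_on_mult c Dc)
      ultimately show ?case by simp
    qed
    then have "(\<lambda>k. integral {0..T} (\<lambda>s. kern (eps k) t1 s * D s)) \<longlonglongrightarrow> D t2"
      by (rule Lim_transform_eventually[OF kern_average_lim[OF Dc t2]])
    then show ?thesis using LIMSEQ_unique kern_average_lim[OF Dc t1] by blast
  qed
  have cl: "closure {0<..<T} = {0..T}" using T by simp
  have cst: "D s = D (T / 2)" if "s \<in> {0..T}" for s
  proof (rule continuous_constant_on_closure[of "{0<..<T}" D "D (T / 2)" s])
    show "D x = D (T / 2)" if "x \<in> {0<..<T}" for x using const[of x "T / 2"] that by simp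
  qed (simp_all only: cl Dc that)
  have "0 \<in> {0..T}" using T by simp
  then have "D t = D 0" using cst[OF t] cst[of 0] by metis
  then show ?thesis by (simp add: D_def H_def)
qed

section \<open>Averages at a spatial minimum\<close>

lemma bump_deriv_bounded: "\<exists>A>0. \<forall>s. \<bar>deriv bump s\<bar> \<le> A"
proof -
  have sm: "smooth bump" by (rule admD(1)[OF adm_bump])
  have z: "bump s = 0" if "s \<notin> {-1<..<1}" for s using admD(4)[OF adm_bump, of s] that by (auto simp: abs_if split: if_splits)
  show ?thesis
    using smooth_compact_bounded[OF smooth_deriv[OF sm], of "-1" 1] deriv_eq_0_outside[OF sm z] by metis
qed

definition bumpA1 :: real where
  "bumpA1 = (SOME A. A > 0 \<and> (\<forall>s. \<bar>deriv bump s\<bar> \<le> A))"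

lemma bumpA1: "0 < bumpA1" "\<bar>deriv bump s\<bar> \<le> bumpA1"
  using someI_ex[OF bump_deriv_bounded, folded bumpA1_def] by auto

lemma deriv_kern:
  assumes "0 < \<epsilon>"
  shows "deriv (kern \<epsilon> x) s = deriv bump ((s - x) / \<epsilon>) / \<epsilon>\<^sup>2"
proof -
  have "((\<lambda>s. (s - x) / \<epsilon>) has_real_derivative 1 / \<epsilon>) (at s)"
    using assms by (auto intro!: derivative_eq_intros)
  from DERIV_chain2[OF smooth_has_real_derivative[OF admD(1)[OF adm_bump]] this]
  have "((\<lambda>s. bump ((s - x) / \<epsilon>)) has_real_derivative deriv bump ((s - x) / \<epsilon>) * (1 / \<epsilon>)) (at s)" .
  from DERIV_cdivide[OF this, of \<epsilon>]
  have "(kern \<epsilon> x has_real_derivative deriv bump ((s - x) / \<epsilon>) / \<epsilon>\<^sup>2) (at s)"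
    by (simp add: kern_def[abs_def] power2_eq_square)
  then show ?thesis by (rule DERIV_imp_deriv)
qed

text \<open>The partial derivative of the kernel in its variable, which is minus the derivative in its centre.\<close>

definition dkern :: "real \<Rightarrow> 3 \<Rightarrow> real^3 \<Rightarrow> real^3 \<Rightarrow> real" where
  "dkern \<epsilon> j x = tens ((\<lambda>i. kern \<epsilon> (x $ i))(j := deriv (kern \<epsilon> (x $ j))))"

definition dkern_bound :: "real \<Rightarrow> real" where
  "dkern_bound \<epsilon> = bumpA\<^sup>2 * bumpA1 / \<epsilon> ^ 4"

lemma supp_kern: "0 < \<epsilon> \<Longrightarrow> \<epsilon> \<le> 1 / 2 \<Longrightarrow> supp_at (corner x) (\<lambda>i. kern \<epsilon> (x $ i))"
  by (rule adm3_supp[OF adm3_kern])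

lemma supp_dkern: "0 < \<epsilon> \<Longrightarrow> \<epsilon> \<le> 1 / 2 \<Longrightarrow>
    supp_at (corner x) ((\<lambda>i. kern \<epsilon> (x $ i))(j := deriv (kern \<epsilon> (x $ j))))"
  using supp_at_deriv[OF supp_kern, of \<epsilon> x j] by simp

lemma dkern_zero:
  assumes "0 < \<epsilon>" "y \<notin> cube x \<epsilon>"
  shows "dkern \<epsilon> j x y = 0"
proof -
  obtain i where i: "\<bar>y $ i - x $ i\<bar> \<ge> \<epsilon>" using assms(2) unfolding cube_def by (auto simp: not_less)
  note a = adm_kern[OF assms(1)]
  have z: "kern \<epsilon> (x $ i) s = 0" if "s \<notin> {x $ i - \<epsilon><..<x $ i + \<epsilon>}" for s
    using admD(4)[OF a, of s "x $ i"] that by (auto simp: abs_if split: if_splits)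
  have "((\<lambda>i. kern \<epsilon> (x $ i))(j := deriv (kern \<epsilon> (x $ j)))) i (y $ i) = 0"
  proof (cases "i = j")
    case True
    have "y $ i \<notin> {x $ i - \<epsilon><..<x $ i + \<epsilon>}" using i by auto
    then show ?thesis using True deriv_eq_0_outside[OF admD(1)[OF a] z] by simp
  qed (use admD(4)[OF a i] in simp)
  then show ?thesis unfolding dkern_def tens_def by (intro prod_zero bexI[of _ i]) auto
qed

lemma dkern_le:
  assumes "0 < \<epsilon>"
  shows "\<bar>dkern \<epsilon> j x y\<bar> \<le> dkern_bound \<epsilon>"
proof -
  have "\<bar>dkern \<epsilon> j x y\<bar> = \<bar>deriv (kern \<epsilon> (x $ j)) (y $ j)\<bar> * (\<Prod>i\<in>UNIV - {j}. \<bar>kern \<epsilon> (x $ i) (y $ i)\<bar>)"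
    by (simp add: dkern_def tens_upd abs_mult abs_prod)
  also have "\<dots> \<le> (bumpA1 / \<epsilon>\<^sup>2) * (\<Prod>i\<in>UNIV - {j}. bumpA / \<epsilon>)"
    using bumpA1 assms adm_abs_le[OF adm_kern[OF assms]]
    by (intro mult_mono prod_mono prod_nonneg) (auto simp: deriv_kern divide_right_mono less_imp_le)
  also have "\<dots> = dkern_bound \<epsilon>"
    by (simp add: dkern_bound_def card_Diff_singleton power_divide power2_eq_square power4_eq_xxxx mult_ac)
  finally show ?thesis .
qed

text \<open>The bound by a multiple of \<open>1/\<epsilon>\<close> is the one that matters: it compensates the factor \<open>\<epsilon>\<close> in the
  oscillation of a Lipschitz function on the cube.\<close>

lemma dkern_integral:
  assumes "0 < \<epsilon>" "\<epsilon> \<le> 1 / 2"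
  shows "integrable lebesgue (\<lambda>y. \<bar>dkern \<epsilon> j x y\<bar>)"
    "(\<integral>y. \<bar>dkern \<epsilon> j x y\<bar> \<partial>lebesgue) \<le> 8 * bumpA\<^sup>2 * bumpA1 / \<epsilon>"
    "(\<integral>y. \<bar>dkern \<epsilon> j x y\<bar> \<partial>lebesgue) \<le> dkern_bound \<epsilon>"
proof -
  have le: "\<bar>tens ((\<lambda>i. kern \<epsilon> (x $ i))(j := deriv (kern \<epsilon> (x $ j)))) y\<bar> \<le> dkern_bound \<epsilon>" for y
    using dkern_le[OF assms(1)] by (simp add: dkern_def)
  note b = torus_integral_tens_bound[OF supp_dkern[OF assms] const_torus(1) const_torus(2) le, of 1]
  show i: "integrable lebesgue (\<lambda>y. \<bar>dkern \<epsilon> j x y\<bar>)" using b(1) by (simp add: dkern_def)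
  show "(\<integral>y. \<bar>dkern \<epsilon> j x y\<bar> \<partial>lebesgue) \<le> dkern_bound \<epsilon>"
    using b(2) measure_torus(1) by (simp add: dkern_def)
  have "(\<integral>y. \<bar>dkern \<epsilon> j x y\<bar> \<partial>lebesgue) \<le> (LINT y:cube x \<epsilon>|lebesgue. dkern_bound \<epsilon>)"
    unfolding set_lebesgue_integral_def
  proof (rule integral_mono[OF i])
    show "integrable lebesgue (\<lambda>y. indicator (cube x \<epsilon>) y *\<^sub>R dkern_bound \<epsilon>)"
      using cube_measure(1)[OF assms(1)] by (simp add: set_integrable_def)
    show "\<bar>dkern \<epsilon> j x y\<bar> \<le> indicator (cube x \<epsilon>) y *\<^sub>R dkern_bound \<epsilon>" for y
      using dkern_le[OF assms(1)] dkern_zero[OF assms(1)] by (cases "y \<in> cube x \<epsilon>") auto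
  qed
  also have "\<dots> = 8 * bumpA\<^sup>2 * bumpA1 / \<epsilon>"
    unfolding cube_measure(2)[OF assms(1)] dkern_bound_def using assms(1) by (simp add: field_simps power_numeral_reduce)
  finally show "(\<integral>y. \<bar>dkern \<epsilon> j x y\<bar> \<partial>lebesgue) \<le> 8 * bumpA\<^sup>2 * bumpA1 / \<epsilon>" .
qed

lemma torus_integral_dkern:
  fixes f :: "real^3 \<Rightarrow> real"
  assumes "0 < \<epsilon>" "\<epsilon> \<le> 1 / 2" and f: "periodic f" "integrable torus f"
  shows "integrable lebesgue (\<lambda>y. f y * dkern \<epsilon> j x y)" "integrable lebesgue (\<lambda>y. \<bar>f y\<bar> * \<bar>dkern \<epsilon> j x y\<bar>)"
    "(\<integral>y. \<bar>f y\<bar> * \<bar>dkern \<epsilon> j x y\<bar> \<partial>lebesgue) \<le> dkern_bound \<epsilon> * (\<integral>y. \<bar>f y\<bar> \<partial>torus)"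
  using torus_integral_tens(1)[OF supp_dkern[OF assms(1,2)] f, of x j]
    torus_integral_tens_bound[OF supp_dkern[OF assms(1,2)] f, of x j "dkern_bound \<epsilon>"] dkern_le[OF assms(1), of j x]
  by (simp_all add: dkern_def)

text \<open>The gradient of the average vanishes at a minimum. Since \<open>f\<close> is merely integrable, differentiability
  comes from the kernel: a second-order Taylor estimate of one factor bounds the change of the
  average under a displacement \<open>h\<close> of the centre by its linear part plus \<open>C h\<^sup>2\<close>.\<close>

lemma mol_critical:
  fixes f :: "real^3 \<Rightarrow> real"
  assumes \<epsilon>: "0 < \<epsilon>" "\<epsilon> \<le> 1 / 4" and f: "periodic f" "integrable torus f"
    and min: "\<And>x'. mol f \<epsilon> x \<le> mol f \<epsilon> x'"
  shows "(\<integral>y. f y * dkern \<epsilon> j x y \<partial>lebesgue) = 0"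
proof (rule ccontr)
  let ?I = "\<integral>y. f y * dkern \<epsilon> j x y \<partial>lebesgue"
  assume I: "?I \<noteq> 0"
  let ?b = "\<lambda>i. kern \<epsilon> (x $ i)"
  define k where "k = kern \<epsilon> (x $ j)"
  have half: "\<epsilon> \<le> 1 / 2" using \<epsilon> by simp
  note a = adm_kern[OF \<epsilon>(1)]
  have ks: "smooth k" unfolding k_def by (rule admD(1)[OF a])
  have kz: "k s = 0" if "s \<notin> {x $ j - \<epsilon><..<x $ j + \<epsilon>}" for s
    using admD(4)[OF a, of s "x $ j"] that by (auto simp: k_def abs_if split: if_splits)
  have k'z: "deriv k s = 0" if "s \<notin> {x $ j - \<epsilon><..<x $ j + \<epsilon>}" for s by (rule deriv_eq_0_outside[OF ks kz that])
  obtain M where M: "0 < M" "\<And>s. \<bar>deriv (deriv k) s\<bar> \<le> M"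
    using smooth_compact_bounded[OF smooth_deriv[OF smooth_deriv[OF ks]], of "x $ j - \<epsilon>" "x $ j + \<epsilon>"]
      deriv_eq_0_outside[OF smooth_deriv[OF ks] k'z] by metis
  have lip: "\<bar>deriv k s - deriv k r\<bar> \<le> M * \<bar>s - r\<bar>" for s r
  proof (cases "s = r")
    case False
    have *: "\<bar>deriv k q - deriv k p\<bar> \<le> M * \<bar>q - p\<bar>" if pq: "p < q" for p q
    proof -
      obtain z where "deriv k q - deriv k p = (q - p) * deriv (deriv k) z"
        using MVT2[OF pq, of "deriv k" "deriv (deriv k)"] smooth_has_real_derivative[OF smooth_deriv[OF ks]] by blast
      then show ?thesis using mult_left_mono[OF M(2)[of z], of "\<bar>q - p\<bar>"] by (simp add: abs_mult mult.commute)
    qed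
    then show ?thesis using False *[of s r] *[of r s] by (cases "s < r") (auto simp: abs_minus_commute)
  qed simp
  have taylor: "\<bar>k (s - h) - k s + h * deriv k s\<bar> \<le> M * h\<^sup>2" for s h
  proof -
    have "\<exists>z. \<bar>s - z\<bar> \<le> \<bar>h\<bar> \<and> k (s - h) - k s = - h * deriv k z"
    proof (cases h "0::real" rule: linorder_cases)
      case less
      obtain z where "s < z" "z < s - h" "k (s - h) - k s = (s - h - s) * deriv k z"
        using MVT2[of s "s - h" k "deriv k"] less smooth_has_real_derivative[OF ks] by auto
      then show ?thesis by (intro exI[of _ z]) auto
    next
      case greater
      obtain z where "s - h < z" "z < s" "k s - k (s - h) = (s - (s - h)) * deriv k z"
        using MVT2[of "s - h" s k "deriv k"] greater smooth_has_real_derivative[OF ks] by auto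
      then show ?thesis by (intro exI[of _ z]) auto
    qed auto
    then obtain z where z: "\<bar>s - z\<bar> \<le> \<bar>h\<bar>" "k (s - h) - k s = - h * deriv k z" by blast
    have "\<bar>k (s - h) - k s + h * deriv k s\<bar> = \<bar>h\<bar> * \<bar>deriv k s - deriv k z\<bar>"
      unfolding z(2) abs_mult[symmetric] by (simp add: algebra_simps)
    also have "\<dots> \<le> \<bar>h\<bar> * (M * \<bar>h\<bar>)"
    proof (rule mult_left_mono)
      have "M * \<bar>s - z\<bar> \<le> M * \<bar>h\<bar>" using z(1) M(1) by (intro mult_left_mono) auto
      then show "\<bar>deriv k s - deriv k z\<bar> \<le> M * \<bar>h\<bar>" using lip[of s z] by linarith
    qed simp
    finally show ?thesis by (simp add: power2_eq_square mult_ac)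
  qed
  define C where "C = M * (bumpA / \<epsilon>)\<^sup>2 * (\<integral>y. \<bar>f y\<bar> \<partial>torus)"
  have C: "0 \<le> C" using M(1) by (simp add: C_def integral_nonneg_AE)
  have est: "mol f \<epsilon> (x + h *\<^sub>R axis j 1) - mol f \<epsilon> x + h * ?I \<le> C * h\<^sup>2" if h: "\<bar>h\<bar> \<le> 1 / 4" for h
  proof -
    define e where "e s = k (s - h) - k s + h * deriv k s" for s
    have shift_s: "smooth (\<lambda>s. k (s - h))" using smooth_affine[OF ks, of 1 "- h"] by simp
    have es: "smooth e" unfolding e_def[abs_def]
      by (intro smooth_add smooth_diff smooth_mult shift_s ks smooth_deriv smooth_const)
    have out: "k (s - h) = 0" "k s = 0" "deriv k s = 0" if "s \<notin> {x $ j - 1 / 2<..<x $ j + 1 / 2}" for s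
    proof -
      show "k (s - h) = 0" by (rule kz) (use that h \<epsilon> in \<open>auto simp: abs_if split: if_splits\<close>)
      show "k s = 0" by (rule kz) (use that \<epsilon> in auto)
      show "deriv k s = 0" by (rule k'z) (use that \<epsilon> in auto)
    qed
    have sb: "supp_at (corner x) ?b" by (rule supp_kern[OF \<epsilon>(1) half])
    have supd: "supp_at (corner x) (?b(j := c))" if "smooth c" "\<And>s. s \<notin> {x $ j - 1 / 2<..<x $ j + 1 / 2} \<Longrightarrow> c s = 0" for c
      using sb that unfolding supp_at_def by auto
    have s1: "supp_at (corner x) (?b(j := (\<lambda>s. k (s - h))))" by (rule supd[OF shift_s out(1)])
    have s2: "supp_at (corner x) (?b(j := e))" by (rule supd[OF es]) (simp add: e_def out)
    have E: "tens (?b(j := e)) y = tens (?b(j := (\<lambda>s. k (s - h)))) y - tens ?b y + h * dkern \<epsilon> j x y" for y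
      unfolding dkern_def tens_upd tens_split[of ?b y j] e_def k_def by (simp add: algebra_simps)
    have i1: "integrable lebesgue (\<lambda>y. f y * tens (?b(j := (\<lambda>s. k (s - h)))) y)" by (rule torus_integral_tens(1)[OF s1 f])
    have i2: "integrable lebesgue (\<lambda>y. f y * tens ?b y)" by (rule torus_integral_tens(1)[OF sb f])
    have i3: "integrable lebesgue (\<lambda>y. f y * dkern \<epsilon> j x y)" by (rule torus_integral_dkern(1)[OF \<epsilon>(1) half f])
    have sh: "(\<lambda>i. kern \<epsilon> ((x + h *\<^sub>R axis j 1) $ i)) = ?b(j := (\<lambda>s. k (s - h)))"
      by (auto simp: fun_eq_iff axis_def k_def kern_def algebra_simps)
    have "(\<integral>y. f y * tens (?b(j := e)) y \<partial>lebesgue)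
        = (\<integral>y. f y * tens (?b(j := (\<lambda>s. k (s - h)))) y - f y * tens ?b y + h * (f y * dkern \<epsilon> j x y) \<partial>lebesgue)"
      unfolding E by (intro Bochner_Integration.integral_cong) (simp_all add: algebra_simps)
    also have "\<dots> = mol f \<epsilon> (x + h *\<^sub>R axis j 1) - mol f \<epsilon> x + h * ?I"
      unfolding mol_def sh using i1 i2 i3 by simp
    finally have eq: "mol f \<epsilon> (x + h *\<^sub>R axis j 1) - mol f \<epsilon> x + h * ?I = (\<integral>y. f y * tens (?b(j := e)) y \<partial>lebesgue)" by simp
    have b: "\<bar>tens (?b(j := e)) y\<bar> \<le> M * h\<^sup>2 * (bumpA / \<epsilon>)\<^sup>2" for y
    proof -
      have "\<bar>tens (?b(j := e)) y\<bar> = \<bar>e (y $ j)\<bar> * (\<Prod>i\<in>UNIV - {j}. \<bar>kern \<epsilon> (x $ i) (y $ i)\<bar>)"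
        by (simp add: tens_upd abs_mult abs_prod)
      also have "\<dots> \<le> (M * h\<^sup>2) * (\<Prod>i\<in>UNIV - {j}. bumpA / \<epsilon>)"
        using taylor M(1) adm_abs_le[OF a] by (intro mult_mono prod_mono prod_nonneg) (auto simp: e_def)
      also have "\<dots> = M * h\<^sup>2 * (bumpA / \<epsilon>)\<^sup>2" by (simp add: card_Diff_singleton)
      finally show ?thesis .
    qed
    have "(\<integral>y. f y * tens (?b(j := e)) y \<partial>lebesgue) \<le> (\<integral>y. \<bar>f y\<bar> * \<bar>tens (?b(j := e)) y\<bar> \<partial>lebesgue)"
      by (rule integral_mono[OF torus_integral_tens(1)[OF s2 f] torus_integral_tens_bound(1)[OF s2 f b]])
        (simp add: abs_mult[symmetric])
    also have "\<dots> \<le> M * h\<^sup>2 * (bumpA / \<epsilon>)\<^sup>2 * (\<integral>y. \<bar>f y\<bar> \<partial>torus)" by (rule torus_integral_tens_bound(2)[OF s2 f b])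
    also have "\<dots> = C * h\<^sup>2" by (simp add: C_def)
    finally show ?thesis using eq by simp
  qed
  \<comment> \<open>A displacement against the sign of the gradient so short that the quadratic error cannot
    compensate the linear gain.\<close>
  define t where "t = min (1 / 4) (\<bar>?I\<bar> / (2 * (C + 1)))"
  have t: "0 < t" "t \<le> 1 / 4" "C * t < \<bar>?I\<bar>"
  proof -
    show "t \<le> 1 / 4" unfolding t_def by (rule min.cobounded1)
    show "0 < t" using I C by (auto simp: t_def)
    have "C * t \<le> C * (\<bar>?I\<bar> / (2 * (C + 1)))" using C by (intro mult_left_mono) (auto simp: t_def)
    also have "\<dots> = \<bar>?I\<bar> * (C / (2 * (C + 1)))" by simp
    also have "\<dots> < \<bar>?I\<bar> * 1" using I C by (intro mult_strict_left_mono) (auto simp: field_simps)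
    finally show "C * t < \<bar>?I\<bar>" by simp
  qed
  define h where "h = sgn ?I * t"
  have hI: "h * ?I = t * \<bar>?I\<bar>" "h\<^sup>2 = t * t" "\<bar>h\<bar> \<le> 1 / 4"
    using I t by (auto simp: h_def sgn_if power2_eq_square abs_if)
  have "h * ?I \<le> C * h\<^sup>2" using est[OF hI(3)] min[of "x + h *\<^sub>R axis j 1"] by linarith
  then have "t * \<bar>?I\<bar> \<le> t * (C * t)" unfolding hI by (simp add: mult_ac)
  then show False using t by simp
qed

lemma mol_diff_le:
  fixes f g :: "real^3 \<Rightarrow> real"
  assumes \<epsilon>: "0 < \<epsilon>" "\<epsilon> \<le> 1 / 2" and f: "periodic f" "integrable torus f" and g: "periodic g" "integrable torus g"
    and le: "\<And>y. \<bar>f y - g y\<bar> \<le> c"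
  shows "\<bar>mol f \<epsilon> x - mol g \<epsilon> x\<bar> \<le> c"
proof -
  have *: "mol f \<epsilon> x \<le> mol g \<epsilon> x + c"
    if f: "periodic f" "integrable torus f" and g: "periodic g" "integrable torus g" and le: "\<And>y. f y \<le> g y + c"
    for f g :: "real^3 \<Rightarrow> real"
  proof -
    have p: "periodic (\<lambda>y. g y + c)" using g(1) by (simp add: periodic_def)
    have i: "integrable torus (\<lambda>y. g y + c)" using g(2) const_torus(2) by simp
    have "mol f \<epsilon> x \<le> mol (\<lambda>y. g y + c) \<epsilon> x"
      unfolding mol_def by (rule mol_mono_AE[OF f p i _ adm3_kern[OF \<epsilon>(1)] \<epsilon>(2)]) (use le in simp)
    also have "\<dots> = mol g \<epsilon> x + mol (\<lambda>_. c) \<epsilon> x"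
      unfolding mol_def distrib_right
      by (rule Bochner_Integration.integral_add[OF torus_integral_tens(1)[OF supp_kern[OF \<epsilon>] g] torus_integral_tens(1)[OF supp_kern[OF \<epsilon>] const_torus]])
    finally show ?thesis using mol_const[OF \<epsilon>(1)] by simp
  qed
  have "f y \<le> g y + c" "g y \<le> f y + c" for y using le[of y] by linarith+
  then show ?thesis using *[OF f g] *[OF g f] by (simp add: abs_le_iff)
qed

text \<open>Averaging commutes with translation, so the modulus of continuity is inherited.\<close>

lemma osc_bound_mol:
  assumes F: "osc_bound \<alpha> B F" "0 < \<alpha>" and \<epsilon>: "0 < \<epsilon>" "\<epsilon> \<le> 1 / 2"
  shows "osc_bound \<alpha> B (mol F \<epsilon>)"
  unfolding osc_bound_def
proof (intro conjI allI impI)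
  have c: "continuous_on UNIV F" by (rule osc_bound_continuous[OF F])
  have p: "periodic F" using F(1) by (simp add: osc_bound_def)
  have i: "integrable torus F" by (rule continuous_integrable_torus[OF c])
  show "periodic (mol F \<epsilon>)" using mol_periodic[OF p i \<epsilon>] by (simp add: periodic_def)
  fix k x y assume k: "k \<ge> (1::nat)" and y: "y \<in> cube x (eps k)"
  \<comment> \<open>Moving the centre from \<open>x\<close> to \<open>y\<close> amounts to translating the function.\<close>
  define G where "G z = F (y - x + z)" for z
  have Gp: "periodic G" using p by (simp add: G_def periodic_def add.assoc[symmetric])
  have Gc: "continuous_on UNIV G" unfolding G_def
    by (rule continuous_on_compose2[OF c]) (auto intro!: continuous_intros)
  have Gi: "integrable torus G" by (rule continuous_integrable_torus[OF Gc])
  have "mol F \<epsilon> y = (\<integral>z. F (y - x + z) * tens (\<lambda>i. kern \<epsilon> (y $ i)) (y - x + z) \<partial>lebesgue)"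
    unfolding mol_def
    by (rule lebesgue_integral_plus(2)[OF torus_integral_tens(1)[OF supp_kern[OF \<epsilon>, of y] p i], of "y - x", symmetric])
  also have "\<dots> = mol G \<epsilon> x"
    unfolding mol_def by (intro Bochner_Integration.integral_cong) (auto simp: G_def tens_def kern_def algebra_simps)
  finally have e: "mol F \<epsilon> y = mol G \<epsilon> x" .
  show "\<bar>mol F \<epsilon> y - mol F \<epsilon> x\<bar> \<le> B * eps k powr \<alpha>"
    unfolding e
  proof (rule mol_diff_le[OF \<epsilon> Gp Gi p i])
    fix z
    have "y - x + z \<in> cube z (eps k)" using y by (simp add: cube_def)
    then show "\<bar>G z - F z\<bar> \<le> B * eps k powr \<alpha>" using F(1) k unfolding osc_bound_def G_def by blast
  qed
qed

text \<open>How far the field \<open>U\<close> is from its average around \<open>x\<close>, weighted with the gradient of the kernel. It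
  plays the role of the supremum of the gradient of the velocity in the growth estimate.\<close>

definition defect :: "real \<Rightarrow> (3 \<Rightarrow> real^3 \<Rightarrow> real) \<Rightarrow> real^3 \<Rightarrow> real" where
  "defect \<epsilon> U x = (\<Sum>j\<in>UNIV. \<integral>y. \<bar>U j y - mol (U j) \<epsilon> x\<bar> * \<bar>dkern \<epsilon> j x y\<bar> \<partial>lebesgue)"

lemma minus_const_torus:
  fixes f :: "real^3 \<Rightarrow> real"
  assumes "periodic f" "integrable torus f"
  shows "periodic (\<lambda>y. f y - c)" "integrable torus (\<lambda>y. f y - c)"
  using assms const_torus(2) by (auto simp: periodic_def)

lemma mol_L1_diff:
  fixes f g :: "real^3 \<Rightarrow> real"
  assumes \<epsilon>: "0 < \<epsilon>" "\<epsilon> \<le> 1 / 2" and f: "periodic f" "integrable torus f" and g: "periodic g" "integrable torus g"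
  shows "\<bar>mol f \<epsilon> x - mol g \<epsilon> x\<bar> \<le> (bumpA / \<epsilon>) ^ 3 * (\<integral>y. \<bar>f y - g y\<bar> \<partial>torus)"
proof -
  have "mol (\<lambda>y. f y - g y) \<epsilon> x = mol f \<epsilon> x - mol g \<epsilon> x"
    unfolding mol_def left_diff_distrib
    by (rule Bochner_Integration.integral_diff[OF torus_integral_tens(1)[OF supp_kern[OF \<epsilon>] f] torus_integral_tens(1)[OF supp_kern[OF \<epsilon>] g]])
  moreover have "periodic (\<lambda>y. f y - g y)" "integrable torus (\<lambda>y. f y - g y)" using f g by (auto simp: periodic_def)
  ultimately show ?thesis using mol_bound[of "\<lambda>y. f y - g y" \<epsilon> x] \<epsilon> by simp
qed

definition defect_const :: "real \<Rightarrow> real" where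
  "defect_const \<epsilon> = dkern_bound \<epsilon> * (1 + (bumpA / \<epsilon>) ^ 3)"

lemma dkern_bound_nonneg: "0 \<le> dkern_bound \<epsilon>"
  using bumpA1 by (simp add: dkern_bound_def)

text \<open>Lipschitz dependence on the field in \<open>L\<^sup>1\<close>, uniformly in \<open>x\<close>. The constant depends on \<open>\<epsilon>\<close>; this is used
  only for continuity in time at a fixed scale.\<close>

lemma defect_diff:
  assumes \<epsilon>: "0 < \<epsilon>" "\<epsilon> \<le> 1 / 2" and U: "\<And>j. periodic (U j)" "\<And>j. integrable torus (U j)"
    and V: "\<And>j. periodic (V j)" "\<And>j. integrable torus (V j)"
  shows "defect \<epsilon> U x \<le> defect \<epsilon> V x + defect_const \<epsilon> * (\<Sum>j\<in>UNIV. \<integral>y. \<bar>U j y - V j y\<bar> \<partial>torus)"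
proof -
  have "(\<integral>y. \<bar>U j y - mol (U j) \<epsilon> x\<bar> * \<bar>dkern \<epsilon> j x y\<bar> \<partial>lebesgue)
     \<le> (\<integral>y. \<bar>V j y - mol (V j) \<epsilon> x\<bar> * \<bar>dkern \<epsilon> j x y\<bar> \<partial>lebesgue) + defect_const \<epsilon> * (\<integral>y. \<bar>U j y - V j y\<bar> \<partial>torus)" for j
  proof -
    define m where "m = \<bar>mol (U j) \<epsilon> x - mol (V j) \<epsilon> x\<bar>"
    define D where "D = (\<integral>y. \<bar>U j y - V j y\<bar> \<partial>torus)"
    have UV: "periodic (\<lambda>y. U j y - V j y)" "integrable torus (\<lambda>y. U j y - V j y)" using U V by (auto simp: periodic_def)
    note iU = torus_integral_dkern(2)[OF \<epsilon> minus_const_torus[OF U]]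
    note iV = torus_integral_dkern(2)[OF \<epsilon> minus_const_torus[OF V]]
    note iUV = torus_integral_dkern(2,3)[OF \<epsilon> UV]
    note idk = dkern_integral[OF \<epsilon>]
    have "(\<integral>y. \<bar>U j y - mol (U j) \<epsilon> x\<bar> * \<bar>dkern \<epsilon> j x y\<bar> \<partial>lebesgue)
      \<le> (\<integral>y. \<bar>V j y - mol (V j) \<epsilon> x\<bar> * \<bar>dkern \<epsilon> j x y\<bar> + \<bar>U j y - V j y\<bar> * \<bar>dkern \<epsilon> j x y\<bar> + m * \<bar>dkern \<epsilon> j x y\<bar> \<partial>lebesgue)"
    proof (rule integral_mono)
      fix y
      have "\<bar>U j y - mol (U j) \<epsilon> x\<bar> \<le> \<bar>V j y - mol (V j) \<epsilon> x\<bar> + \<bar>U j y - V j y\<bar> + m" unfolding m_def by linarith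
      from mult_right_mono[OF this, of "\<bar>dkern \<epsilon> j x y\<bar>"]
      show "\<bar>U j y - mol (U j) \<epsilon> x\<bar> * \<bar>dkern \<epsilon> j x y\<bar>
        \<le> \<bar>V j y - mol (V j) \<epsilon> x\<bar> * \<bar>dkern \<epsilon> j x y\<bar> + \<bar>U j y - V j y\<bar> * \<bar>dkern \<epsilon> j x y\<bar> + m * \<bar>dkern \<epsilon> j x y\<bar>"
        by (simp add: distrib_right)
    next
      show "integrable lebesgue (\<lambda>y. \<bar>V j y - mol (V j) \<epsilon> x\<bar> * \<bar>dkern \<epsilon> j x y\<bar> + \<bar>U j y - V j y\<bar> * \<bar>dkern \<epsilon> j x y\<bar> + m * \<bar>dkern \<epsilon> j x y\<bar>)"
        by (intro Bochner_Integration.integrable_add integrable_mult_right iV iUV idk)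
    qed (rule iU)
    also have "\<dots> = (\<integral>y. \<bar>V j y - mol (V j) \<epsilon> x\<bar> * \<bar>dkern \<epsilon> j x y\<bar> \<partial>lebesgue)
        + (\<integral>y. \<bar>U j y - V j y\<bar> * \<bar>dkern \<epsilon> j x y\<bar> \<partial>lebesgue) + m * (\<integral>y. \<bar>dkern \<epsilon> j x y\<bar> \<partial>lebesgue)"
      using iV iUV(1) idk(1) by (simp add: Bochner_Integration.integral_add Bochner_Integration.integrable_add)
    also have "(\<integral>y. \<bar>U j y - V j y\<bar> * \<bar>dkern \<epsilon> j x y\<bar> \<partial>lebesgue) \<le> dkern_bound \<epsilon> * D"
      unfolding D_def by (rule iUV(2))
    also have "m * (\<integral>y. \<bar>dkern \<epsilon> j x y\<bar> \<partial>lebesgue) \<le> ((bumpA / \<epsilon>) ^ 3 * D) * dkern_bound \<epsilon>"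
      using mol_L1_diff[OF \<epsilon> U V, of j x j] idk(3) dkern_bound_nonneg
      by (intro mult_mono) (auto simp: m_def D_def intro: integral_nonneg_AE order_trans[OF abs_ge_zero])
    finally show ?thesis by (simp add: defect_const_def D_def algebra_simps)
  qed
  then show ?thesis unfolding defect_def sum_distrib_left sum.distrib[symmetric] by (intro sum_mono)
qed

text \<open>Bounded independently of the scale: on the cube a Lipschitz field deviates from its average by a
  multiple of \<open>\<epsilon>\<close>, and the gradient of the kernel has mass of order \<open>1/\<epsilon>\<close>.\<close>

lemma defect_lip:
  assumes U: "\<And>j. periodic (U j)" "\<And>j. integrable torus (U j)"
    and F: "\<And>j. osc_bound 1 L (F j)" "\<And>j. AE x in torus. F j x = U j x" and k: "k \<ge> 1"
  shows "defect (eps k) U x \<le> 48 * bumpA\<^sup>2 * bumpA1 * L"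
proof -
  have Fc: "continuous_on UNIV (F j)" for j by (rule osc_bound_continuous[OF F(1)]) simp
  have Fp: "periodic (F j)" for j using F(1) by (simp add: osc_bound_def)
  have Fi: "integrable torus (F j)" for j by (rule continuous_integrable_torus[OF Fc])
  have "(\<integral>y. \<bar>U j y - F j y\<bar> \<partial>torus) = 0" for j
  proof -
    have "(\<integral>y. \<bar>U j y - F j y\<bar> \<partial>torus) = (\<integral>y. 0 \<partial>torus)"
      by (rule integral_cong_AE) (use U(2)[of j] Fi[of j] F(2)[of j] in \<open>auto elim!: eventually_mono\<close>)
    then show ?thesis by simp
  qed
  moreover have "defect (eps k) U x \<le> defect (eps k) F x + defect_const (eps k) * (\<Sum>j\<in>UNIV. \<integral>y. \<bar>U j y - F j y\<bar> \<partial>torus)"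
    by (rule defect_diff[OF eps_pos eps_half U Fp Fi])
  ultimately have "defect (eps k) U x \<le> defect (eps k) F x" by simp
  also have "\<dots> \<le> (\<Sum>j\<in>(UNIV::3 set). 16 * bumpA\<^sup>2 * bumpA1 * L)"
    unfolding defect_def
  proof (rule sum_mono)
    fix j :: 3
    have L0: "0 \<le> L * eps k"
    proof -
      have "x \<in> cube x (eps k)" using eps_pos by (simp add: cube_def)
      then have "\<bar>F j x - F j x\<bar> \<le> L * eps k powr 1" using F(1)[of j] k unfolding osc_bound_def by blast
      then show ?thesis using eps_pos[of k] by simp
    qed
    have o: "\<bar>F j y - F j x\<bar> \<le> L * eps k" if "y \<in> cube x (eps k)" for y
      using F(1)[of j] k that eps_pos[of k] unfolding osc_bound_def by (metis powr_one less_imp_le)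
    have mo: "\<bar>mol (F j) (eps k) x - F j x\<bar> \<le> L * eps k"
      by (rule mol_continuous_close[OF Fc Fp eps_pos eps_half o])
    have "(\<integral>y. \<bar>F j y - mol (F j) (eps k) x\<bar> * \<bar>dkern (eps k) j x y\<bar> \<partial>lebesgue)
      \<le> (\<integral>y. (2 * (L * eps k)) * \<bar>dkern (eps k) j x y\<bar> \<partial>lebesgue)"
    proof (rule integral_mono[OF torus_integral_dkern(2)[OF eps_pos eps_half minus_const_torus[OF Fp Fi]]])
      show "integrable lebesgue (\<lambda>y. (2 * (L * eps k)) * \<bar>dkern (eps k) j x y\<bar>)"
        using dkern_integral(1)[OF eps_pos eps_half] by simp
      fix y
      show "\<bar>F j y - mol (F j) (eps k) x\<bar> * \<bar>dkern (eps k) j x y\<bar> \<le> (2 * (L * eps k)) * \<bar>dkern (eps k) j x y\<bar>"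
      proof (cases "y \<in> cube x (eps k)")
        case True
        have "\<bar>F j y - mol (F j) (eps k) x\<bar> \<le> 2 * (L * eps k)" using o[OF True] mo by linarith
        then show ?thesis by (rule mult_right_mono) simp
      qed (simp add: dkern_zero[OF eps_pos])
    qed
    also have "\<dots> \<le> (2 * (L * eps k)) * (8 * bumpA\<^sup>2 * bumpA1 / eps k)"
    proof -
      have "0 \<le> 2 * (L * eps k)" using L0 by simp
      from mult_left_mono[OF dkern_integral(2)[OF eps_pos eps_half] this]
      show ?thesis by (simp only: integral_mult_right_zero)
    qed
    also have "\<dots> = 16 * bumpA\<^sup>2 * bumpA1 * L" using eps_pos[of k] by simp
    finally show "(\<integral>y. \<bar>F j y - mol (F j) (eps k) x\<bar> * \<bar>dkern (eps k) j x y\<bar> \<partial>lebesgue) \<le> 16 * bumpA\<^sup>2 * bumpA1 * L" .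
  qed
  also have "\<dots> = 48 * bumpA\<^sup>2 * bumpA1 * L" by simp
  finally show ?thesis .
qed

text \<open>At a critical point of the average of \<open>R\<close> the constant \<open>v\<close>, here the average of \<open>U\<close>, may be subtracted
  from the field without changing the flux.\<close>

lemma flux_bound:
  assumes \<epsilon>: "0 < \<epsilon>" "\<epsilon> \<le> 1 / 2" and U: "\<And>j. periodic (U j)" "\<And>j. integrable torus (U j)"
    and R: "periodic R" "integrable torus R" and RU: "\<And>j. integrable torus (\<lambda>y. R y * U j y)"
    and m: "\<And>y. y \<in> cube x \<epsilon> \<Longrightarrow> 0 \<le> R y" "\<And>y. y \<in> cube x \<epsilon> \<Longrightarrow> R y \<le> m" and crit: "\<And>j. (\<integral>y. R y * dkern \<epsilon> j x y \<partial>lebesgue) = 0"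
  shows "(\<Sum>j\<in>UNIV. \<integral>y. (R y * U j y) * dkern \<epsilon> j x y \<partial>lebesgue) \<le> m * defect \<epsilon> U x"
  unfolding defect_def sum_distrib_left
proof (rule sum_mono)
  fix j :: 3
  let ?v = "mol (U j) \<epsilon> x"
  have pRU: "periodic (\<lambda>y. R y * U j y)" using R U by (simp add: periodic_def)
  note iRU = torus_integral_dkern(1)[OF \<epsilon> pRU RU]
  note iR = torus_integral_dkern(1)[OF \<epsilon> R]
  note iU = torus_integral_dkern(2)[OF \<epsilon> minus_const_torus[OF U]]
  have "(\<integral>y. (R y * U j y) * dkern \<epsilon> j x y \<partial>lebesgue)
      = (\<integral>y. (R y * U j y) * dkern \<epsilon> j x y - ?v * (R y * dkern \<epsilon> j x y) \<partial>lebesgue)"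
    using iRU iR crit[of j] by simp
  also have "\<dots> \<le> (\<integral>y. m * (\<bar>U j y - ?v\<bar> * \<bar>dkern \<epsilon> j x y\<bar>) \<partial>lebesgue)"
  proof (rule integral_mono)
    fix y
    show "(R y * U j y) * dkern \<epsilon> j x y - ?v * (R y * dkern \<epsilon> j x y) \<le> m * (\<bar>U j y - ?v\<bar> * \<bar>dkern \<epsilon> j x y\<bar>)"
    proof (cases "y \<in> cube x \<epsilon>")
      case True
      have "(R y * U j y) * dkern \<epsilon> j x y - ?v * (R y * dkern \<epsilon> j x y) = R y * ((U j y - ?v) * dkern \<epsilon> j x y)"
        by (simp add: algebra_simps)
      also have "\<dots> \<le> R y * (\<bar>U j y - ?v\<bar> * \<bar>dkern \<epsilon> j x y\<bar>)"
        using m(1)[OF True] by (intro mult_left_mono) (auto simp: abs_mult[symmetric])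
      also have "\<dots> \<le> m * (\<bar>U j y - ?v\<bar> * \<bar>dkern \<epsilon> j x y\<bar>)" using m(2)[OF True] by (intro mult_right_mono) auto
      finally show ?thesis .
    qed (simp add: dkern_zero[OF \<epsilon>(1)])
  qed (use iRU iR iU in auto)
  also have "\<dots> = m * (\<integral>y. \<bar>U j y - ?v\<bar> * \<bar>dkern \<epsilon> j x y\<bar> \<partial>lebesgue)" by simp
  finally show "(\<integral>y. (R y * U j y) * dkern \<epsilon> j x y \<partial>lebesgue) \<le> m * (\<integral>y. \<bar>U j y - ?v\<bar> * \<bar>dkern \<epsilon> j x y\<bar> \<partial>lebesgue)" .
qed

section \<open>Propagation of the lower bound\<close>

lemma C_sobolev_L1:
  fixes u :: "real \<Rightarrow> real^3 \<Rightarrow> real^3"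
  assumes u: "u \<in> C_sobolev T 2 2"
  shows "t \<in> {0..T} \<Longrightarrow> periodic (\<lambda>x. u t x $ j)" "t \<in> {0..T} \<Longrightarrow> integrable torus (\<lambda>x. u t x $ j)"
    "t \<in> {0..T} \<Longrightarrow> 0 < e \<Longrightarrow> \<exists>d>0. \<forall>s\<in>{0..T}. dist s t < d \<longrightarrow> (\<forall>j. (\<integral>x. \<bar>u s x $ j - u t x $ j\<bar> \<partial>torus) \<le> e)"
proof -
  have sob: "u t \<in> sobolev 2 2" if "t \<in> {0..T}" for t using u that by (simp add: C_sobolev_def)
  have iu: "integrable torus (u t)" if "t \<in> {0..T}" for t
    using sobolev_weak_dx[OF sob[OF that], of "[]"] by (simp add: weak_dx_def weak_deriv_def)
  show p: "periodic (\<lambda>x. u t x $ j)" if "t \<in> {0..T}" for t j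
    using sobolev_periodic[OF sob[OF that]] by (simp add: periodic_def)
  show i: "integrable torus (\<lambda>x. u t x $ j)" if "t \<in> {0..T}" for t j
    by (rule integrable_bounded_linear[OF bounded_linear_vec_nth iu[OF that]])
  assume t: "t \<in> {0..T}" and e: "0 < e"
  have "((\<lambda>s. sobolev_norm 2 2 (\<lambda>x. u s x - u t x)) \<longlongrightarrow> 0) (at t within {0..T})"
    using u t by (simp add: C_sobolev_def)
  then have "\<forall>\<^sub>F s in at t within {0..T}. sobolev_norm 2 2 (\<lambda>x. u s x - u t x) < ennreal (e / 2)"
    using e by (intro order_tendstoD(2)) auto
  then obtain d where d: "d > 0" "\<And>s. s \<in> {0..T} \<Longrightarrow> s \<noteq> t \<Longrightarrow> dist s t < d \<Longrightarrow> sobolev_norm 2 2 (\<lambda>x. u s x - u t x) < ennreal (e / 2)"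
    unfolding eventually_at by blast
  have "(\<integral>x. \<bar>u s x $ j - u t x $ j\<bar> \<partial>torus) \<le> e" if s: "s \<in> {0..T}" "dist s t < d" for s j
  proof (cases "s = t")
    case False
    define D where "D x = u s x - u t x" for x
    have nrm: "sobolev_norm 2 2 D < ennreal (e / 2)" unfolding D_def[abs_def] by (rule d(2)[OF s(1) False s(2)])
    have iD: "integrable torus D" unfolding D_def[abs_def] using iu s t by simp
    have "weak_dx [] D D" using iD by (simp add: weak_dx_def weak_deriv_def)
    then have w: "weak_dx [] D (dx [] D)" by (rule weak_dx_dx)
    have pD: "periodic (\<lambda>x. D x $ j)" using p[OF s(1)] p[OF t] by (simp add: periodic_def D_def)
    have ae: "AE x in torus. D x $ j = dx [] D x $ j" by (rule weak_dx_nil[OF weak_dx_nth[OF w] pD])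
    have "Lp_norm 2 (\<lambda>x. D x $ j) \<le> Lp_norm 2 (dx [] D)"
    proof (rule Lp_norm_mono)
      show "AE x in torus. norm (D x $ j) \<le> norm (dx [] D x)"
        using ae by eventually_elim (simp add: component_le_norm_cart)
    qed simp
    also have "\<dots> \<le> sobolev_norm 2 2 D" by (rule sobolev_norm_ge) simp
    also have "\<dots> \<le> ennreal (e / 2)" using nrm by simp
    finally have L: "Lp_norm 2 (\<lambda>x. D x $ j) \<le> ennreal (e / 2)" .
    have "(\<lambda>x. D x $ j) \<in> borel_measurable torus"
      using integrable_bounded_linear[OF bounded_linear_vec_nth iD, of j] by simp
    then have "(\<integral>x. \<bar>D x $ j\<bar> \<partial>torus) \<le> 2 * (e / 2)" using L1_le_Lp(2)[OF _ L] e by simp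
    then show ?thesis by (simp add: D_def)
  qed (use e in simp)
  then show "\<exists>d>0. \<forall>s\<in>{0..T}. dist s t < d \<longrightarrow> (\<forall>j. (\<integral>x. \<bar>u s x $ j - u t x $ j\<bar> \<partial>torus) \<le> e)"
    using d(1) by blast
qed

text \<open>Consider the last time at which \<open>r\<close> is somewhere not above the comparison function.
  The contact point is a spatial minimum, and afterwards \<open>r\<close> stays above, so the right derivative of
  \<open>r\<close> there is at least that of the comparison function. The hypothesis \<open>key\<close> excludes this.\<close>

lemma barrier:
  fixes r :: "real \<Rightarrow> 'a::euclidean_space \<Rightarrow> real"
  assumes K: "compact K" and r: "continuous_on ({0..T} \<times> K) (\<lambda>p. r (fst p) (snd p))"
    and y: "\<And>t. t \<in> {0..T} \<Longrightarrow> (y has_real_derivative y' t) (at t within {0..T})"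
    and final: "\<And>x. x \<in> K \<Longrightarrow> y T < r T x"
    and key: "\<And>t x. 0 \<le> t \<Longrightarrow> t < T \<Longrightarrow> x \<in> K \<Longrightarrow> r t x = y t \<Longrightarrow> (\<And>x'. x' \<in> K \<Longrightarrow> r t x \<le> r t x') \<Longrightarrow>
       \<exists>D. ((\<lambda>s. r s x) has_real_derivative D) (at t within {t..T}) \<and> D < y' t"
    and t: "t \<in> {0..T}" and x: "x \<in> K"
  shows "y t < r t x"
proof (rule ccontr)
  assume neg: "\<not> y t < r t x"
  have yc: "continuous_on {0..T} y" using y DERIV_continuous_on by blast
  have yc2: "continuous_on ({0..T} \<times> K) (\<lambda>p. y (fst p))"
    by (rule continuous_on_compose2[OF yc]) (auto intro!: continuous_intros)
  define S where "S = {p \<in> {0..T} \<times> K. r (fst p) (snd p) \<le> y (fst p)}"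
  have cK: "compact ({0..T} \<times> K)" using K by (intro compact_Times) auto
  \<comment> \<open>The last contact time is attained by compactness.\<close>
  have "closed S" unfolding S_def
    by (rule continuous_on_closed_Collect_le[OF r yc2]) (use cK compact_imp_closed in auto)
  moreover have "S = S \<inter> ({0..T} \<times> K)" unfolding S_def by auto
  ultimately have "compact S" using cK closed_Int_compact by metis
  moreover have "(t, x) \<in> S" using neg t x by (simp add: S_def)
  ultimately have "\<exists>p\<in>S. \<forall>p'\<in>S. fst p' \<le> fst p"
    by (intro continuous_attains_sup continuous_on_fst continuous_on_id) auto
  then obtain p where p: "p \<in> S" "\<And>p'. p' \<in> S \<Longrightarrow> fst p' \<le> fst p" by blast
  define a where "a = fst p"
  define z where "z = snd p"
  have az: "a \<in> {0..T}" "z \<in> K" "r a z \<le> y a" using p(1) by (auto simp: S_def a_def z_def)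
  have "a \<noteq> T" using az final[of z] by auto
  then have aT: "a < T" using az by simp
  have above: "y s < r s x'" if "a < s" "s \<le> T" "x' \<in> K" for s x'
  proof (rule ccontr)
    assume "\<not> ?thesis"
    then have "(s, x') \<in> S" using that az by (auto simp: S_def)
    then show False using p(2) that unfolding a_def by fastforce
  qed
  have ge: "y a \<le> r a x'" if x': "x' \<in> K" for x'
  proof -
    have rc: "continuous_on {a..T} (\<lambda>s. r s x')"
    proof -
      have "(\<lambda>s. (s, x')) ` {a..T} \<subseteq> {0..T} \<times> K" using az x' by auto
      moreover have "continuous_on {a..T} (\<lambda>s. (s, x'))" by (intro continuous_intros)
      ultimately show ?thesis using continuous_on_compose2[OF r, of "{a..T}" "\<lambda>s. (s, x')"] by simp
    qed
    have cl: "closure {a<..<T} = {a..T}" using aT by simp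
    have "0 \<le> r a x' - y a"
    proof (rule continuous_ge_on_closure[of "{a<..<T}" "\<lambda>s. r s x' - y s"])
      show "continuous_on (closure {a<..<T}) (\<lambda>s. r s x' - y s)"
        unfolding cl using az by (intro continuous_on_diff rc continuous_on_subset[OF yc]) auto
      show "a \<in> closure {a<..<T}" unfolding cl using aT by simp
      show "0 \<le> r s x' - y s" if "s \<in> {a<..<T}" for s using above[of s x'] that x' by simp
    qed
    then show ?thesis by simp
  qed
  have eq: "r a z = y a" using ge[OF az(2)] az(3) by simp
  obtain D where D: "((\<lambda>s. r s z) has_real_derivative D) (at a within {a..T})" "D < y' a"
    using key[of a z] az aT eq ge by auto
  have "((\<lambda>s. r s z - y s) has_real_derivative D - y' a) (at a within {a..T})"
    by (rule DERIV_diff[OF D(1) DERIV_subset[OF y[OF az(1)]]]) (use az in auto)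
  from has_real_derivative_neg_dec_right[OF this] D(2)
  obtain d where d: "0 < d" "\<And>h. 0 < h \<Longrightarrow> a + h \<in> {a..T} \<Longrightarrow> h < d \<Longrightarrow> r (a + h) z - y (a + h) < r a z - y a" by auto
  define h where "h = min (d / 2) (T - a)"
  have h: "0 < h" "h < d" "a + h \<le> T" using d(1) aT by (auto simp: h_def)
  have "r (a + h) z - y (a + h) < r a z - y a" by (rule d(2)) (use h in auto)
  moreover have "y (a + h) < r (a + h) z" by (rule above) (use h az in auto)
  ultimately show False using eq by simp
qed


lemma periodic_axis_nat:
  assumes "periodic f"
  shows "f (x + axis i (real n)) = f x"
proof (induction n)
  case (Suc n)
  have "x + axis i (real (Suc n)) = (x + axis i (real n)) + axis i 1" by (simp add: vec_eq_iff axis_def)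
  then show ?case using assms Suc unfolding periodic_def by metis
next
  case 0
  have "x + axis i (real 0) = x" by (simp add: vec_eq_iff axis_def)
  then show ?case by metis
qed

lemma periodic_axis_int:
  assumes "periodic f"
  shows "f (x + axis i (of_int n)) = f x"
proof (cases "n \<ge> 0")
  case True
  then show ?thesis using periodic_axis_nat[OF assms, of x i "nat n"] by simp
next
  case False
  have "(x + axis i (of_int n)) + axis i (real (nat (- n))) = x"
    using False by (simp add: vec_eq_iff axis_def)
  then show ?thesis using periodic_axis_nat[OF assms, of "x + axis i (of_int n)" i "nat (- n)"] by metis
qed

lemma periodic_frac:
  assumes "periodic f"
  shows "f (\<chi> i. frac (x $ i)) = f x"
proof -
  let ?z = "\<chi> i. frac (x $ i)"
  have "x = ((?z + axis 1 (of_int \<lfloor>x $ 1\<rfloor>)) + axis 2 (of_int \<lfloor>x $ 2\<rfloor>)) + axis 3 (of_int \<lfloor>x $ 3\<rfloor>)"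
    by (simp add: vec_eq_iff axis_def forall_3 frac_def)
  then show ?thesis using periodic_axis_int[OF assms] by metis
qed

lemma frac_in_cbox: "(\<chi> i. frac (x $ i)) \<in> cbox 0 (\<chi> i. 1 :: real^3)"
  by (simp add: mem_box_cart frac_lt_1 less_imp_le)

lemma continuous_sup_in_time:
  fixes r :: "real \<Rightarrow> real"
  assumes "\<And>t e. t \<in> {0..T} \<Longrightarrow> 0 < e \<Longrightarrow> \<exists>d>0. \<forall>s\<in>{0..T}. dist s t < d \<longrightarrow> \<bar>r s - r t\<bar> \<le> e"
  shows "continuous_on {0..T} r"
  unfolding continuous_on_iff
proof (intro ballI allI impI)
  fix t e :: real assume t: "t \<in> {0..T}" and e: "0 < e"
  have "0 < e / 2" using e by simp
  from assms[OF t this] obtain d where d: "d > 0" "\<And>s. s \<in> {0..T} \<Longrightarrow> dist s t < d \<Longrightarrow> \<bar>r s - r t\<bar> \<le> e / 2" by blast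
  have "dist (r s) (r t) < e" if "s \<in> {0..T}" "dist s t < d" for s
    using d(2)[OF that] e unfolding dist_real_def by linarith
  then show "\<exists>d>0. \<forall>s\<in>{0..T}. dist s t < d \<longrightarrow> dist (r s) (r t) < e" using d(1) by blast
qed

text \<open>The data that the estimate uses: the continuity equation, the regularity of the velocity, and
  nonnegative continuous representatives \<open>R t\<close> of the densities that are Hoelder continuous in space
  uniformly in time and continuous in time in the supremum norm.\<close>

locale transport =
  fixes T :: real and \<rho> :: "real \<Rightarrow> real^3 \<Rightarrow> real" and u :: "real \<Rightarrow> real^3 \<Rightarrow> real^3"
    and R :: "real \<Rightarrow> real^3 \<Rightarrow> real" and \<alpha> B :: real
  assumes T: "0 < T" and \<alpha>: "0 < \<alpha>" and ce: "continuity_eq T \<rho> u"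
    and uC: "u \<in> C_sobolev T 2 2"
    and \<rho>p: "\<And>t. t \<in> {0..T} \<Longrightarrow> periodic (\<rho> t)" and \<rho>i: "\<And>t. t \<in> {0..T} \<Longrightarrow> integrable torus (\<rho> t)"
    and Ro: "\<And>t. t \<in> {0..T} \<Longrightarrow> osc_bound \<alpha> B (R t)" and RB: "\<And>t x. t \<in> {0..T} \<Longrightarrow> \<bar>R t x\<bar> \<le> B"
    and R\<rho>: "\<And>t. t \<in> {0..T} \<Longrightarrow> AE x in torus. R t x = \<rho> t x"
    and Rcont: "\<And>t e. t \<in> {0..T} \<Longrightarrow> 0 < e \<Longrightarrow> \<exists>d>0. \<forall>s\<in>{0..T}. dist s t < d \<longrightarrow> (\<forall>x. \<bar>R s x - R t x\<bar> \<le> e)"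
    and R0: "\<And>t x. t \<in> {0..T} \<Longrightarrow> 0 \<le> R t x"
begin

definition U :: "real \<Rightarrow> 3 \<Rightarrow> real^3 \<Rightarrow> real" where
  "U t j x = u t x $ j"

lemma U: "t \<in> {0..T} \<Longrightarrow> periodic (U t j)" "t \<in> {0..T} \<Longrightarrow> integrable torus (U t j)"
  using C_sobolev_L1(1,2)[OF uC] by (simp_all add: U_def[abs_def])

lemma U_L1: "t \<in> {0..T} \<Longrightarrow> 0 < e \<Longrightarrow>
    \<exists>d>0. \<forall>s\<in>{0..T}. dist s t < d \<longrightarrow> (\<forall>j. (\<integral>x. \<bar>U s j x - U t j x\<bar> \<partial>torus) \<le> e)"
  using C_sobolev_L1(3)[OF uC] by (simp add: U_def)

lemma R: "t \<in> {0..T} \<Longrightarrow> continuous_on UNIV (R t)" "t \<in> {0..T} \<Longrightarrow> periodic (R t)" "t \<in> {0..T} \<Longrightarrow> integrable torus (R t)"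
  using osc_bound_continuous[OF Ro \<alpha>] continuous_integrable_torus Ro by (auto simp: osc_bound_def)

lemma B0: "0 \<le> B"
  using RB[of 0 0] R0[of 0 0] T by auto

lemma RU:
  assumes t: "t \<in> {0..T}"
  shows "periodic (\<lambda>x. R t x * U t j x)" "integrable torus (\<lambda>x. R t x * U t j x)"
    "integrable torus (\<lambda>x. \<rho> t x * U t j x)" "periodic (\<lambda>x. \<rho> t x * U t j x)"
proof -
  show "periodic (\<lambda>x. R t x * U t j x)" "periodic (\<lambda>x. \<rho> t x * U t j x)"
    using R(2)[OF t] U(1)[OF t] \<rho>p[OF t] by (simp_all add: periodic_def)
  show i: "integrable torus (\<lambda>x. R t x * U t j x)"
  proof (rule Bochner_Integration.integrable_bound)
    show "integrable torus (\<lambda>x. B * U t j x)" using U(2)[OF t] by simp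
    show "AE x in torus. norm (R t x * U t j x) \<le> norm (B * U t j x)"
      using RB[OF t] B0 by (auto simp: abs_mult intro!: mult_right_mono AE_I2)
  qed (use R(3)[OF t] U(2)[OF t] in \<open>auto intro!: borel_measurable_times\<close>)
  show "integrable torus (\<lambda>x. \<rho> t x * U t j x)"
    by (rule integrable_cong_AE_imp[OF i])
      (use \<rho>i[OF t] U(2)[OF t] R\<rho>[OF t] in \<open>auto intro!: borel_measurable_times elim!: eventually_mono\<close>)
qed

text \<open>The product of a bounded, uniformly continuous factor with one that is continuous in \<open>L\<^sup>1\<close>.\<close>

lemma RU_L1:
  assumes t: "t \<in> {0..T}" and e: "0 < e"
  shows "\<exists>d>0. \<forall>s\<in>{0..T}. dist s t < d \<longrightarrow> (\<integral>x. \<bar>R s x * U s j x - R t x * U t j x\<bar> \<partial>torus) \<le> e"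
proof -
  define N where "N = (\<integral>x. \<bar>U t j x\<bar> \<partial>torus)"
  have N: "0 \<le> N" unfolding N_def by (rule integral_nonneg_AE) simp
  define e1 where "e1 = e / (2 * (B + 1))"
  define e2 where "e2 = e / (2 * (N + 1))"
  have e12: "0 < e1" "0 < e2" "B * e1 \<le> e / 2" "e2 * N \<le> e / 2"
  proof -
    show "0 < e1" "0 < e2" using e B0 N by (auto simp: e1_def e2_def)
    have "B * e1 = (e / 2) * (B / (B + 1))" using B0 by (simp add: e1_def field_simps)
    also have "\<dots> \<le> (e / 2) * 1" using B0 e by (intro mult_left_mono) auto
    finally show "B * e1 \<le> e / 2" by simp
    have "e2 * N = (e / 2) * (N / (N + 1))" using N by (simp add: e2_def field_simps)
    also have "\<dots> \<le> (e / 2) * 1" using N e by (intro mult_left_mono) auto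
    finally show "e2 * N \<le> e / 2" by simp
  qed
  obtain d1 where d1: "d1 > 0" "\<And>s. s \<in> {0..T} \<Longrightarrow> dist s t < d1 \<Longrightarrow> (\<integral>x. \<bar>U s j x - U t j x\<bar> \<partial>torus) \<le> e1"
    using U_L1[OF t e12(1)] by blast
  obtain d2 where d2: "d2 > 0" "\<And>s x. s \<in> {0..T} \<Longrightarrow> dist s t < d2 \<Longrightarrow> \<bar>R s x - R t x\<bar> \<le> e2"
    using Rcont[OF t e12(2)] by blast
  have "(\<integral>x. \<bar>R s x * U s j x - R t x * U t j x\<bar> \<partial>torus) \<le> e" if s: "s \<in> {0..T}" "dist s t < min d1 d2" for s
  proof -
    have iU: "integrable torus (\<lambda>x. U s j x - U t j x)" using U(2) s(1) t by simp
    have "(\<integral>x. \<bar>R s x * U s j x - R t x * U t j x\<bar> \<partial>torus) \<le> (\<integral>x. B * \<bar>U s j x - U t j x\<bar> + e2 * \<bar>U t j x\<bar> \<partial>torus)"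
    proof (rule integral_mono)
      show "integrable torus (\<lambda>x. \<bar>R s x * U s j x - R t x * U t j x\<bar>)" using RU(2) s(1) t by simp
      show "integrable torus (\<lambda>x. B * \<bar>U s j x - U t j x\<bar> + e2 * \<bar>U t j x\<bar>)" using iU U(2)[OF t] by simp
      fix x
      have "R s x * U s j x - R t x * U t j x = R s x * (U s j x - U t j x) + (R s x - R t x) * U t j x"
        by (simp add: algebra_simps)
      then have "\<bar>R s x * U s j x - R t x * U t j x\<bar> \<le> \<bar>R s x\<bar> * \<bar>U s j x - U t j x\<bar> + \<bar>R s x - R t x\<bar> * \<bar>U t j x\<bar>"
        by (metis abs_mult abs_triangle_ineq)
      also have "\<dots> \<le> B * \<bar>U s j x - U t j x\<bar> + e2 * \<bar>U t j x\<bar>"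
        using RB[OF s(1)] d2(2)[OF s(1)] s(2) by (intro add_mono mult_right_mono) auto
      finally show "\<bar>R s x * U s j x - R t x * U t j x\<bar> \<le> B * \<bar>U s j x - U t j x\<bar> + e2 * \<bar>U t j x\<bar>" .
    qed
    also have "\<dots> = B * (\<integral>x. \<bar>U s j x - U t j x\<bar> \<partial>torus) + e2 * N"
      using iU U(2)[OF t] by (simp add: N_def)
    also have "\<dots> \<le> B * e1 + e2 * N"
      using d1(2)[OF s(1)] s(2) B0 by (intro add_right_mono mult_left_mono) auto
    also have "\<dots> \<le> e" using e12 by simp
    finally show ?thesis .
  qed
  then show ?thesis using d1(1) d2(1) by (intro exI[of _ "min d1 d2"]) auto
qed

context
  fixes k :: nat
  assumes k: "k \<ge> 1"
begin

definition r :: "real \<Rightarrow> real^3 \<Rightarrow> real" where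
  "r t x = mol (R t) (eps k) x"

definition H :: "3 \<Rightarrow> real \<Rightarrow> real^3 \<Rightarrow> real" where
  "H j t x = (\<integral>y. (R t y * U t j y) * dkern (eps k) j x y \<partial>lebesgue)"

lemma r_time:
  assumes t: "t \<in> {0..T}" and e: "0 < e"
  shows "\<exists>d>0. \<forall>s\<in>{0..T}. dist s t < d \<longrightarrow> (\<forall>x. \<bar>r s x - r t x\<bar> \<le> e)"
proof -
  obtain d where d: "d > 0" "\<And>s x. s \<in> {0..T} \<Longrightarrow> dist s t < d \<Longrightarrow> \<bar>R s x - R t x\<bar> \<le> e"
    using Rcont[OF t e] by blast
  have "\<bar>r s x - r t x\<bar> \<le> e" if s: "s \<in> {0..T}" "dist s t < d" for s x
    unfolding r_def by (rule mol_diff_le[OF eps_pos eps_half R(2,3)[OF s(1)] R(2,3)[OF t] d(2)[OF s]])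
  then show ?thesis using d(1) by blast
qed

lemma r_cont: "continuous_on {0..T} (\<lambda>t. r t x)"
proof (rule continuous_sup_in_time)
  fix t e :: real assume "t \<in> {0..T}" "0 < e"
  from r_time[OF this] show "\<exists>d>0. \<forall>s\<in>{0..T}. dist s t < d \<longrightarrow> \<bar>r s x - r t x\<bar> \<le> e" by fast
qed

lemma r_osc: "t \<in> {0..T} \<Longrightarrow> osc_bound \<alpha> B (r t)"
  unfolding r_def[abs_def] by (rule osc_bound_mol[OF Ro \<alpha> eps_pos eps_half])

lemma r_joint: "continuous_on ({0..T} \<times> K) (\<lambda>p. r (fst p) (snd p))"
  unfolding continuous_on_iff
proof (intro ballI allI impI)
  fix p and e :: real assume p: "p \<in> {0..T} \<times> K" and e: "0 < e"
  have t: "fst p \<in> {0..T}" using p by auto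
  have e3: "0 < e / 3" using e by simp
  obtain d1 where d1: "d1 > 0" "\<And>s x. s \<in> {0..T} \<Longrightarrow> dist s (fst p) < d1 \<Longrightarrow> \<bar>r s x - r (fst p) x\<bar> \<le> e / 3"
    using r_time[OF t e3] by blast
  have "continuous_on UNIV (r (fst p))" by (rule osc_bound_continuous[OF r_osc[OF t] \<alpha>])
  from this[unfolded continuous_on_iff, rule_format, OF UNIV_I e3]
  obtain d2 where d2: "d2 > 0" "\<And>x. dist x (snd p) < d2 \<Longrightarrow> dist (r (fst p) x) (r (fst p) (snd p)) < e / 3" by blast
  have "dist (r (fst q) (snd q)) (r (fst p) (snd p)) < e" if q: "q \<in> {0..T} \<times> K" "dist q p < min d1 d2" for q
  proof -
    have "dist (fst q) (fst p) < d1" "dist (snd q) (snd p) < d2"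
      using q(2) dist_fst_le[of q p] dist_snd_le[of q p] by linarith+
    then have "\<bar>r (fst q) (snd q) - r (fst p) (snd q)\<bar> \<le> e / 3" "dist (r (fst p) (snd q)) (r (fst p) (snd p)) < e / 3"
      using d1(2) d2(2) q(1) by auto
    then show ?thesis using e unfolding dist_real_def by linarith
  qed
  then show "\<exists>d>0. \<forall>q\<in>{0..T} \<times> K. dist q p < d \<longrightarrow> dist (r (fst q) (snd q)) (r (fst p) (snd p)) < e"
    using d1(1) d2(1) by (intro exI[of _ "min d1 d2"]) auto
qed

lemma H_cont: "continuous_on {0..T} (\<lambda>t. H j t x)"
proof (rule continuous_sup_in_time)
  fix t e :: real assume t: "t \<in> {0..T}" and e: "0 < e"
  define e1 where "e1 = e / (dkern_bound (eps k) + 1)"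
  have e1: "0 < e1" using e dkern_bound_nonneg[of "eps k"] by (simp add: e1_def)
  have e1': "dkern_bound (eps k) * e1 \<le> e"
    using e dkern_bound_nonneg[of "eps k"] by (simp add: e1_def field_simps)
  obtain d where d: "d > 0" "\<And>s. s \<in> {0..T} \<Longrightarrow> dist s t < d \<Longrightarrow> (\<integral>x. \<bar>R s x * U s j x - R t x * U t j x\<bar> \<partial>torus) \<le> e1"
    using RU_L1[OF t e1] by blast
  have "\<bar>H j s x - H j t x\<bar> \<le> e" if s: "s \<in> {0..T}" "dist s t < d" for s
  proof -
    let ?D = "\<lambda>y. R s y * U s j y - R t y * U t j y"
    have D: "periodic ?D" "integrable torus ?D" using RU[OF s(1)] RU[OF t] by (simp_all add: periodic_def)
    note di = torus_integral_dkern[OF eps_pos eps_half]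
    have "H j s x - H j t x = (\<integral>y. ?D y * dkern (eps k) j x y \<partial>lebesgue)"
      unfolding H_def left_diff_distrib
      by (rule Bochner_Integration.integral_diff[symmetric, OF di(1)[OF RU(1,2)[OF s(1)]] di(1)[OF RU(1,2)[OF t]]])
    then have "\<bar>H j s x - H j t x\<bar> \<le> (\<integral>y. \<bar>?D y * dkern (eps k) j x y\<bar> \<partial>lebesgue)"
      by (simp only: integral_abs_bound)
    also have "\<dots> \<le> dkern_bound (eps k) * (\<integral>y. \<bar>?D y\<bar> \<partial>torus)" unfolding abs_mult by (rule di(3)[OF D])
    also have "\<dots> \<le> dkern_bound (eps k) * e1" using d(2)[OF s] dkern_bound_nonneg by (intro mult_left_mono)
    also have "\<dots> \<le> e" by (rule e1')
    finally show ?thesis .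
  qed
  then show "\<exists>d>0. \<forall>s\<in>{0..T}. dist s t < d \<longrightarrow> \<bar>H j s x - H j t x\<bar> \<le> e" using d(1) by blast
qed

text \<open>The averages of the density solve an ordinary differential equation in time, for every fixed
  centre, whose right-hand side is the flux against the gradient of the kernel.\<close>

lemma r_integral:
  assumes t: "t \<in> {0..T}"
  shows "r t x = r 0 x + integral {0..t} (\<lambda>s. \<Sum>j\<in>UNIV. H j s x)"
proof (rule du_bois_reymond[OF T r_cont _ _ t])
  show hc: "continuous_on {0..T} (\<lambda>s. \<Sum>j\<in>UNIV. H j s x)" by (intro continuous_on_sum H_cont)
  fix \<psi> l rr
  assume \<psi>: "smooth \<psi>" "0 < l" "rr < T" "\<And>s. s \<notin> {l<..<rr} \<Longrightarrow> \<psi> s = 0"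
  let ?b = "\<lambda>i. kern (eps k) (x $ i)"
  have sb: "supp_at (corner x) ?b" by (rule supp_kern[OF eps_pos eps_half])
  have g: "(\<integral>y. \<rho> s y * tens ?b y \<partial>lebesgue) = r s x" if s: "s \<in> {0..T}" for s
    unfolding r_def mol_def
    by (rule tens_integral_AE_eq[OF \<rho>p[OF s] \<rho>i[OF s] R(2,3)[OF s] _ sb]) (use R\<rho>[OF s] in \<open>auto elim!: eventually_mono\<close>)
  have h: "(\<integral>y. (\<rho> s y * u s y $ j) * tens (?b(j := deriv (?b j))) y \<partial>lebesgue) = H j s x" if s: "s \<in> {0..T}" for s j
    unfolding H_def dkern_def U_def[symmetric]
    by (rule tens_integral_AE_eq[OF RU(4,3,1,2)[OF s] _ supp_at_deriv[OF sb]])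
      (use R\<rho>[OF s] in \<open>auto elim!: eventually_mono\<close>)
  have "integral {0..T} (\<lambda>t. deriv \<psi> t * (\<integral>y. \<rho> t y * tens ?b y \<partial>lebesgue))
    = - integral {0..T} (\<lambda>t. \<psi> t * (\<Sum>j\<in>UNIV. \<integral>y. (\<rho> t y * u t y $ j) * tens (?b(j := deriv (?b j))) y \<partial>lebesgue))"
  proof (rule continuity_weak[OF ce sb \<psi>])
    show "continuous_on {0..T} (\<lambda>t. \<integral>y. \<rho> t y * tens ?b y \<partial>lebesgue)"
      using r_cont[of x] by (rule continuous_on_eq) (simp add: g)
    show "continuous_on {0..T} (\<lambda>t. \<integral>y. (\<rho> t y * u t y $ j) * tens (?b(j := deriv (?b j))) y \<partial>lebesgue)" for j
      using H_cont[of j x] by (rule continuous_on_eq) (simp only: h)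
  qed (use RU \<rho>p \<rho>i in \<open>auto simp: U_def\<close>)
  moreover have "integral {0..T} (\<lambda>t. deriv \<psi> t * (\<integral>y. \<rho> t y * tens ?b y \<partial>lebesgue)) = integral {0..T} (\<lambda>t. deriv \<psi> t * r t x)"
    by (rule integral_cong) (simp add: g)
  moreover have "integral {0..T} (\<lambda>t. \<psi> t * (\<Sum>j\<in>UNIV. \<integral>y. (\<rho> t y * u t y $ j) * tens (?b(j := deriv (?b j))) y \<partial>lebesgue))
      = integral {0..T} (\<lambda>t. \<psi> t * (\<Sum>j\<in>UNIV. H j t x))"
    by (rule integral_cong) (simp only: h)
  ultimately show "integral {0..T} (\<lambda>t. deriv \<psi> t * r t x) = - integral {0..T} (\<lambda>t. \<psi> t * (\<Sum>j\<in>UNIV. H j t x))"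
    by simp
qed

lemma r_derivative:
  assumes t: "0 \<le> t" "t < T"
  shows "((\<lambda>s. r s x) has_real_derivative (\<Sum>j\<in>UNIV. H j t x)) (at t within {t..T})"
proof -
  have hc: "continuous_on {0..T} (\<lambda>s. \<Sum>j\<in>UNIV. H j s x)" by (intro continuous_on_sum H_cont)
  have "((\<lambda>s. integral {0..s} (\<lambda>s. \<Sum>j\<in>UNIV. H j s x)) has_real_derivative (\<Sum>j\<in>UNIV. H j t x)) (at t within {0..T})"
    by (rule integral_has_real_derivative[OF hc]) (use t in auto)
  then have "((\<lambda>s. r 0 x + integral {0..s} (\<lambda>s. \<Sum>j\<in>UNIV. H j s x)) has_real_derivative (\<Sum>j\<in>UNIV. H j t x)) (at t within {0..T})"
    by (auto intro!: derivative_eq_intros)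
  then have "((\<lambda>s. r 0 x + integral {0..s} (\<lambda>s. \<Sum>j\<in>UNIV. H j s x)) has_real_derivative (\<Sum>j\<in>UNIV. H j t x)) (at t within {t..T})"
    by (rule DERIV_subset) (use t in auto)
  then show ?thesis
    by (rule has_field_derivative_transform_within[OF _ zero_less_one])
      (use t in \<open>auto intro: r_integral[symmetric]\<close>)
qed

text \<open>Continuous in time at every fixed scale, so that its time integral is differentiable and can serve
  as the exponent of the comparison function.\<close>

definition sup_defect :: "real \<Rightarrow> real" where
  "sup_defect t = (SUP x. defect (eps k) (U t) x)"

lemma defect_const_nonneg: "0 \<le> defect_const (eps k)"
  using dkern_bound_nonneg bumpA_pos eps_pos[of k] by (simp add: defect_const_def)

lemma defect_bdd:
  assumes t: "t \<in> {0..T}"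
  shows "bdd_above (range (defect (eps k) (U t)))"
proof (rule bdd_aboveI2)
  fix x
  have "defect (eps k) (U t) x \<le> defect (eps k) (\<lambda>_ _. 0) x + defect_const (eps k) * (\<Sum>j\<in>UNIV. \<integral>y. \<bar>U t j y - 0\<bar> \<partial>torus)"
    by (rule defect_diff[OF eps_pos eps_half U[OF t] const_torus])
  also have "defect (eps k) (\<lambda>_ _. 0) x = 0" by (simp add: defect_def mol_const eps_pos)
  finally show "defect (eps k) (U t) x \<le> defect_const (eps k) * (\<Sum>j\<in>UNIV. \<integral>y. \<bar>U t j y - 0\<bar> \<partial>torus)" by simp
qed

lemma defect_le_sup: "t \<in> {0..T} \<Longrightarrow> defect (eps k) (U t) x \<le> sup_defect t"
  unfolding sup_defect_def by (rule cSUP_upper[OF _ defect_bdd]) auto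

lemma sup_defect_cont: "continuous_on {0..T} sup_defect"
proof (rule continuous_sup_in_time)
  fix t e :: real assume t: "t \<in> {0..T}" and e: "0 < e"
  define e1 where "e1 = e / (3 * (defect_const (eps k) + 1))"
  have e1: "0 < e1" using e defect_const_nonneg by (simp add: e1_def)
  have e1': "defect_const (eps k) * (3 * e1) \<le> e" using e defect_const_nonneg by (simp add: e1_def field_simps)
  obtain d where d: "d > 0" "\<And>s j. s \<in> {0..T} \<Longrightarrow> dist s t < d \<Longrightarrow> (\<integral>x. \<bar>U s j x - U t j x\<bar> \<partial>torus) \<le> e1"
    using U_L1[OF t e1] by blast
  have step: "sup_defect s' \<le> sup_defect t' + e" if s': "s' \<in> {0..T}" and t': "t' \<in> {0..T}"
    and le: "\<And>j. (\<integral>x. \<bar>U s' j x - U t' j x\<bar> \<partial>torus) \<le> e1" for s' t'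
    unfolding sup_defect_def[of s']
  proof (rule cSUP_least)
    fix x
    have "(\<Sum>j\<in>UNIV. \<integral>y. \<bar>U s' j y - U t' j y\<bar> \<partial>torus) \<le> (\<Sum>j\<in>(UNIV::3 set). e1)"
      by (rule sum_mono) (rule le)
    then have "(\<Sum>j\<in>UNIV. \<integral>y. \<bar>U s' j y - U t' j y\<bar> \<partial>torus) \<le> 3 * e1" by simp
    then have "defect_const (eps k) * (\<Sum>j\<in>UNIV. \<integral>y. \<bar>U s' j y - U t' j y\<bar> \<partial>torus) \<le> e"
      using mult_left_mono[OF _ defect_const_nonneg] e1' order_trans by blast
    moreover have "defect (eps k) (U s') x \<le> defect (eps k) (U t') x
        + defect_const (eps k) * (\<Sum>j\<in>UNIV. \<integral>y. \<bar>U s' j y - U t' j y\<bar> \<partial>torus)"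
      by (rule defect_diff[OF eps_pos eps_half U[OF s'] U[OF t']])
    ultimately show "defect (eps k) (U s') x \<le> sup_defect t' + e" using defect_le_sup[OF t', of x] by linarith
  qed simp
  have "\<bar>sup_defect s - sup_defect t\<bar> \<le> e" if s: "s \<in> {0..T}" "dist s t < d" for s
  proof -
    have "(\<integral>x. \<bar>U t j x - U s j x\<bar> \<partial>torus) \<le> e1" for j using d(2)[OF s, of j] by (simp add: abs_minus_commute)
    then show ?thesis using step[OF s(1) t d(2)[OF s]] step[OF t s(1)] by (simp add: abs_le_iff)
  qed
  then show "\<exists>d>0. \<forall>s\<in>{0..T}. dist s t < d \<longrightarrow> \<bar>sup_defect s - sup_defect t\<bar> \<le> e" using d(1) by blast
qed

text \<open>The comparison function is \<open>c exp (- \<integral>\<^bsub>t\<^esub>\<^bsup>T\<^esup> P) - \<delta>\<close> with \<open>P\<close> the largest defect plus one. Adding one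
  makes the differential inequality at a contact point strict. There \<open>R \<le> r + \<delta>\<close> on the cube, and
  \<open>r + \<delta>\<close> equals the exponential term.\<close>

lemma lower_bound:
  assumes c: "0 < c" "\<And>x. c \<le> R T x"
  shows "c * exp (- integral {0..T} (\<lambda>t. sup_defect t + 1)) - (2 * B + 1) * eps k powr \<alpha> < r 0 x"
proof -
  define \<delta> where "\<delta> = (2 * B + 1) * eps k powr \<alpha>"
  have e: "0 < eps k powr \<alpha>" using eps_pos[of k] by simp
  have \<delta>: "0 < \<delta>" "2 * (B * eps k powr \<alpha>) \<le> \<delta>"
    unfolding \<delta>_def using B0 e by (intro mult_pos_pos, simp, simp, simp add: distrib_right)
  define P where "P t = sup_defect t + 1" for t
  have Pc: "continuous_on {0..T} P" unfolding P_def by (intro continuous_intros sup_defect_cont)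
  define Y where "Y t = c * exp (- integral {t..T} P)" for t
  have Ypos: "0 < Y t" for t using c by (simp add: Y_def)
  define K where "K = cbox 0 (\<chi> i. 1 :: real^3)"
  have "Y 0 - \<delta> < r 0 x'" if "x' \<in> K" for x'
  proof (rule barrier[where r = r and y = "\<lambda>t. Y t - \<delta>" and y' = "\<lambda>t. Y t * P t" and K = K and T = T])
    show "compact K" by (simp add: K_def)
    show "continuous_on ({0..T} \<times> K) (\<lambda>p. r (fst p) (snd p))" by (rule r_joint)
    show "((\<lambda>t. Y t - \<delta>) has_real_derivative Y t * P t) (at t within {0..T})" if "t \<in> {0..T}" for t
    proof -
      have "((\<lambda>t. integral {t..T} P) has_real_derivative - P t) (at t within {0..T})"
        by (rule integral_has_real_derivative'[OF Pc that])
      then show ?thesis unfolding Y_def by (auto intro!: derivative_eq_intros)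
    qed
    show "Y T - \<delta> < r T x" for x
    proof -
      have TT: "T \<in> {0..T}" using T by simp
      have "mol (\<lambda>_. c) (eps k) x \<le> mol (R T) (eps k) x"
        unfolding mol_def by (rule mol_mono_AE[OF const_torus R(2,3)[OF TT] _ adm3_kern[OF eps_pos] eps_half]) (use c in simp)
      then have "c \<le> r T x" by (simp add: mol_const eps_pos r_def)
      then show ?thesis using \<delta> by (simp add: Y_def)
    qed
    show "\<exists>D. ((\<lambda>s. r s x) has_real_derivative D) (at t within {t..T}) \<and> D < Y t * P t"
      if t: "0 \<le> t" "t < T" and x: "x \<in> K" and eq: "r t x = Y t - \<delta>" and min: "\<And>x'. x' \<in> K \<Longrightarrow> r t x \<le> r t x'" for t x
    proof -
      have tT: "t \<in> {0..T}" using t by simp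
      have rp: "periodic (r t)" using r_osc[OF tT] by (simp add: osc_bound_def)
      have min': "mol (R t) (eps k) x \<le> mol (R t) (eps k) x'" for x'
        using min[of "\<chi> i. frac (x' $ i)"] frac_in_cbox[of x'] periodic_frac[OF rp, of x'] by (simp add: K_def r_def)
      have osc: "\<bar>R t y - R t x\<bar> \<le> B * eps k powr \<alpha>" if "y \<in> cube x (eps k)" for y
        using Ro[OF tT] k that unfolding osc_bound_def by blast
      have cl: "\<bar>r t x - R t x\<bar> \<le> B * eps k powr \<alpha>"
        unfolding r_def by (rule mol_continuous_close[OF R(1,2)[OF tT] eps_pos eps_half osc])
      have up: "R t y \<le> Y t" if "y \<in> cube x (eps k)" for y
        using osc[OF that] cl \<delta>(2) eq by linarith
      have "(\<Sum>j\<in>UNIV. H j t x) \<le> Y t * defect (eps k) (U t) x"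
        unfolding H_def
        by (rule flux_bound[OF eps_pos eps_half U[OF tT] R(2,3)[OF tT] RU(2)[OF tT] R0[OF tT] up
              mol_critical[OF eps_pos eps_le R(2,3)[OF tT] min']])
      also have "\<dots> \<le> Y t * sup_defect t" using defect_le_sup[OF tT] Ypos[of t] by (intro mult_left_mono) auto
      also have "\<dots> < Y t * P t" using Ypos[of t] by (simp add: P_def)
      finally show ?thesis using r_derivative[OF t] by blast
    qed
    show "0 \<in> {0..T}" using T by simp
  qed (rule that)
  then have "Y 0 - \<delta> < r 0 (\<chi> i. frac (x $ i))" using frac_in_cbox by (simp add: K_def)
  moreover have "periodic (r 0)" using r_osc[of 0] T by (simp add: osc_bound_def)
  ultimately show ?thesis using periodic_frac[of "r 0" x] by (simp add: Y_def P_def[abs_def] \<delta>_def)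
qed

end

text \<open>The Sobolev norm of \<open>u(t)\<close> need not be a measurable function of time, and an integral of such a
  function is a supremum over simple functions below it. A continuous function is therefore placed
  below its square: the defect is at most \<open>C (s + 1)\<close> with \<open>s\<close> the norm, and \<open>s - 1 \<le> s\<^sup>2\<close>.\<close>

lemma sup_defect_integral_bound:
  assumes q: "3 < q" and u: "u \<in> L2_sobolev T 2 q"
  obtains KK where "\<And>k. k \<ge> 1 \<Longrightarrow> integral {0..T} (\<lambda>t. sup_defect k t + 1) \<le> KK"
proof -
  define C where "C = 48 * bumpA\<^sup>2 * bumpA1 * lip_const q"
  have C: "0 < C"
  proof -
    have "0 < 1 - 3 / q" using q by simp
    then have "0 < rep_const q" using sup_const_pos by (simp add: rep_const_def)
    moreover have "0 < sup_const 1" by (rule sup_const_pos) simp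
    ultimately show ?thesis using bumpA_pos bumpA1(1) by (simp add: C_def lip_const_def)
  qed
  define K0 where "K0 = (\<integral>\<^sup>+t. (sobolev_norm 2 q (u t))\<^sup>2 \<partial>lebesgue_on {0..T})"
  have K0: "K0 < \<infinity>" using u unfolding K0_def L2_sobolev_def by blast
  have "integral {0..T} (\<lambda>t. sup_defect k t + 1) \<le> (2 * C + 1) * T + C * enn2real K0" if k: "k \<ge> 1" for k
  proof -
    define w where "w t = max 0 ((sup_defect k t - 2 * C) / C)" for t
    have wc: "continuous_on {0..T} w" unfolding w_def by (intro continuous_intros sup_defect_cont[OF k]) (use C in auto)
    have "AE t in lebesgue_on {0..T}. u t \<in> sobolev 2 q" using u unfolding L2_sobolev_def by blast
    then have "AE t in lebesgue_on {0..T}. ennreal (w t) \<le> (sobolev_norm 2 q (u t))\<^sup>2"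
      using AE_space
    proof eventually_elim
      case (elim t)
      have t: "t \<in> {0..T}" using elim(2) by simp
      show ?case
      proof (cases "sobolev_norm 2 q (u t) = \<infinity>")
        case True
        then show ?thesis by (simp add: power2_eq_square ennreal_mult_top)
      next
        case False
        define s where "s = enn2real (sobolev_norm 2 q (u t))"
        have s0: "0 \<le> s" by (simp add: s_def)
        have S: "sobolev_norm 2 q (u t) = ennreal s" using False by (simp add: s_def less_top)
        have N: "sobolev_norm 2 q (u t) \<le> ennreal (s + 1)" "0 < s + 1" using S s0 by (auto intro: ennreal_leI)
        have "\<exists>F. osc_bound 1 (lip_const q * (s + 1)) F \<and> (AE x in torus. F x = U t j x)" for j
          using sobolev_2_lipschitz[OF q elim(1) N, of j] unfolding U_def by blast
        then have "\<forall>j. \<exists>F. osc_bound 1 (lip_const q * (s + 1)) F \<and> (AE x in torus. F x = U t j x)" by blast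
        from choice[OF this] obtain F where F: "\<forall>j. osc_bound 1 (lip_const q * (s + 1)) (F j) \<and> (AE x in torus. F j x = U t j x)"
          by (elim exE)
        have F': "osc_bound 1 (lip_const q * (s + 1)) (F j)" "AE x in torus. F j x = U t j x" for j using F by simp_all
        have "defect (eps k) (U t) x \<le> 48 * bumpA\<^sup>2 * bumpA1 * (lip_const q * (s + 1))" for x
          by (rule defect_lip[OF U[OF t] F' k])
        then have "defect (eps k) (U t) x \<le> C * (s + 1)" for x by (simp add: C_def mult.assoc)
        then have "sup_defect k t \<le> C * (s + 1)" unfolding sup_defect_def[OF k] by (intro cSUP_least) auto
        then have "(sup_defect k t - 2 * C) / C \<le> s - 1" using C by (simp add: field_simps)
        also have "s - 1 \<le> s\<^sup>2" using zero_le_power2[of "s - 1"] s0 by (simp add: power2_eq_square algebra_simps)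
        finally have "w t \<le> s\<^sup>2" by (simp add: w_def)
        then show ?thesis unfolding S using s0 by (simp add: ennreal_power ennreal_leI)
      qed
    qed
    then have nn: "(\<integral>\<^sup>+t. ennreal (w t) \<partial>lebesgue_on {0..T}) \<le> K0"
      unfolding K0_def by (rule nn_integral_mono_AE)
    have wi: "integrable (lebesgue_on {0..T}) w" by (rule continuous_imp_integrable_real[OF wc])
    have "ennreal (integral\<^sup>L (lebesgue_on {0..T}) w) \<le> K0"
      using nn nn_integral_eq_integral[OF wi] by (simp add: w_def)
    then have "integral\<^sup>L (lebesgue_on {0..T}) w \<le> enn2real K0"
      using K0 by (metis enn2real_mono enn2real_ennreal integral_nonneg_AE AE_I2 w_def max.cobounded1 infinity_ennreal_def)
    then have iw: "integral {0..T} w \<le> enn2real K0"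
      using lebesgue_integral_eq_integral[OF wi] by simp
    have "integral {0..T} (\<lambda>t. sup_defect k t + 1) \<le> integral {0..T} (\<lambda>t. (2 * C + 1) + C * w t)"
    proof (rule integral_le)
      show "(\<lambda>t. sup_defect k t + 1) integrable_on {0..T}" "(\<lambda>t. (2 * C + 1) + C * w t) integrable_on {0..T}"
        by (intro integrable_continuous_interval continuous_intros sup_defect_cont[OF k] wc)+
      show "sup_defect k t + 1 \<le> (2 * C + 1) + C * w t" for t
      proof -
        have "sup_defect k t - 2 * C = C * ((sup_defect k t - 2 * C) / C)" using C by simp
        also have "\<dots> \<le> C * w t" using C by (intro mult_left_mono) (auto simp: w_def)
        finally show ?thesis by simp
      qed
    qed
    also have "\<dots> = integral {0..T} (\<lambda>t. 2 * C + 1) + integral {0..T} (\<lambda>t. C * w t)"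
      by (intro integral_add integrable_continuous_interval continuous_intros wc)
    also have "\<dots> = (2 * C + 1) * T + C * integral {0..T} w" using T by simp
    also have "\<dots> \<le> (2 * C + 1) * T + C * enn2real K0" using iw C by simp
    finally show ?thesis .
  qed
  then show thesis using that by blast
qed

text \<open>The exponents are bounded uniformly in the scale, the correction \<open>\<delta>\<close> tends to zero with the scale, and
  the averages tend to the density.\<close>

lemma initial_lower_bound:
  assumes q: "3 < q" and u: "u \<in> L2_sobolev T 2 q" and c: "0 < c" "\<And>x. c \<le> R T x"
  obtains c' where "0 < c'" "\<And>x. c' \<le> R 0 x"
proof -
  obtain KK where KK: "\<And>k. k \<ge> 1 \<Longrightarrow> integral {0..T} (\<lambda>t. sup_defect k t + 1) \<le> KK" using sup_defect_integral_bound[OF q u] by blast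
  have z: "0 \<in> {0..T}" using T by simp
  have "c * exp (- KK) \<le> R 0 x" for x
  proof (rule LIMSEQ_le)
    show "(\<lambda>k. mol (R 0) (eps (Suc k)) x) \<longlonglongrightarrow> R 0 x"
      using LIMSEQ_Suc[OF mol_lim[OF R(1,2)[OF z]]] .
    have "(\<lambda>k. eps k powr \<alpha>) \<longlonglongrightarrow> 0"
    proof (intro tendsto_zero_powrI)
      show "(\<lambda>k. \<alpha>) \<longlonglongrightarrow> \<alpha>" by simp
      show "\<forall>\<^sub>F k in sequentially. 0 \<le> eps k" using eps_pos less_imp_le by (intro always_eventually) blast
    qed (use eps_lim \<alpha> in auto)
    from tendsto_diff[OF tendsto_const tendsto_mult_left[OF LIMSEQ_Suc[OF this]]]
    show "(\<lambda>k. c * exp (- KK) - (2 * B + 1) * eps (Suc k) powr \<alpha>) \<longlonglongrightarrow> c * exp (- KK)" by fastforce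
    have "c * exp (- KK) - (2 * B + 1) * eps (Suc k) powr \<alpha> \<le> mol (R 0) (eps (Suc k)) x" for k
    proof -
      have "c * exp (- KK) \<le> c * exp (- integral {0..T} (\<lambda>t. sup_defect (Suc k) t + 1))"
        using KK[of "Suc k"] c by simp
      moreover have "c * exp (- integral {0..T} (\<lambda>t. sup_defect (Suc k) t + 1)) - (2 * B + 1) * eps (Suc k) powr \<alpha> < r (Suc k) 0 x"
        by (rule lower_bound[OF _ c]) simp
      moreover have "r (Suc k) 0 x = mol (R 0) (eps (Suc k)) x" by (simp add: r_def)
      ultimately show ?thesis by linarith
    qed
    then show "\<exists>N. \<forall>n\<ge>N. c * exp (- KK) - (2 * B + 1) * eps (Suc n) powr \<alpha> \<le> mol (R 0) (eps (Suc n)) x" by blast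
  qed
  then show thesis using that[of "c * exp (- KK)"] c by simp
qed

end


text \<open>The regularity of a strong solution provides the representatives that the transport estimate needs.\<close>

lemma positivity_backward:
  assumes T: "0 < T" and sol: "strong_solution \<mu> lam \<gamma> \<rho>\<^sub>0 u\<^sub>0 T \<rho> u"
  obtains F0 FT where "continuous_on UNIV F0" "periodic F0" "AE x in torus. F0 x = \<rho>\<^sub>0 x" "AE x in torus. F0 x = \<rho> 0 x"
    "continuous_on UNIV FT" "periodic FT" "AE x in torus. FT x = \<rho> T x" "\<And>x. 0 \<le> FT x"
    "\<And>c. 0 < c \<Longrightarrow> (\<And>x. c \<le> FT x) \<Longrightarrow> \<exists>c'>0. \<forall>x. c' \<le> F0 x"
proof -
  have ce: "continuity_eq T \<rho> u"
    using sol unfolding strong_solution_def by (elim conjE)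
  have init: "AE x in torus. \<rho> 0 x = \<rho>\<^sub>0 x \<and> \<rho> 0 x *\<^sub>R u 0 x = \<rho>\<^sub>0 x *\<^sub>R u\<^sub>0 x"
    using sol unfolding strong_solution_def by (elim conjE)
  obtain q where q: "3 < q" and pos': "\<forall>t\<in>{0..T}. AE x in torus. 0 \<le> \<rho> t x"
    and \<rho>C: "\<rho> \<in> C_sobolev T 1 q" and uC: "u \<in> C_sobolev T 2 2" and uL: "u \<in> L2_sobolev T 2 q"
    using sol unfolding strong_solution_def by (elim conjE exE) (rule that; assumption)
  have pos: "AE x in torus. 0 \<le> \<rho> t x" if "t \<in> {0..T}" for t using pos' that by (rule bspec)
  have \<alpha>: "0 < 1 - 3 / q" using q by simp
  show thesis
  proof (rule C_sobolev_rep[OF q \<rho>C])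
    fix B R
    assume reps: "\<And>t. t \<in> {0..T} \<Longrightarrow> osc_bound (1 - 3 / q) B (R t)"
      "\<And>t x. t \<in> {0..T} \<Longrightarrow> \<bar>R t x\<bar> \<le> B" "\<And>t. t \<in> {0..T} \<Longrightarrow> AE x in torus. R t x = \<rho> t x"
      "\<And>t e. t \<in> {0..T} \<Longrightarrow> 0 < e \<Longrightarrow> \<exists>d>0. \<forall>s\<in>{0..T}. dist s t < d \<longrightarrow> (\<forall>x. \<bar>R s x - R t x\<bar> \<le> e)"
    have sob: "\<rho> t \<in> sobolev 1 q" if "t \<in> {0..T}" for t using \<rho>C that by (simp add: C_sobolev_def)
    have Rc: "continuous_on UNIV (R t)" "periodic (R t)" if "t \<in> {0..T}" for t
      using osc_bound_continuous[OF reps(1)[OF that] \<alpha>] reps(1)[OF that] by (auto simp: osc_bound_def)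
    have R0: "0 \<le> R t x" if t: "t \<in> {0..T}" for t x
      by (rule cont_AE_ge[OF Rc[OF t]]) (use pos[OF t] reps(3)[OF t] in \<open>eventually_elim, simp\<close>)
    interpret transport T \<rho> u R "1 - 3 / q" B
    proof
      show "periodic (\<rho> t)" if "t \<in> {0..T}" for t by (rule sobolev_periodic[OF sob[OF that]])
      show "integrable torus (\<rho> t)" if "t \<in> {0..T}" for t
        using sobolev_weak_dx[OF sob[OF that], of "[]"] by (simp add: weak_dx_def weak_deriv_def)
    qed (fact T \<alpha> ce uC reps R0)+
    have z: "0 \<in> {0..T}" "T \<in> {0..T}" using T by auto
    show thesis
    proof (rule that[of "R 0" "R T"])
      show "AE x in torus. R 0 x = \<rho>\<^sub>0 x" 
        by (rule eventually_mono[OF eventually_conj[OF reps(3)[OF z(1)] init]]) simp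
      show "\<exists>c'>0. \<forall>x. c' \<le> R 0 x" if "0 < c" "\<And>x. c \<le> R T x" for c
        using initial_lower_bound[OF q uL that] by blast
    qed (fact Rc[OF z(1)] Rc[OF z(2)] reps(3)[OF z(1)] reps(3)[OF z(2)] R0[OF z(2)])+
  qed
qed

theorem theorem1p3:
  fixes \<mu> lam \<gamma> q M :: real
    and \<rho>\<^sub>0 :: "real^3 \<Rightarrow> real" and u\<^sub>0 :: "real^3 \<Rightarrow> real^3" and m\<^sub>0 :: "real^3"
    and K :: ennreal
    and \<rho> :: "real \<Rightarrow> real^3 \<Rightarrow> real" and u :: "real \<Rightarrow> real^3 \<Rightarrow> real^3"
  assumes "\<mu> > 0" and "2 * \<mu> + 3 * lam \<ge> 0" and "\<gamma> > 1"
    and "3 < q" and "q \<le> 6"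
    and "AE x in torus. 0 \<le> \<rho>\<^sub>0 x" and "\<rho>\<^sub>0 \<in> sobolev 1 q"
    and "u\<^sub>0 \<in> sobolev 2 2"
    and "1 / measure torus (space torus) * (\<integral>x. \<rho>\<^sub>0 x \<partial>torus) = 1"
    and "m\<^sub>0 = (\<integral>x. \<rho>\<^sub>0 x *\<^sub>R u\<^sub>0 x \<partial>torus)"
    and "K = Lp_norm 2 (\<lambda>x. \<rho>\<^sub>0 x - 1) + Lp_norm 2 (\<lambda>x. sqrt (\<rho>\<^sub>0 x) *\<^sub>R (u\<^sub>0 x - m\<^sub>0))
             + Lp_norm 2 (weak_grad u\<^sub>0)"
    and "K < \<infinity>"
    and "global_strong_solution \<mu> lam \<gamma> \<rho>\<^sub>0 u\<^sub>0 \<rho> u"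
    and "M > 0" and "(SUP t\<in>{0..}. Linf_norm (\<rho> t)) \<le> ennreal M"
    and "(INF x. cont_rep \<rho>\<^sub>0 x) = 0"
  shows "\<forall>t\<ge>0. (INF x. cont_rep (\<rho> t) x) = 0"
proof (intro allI impI)
  fix t :: real assume "0 \<le> t"
  have sol: "strong_solution \<mu> lam \<gamma> \<rho>\<^sub>0 u\<^sub>0 T \<rho> u" if "0 < T" for T
    using assms(13) that unfolding global_strong_solution_def by blast
  show "(INF x. cont_rep (\<rho> t) x) = 0"
  proof (cases "t = 0")
    case True
    show ?thesis
    proof (rule positivity_backward[OF zero_less_one sol[OF zero_less_one]])
      fix F0 F
      assume F0: "continuous_on UNIV F0" "periodic F0" "AE x in torus. F0 x = \<rho>\<^sub>0 x" "AE x in torus. F0 x = \<rho> 0 x"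
        "continuous_on UNIV F" "periodic F" "AE x in torus. F x = \<rho> 1 x" "\<And>x. 0 \<le> F x"
        "\<And>c. 0 < c \<Longrightarrow> (\<And>x. c \<le> F x) \<Longrightarrow> \<exists>c'>0. \<forall>x. c' \<le> F0 x"
      have "cont_rep \<rho>\<^sub>0 = F0" "cont_rep (\<rho> 0) = F0"
        by (rule cont_rep_eq[OF F0(1,2)], fact F0)+
      then have "cont_rep (\<rho> t) = cont_rep \<rho>\<^sub>0" using True by simp
      then show "(INF x. cont_rep (\<rho> t) x) = 0" using assms(16) by simp
    qed
  next
    case False
    then have t: "0 < t" using \<open>0 \<le> t\<close> by simp
    show ?thesis
    proof (rule positivity_backward[OF t sol[OF t]])
      fix F0 F
      assume X: "continuous_on UNIV F0" "periodic F0" "AE x in torus. F0 x = \<rho>\<^sub>0 x" "AE x in torus. F0 x = \<rho> 0 x"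
        "continuous_on UNIV F" "periodic F" "AE x in torus. F x = \<rho> t x" "\<And>x. 0 \<le> F x"
        "\<And>c. 0 < c \<Longrightarrow> (\<And>x. c \<le> F x) \<Longrightarrow> \<exists>c'>0. \<forall>x. c' \<le> F0 x"
      note F = X(5,6,7,8) and bwd = X(9)
      have e: "cont_rep (\<rho> t) = F" "cont_rep \<rho>\<^sub>0 = F0"
        by (rule cont_rep_eq[OF X(5,6,7)], rule cont_rep_eq[OF X(1,2,3)])
      have bdd: "bdd_below (range F)" using F(4) by (intro bdd_belowI2[of _ 0]) auto
      have "0 \<le> (INF x. F x)" using F(4) by (intro cINF_greatest) auto
      moreover have "\<not> 0 < (INF x. F x)"
      proof
        assume "0 < (INF x. F x)"
        from bwd[OF this cINF_lower[OF bdd]] obtain c where c: "0 < c" "\<And>x. c \<le> F0 x" by blast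
        have "c \<le> (INF x. F0 x)" using c(2) by (intro cINF_greatest) auto
        then show False using c(1) assms(16) e(2) by simp
      qed
      ultimately show "(INF x. cont_rep (\<rho> t) x) = 0" using e(1) by simp
    qed
  qed
qed

end
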